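(* Let $(p_j)_{j\in\mathbb N}$ be any strictly increasing sequence in $[1,\infty)$, let $E=\ell^r$ where $\sup_jp_j\le r\le\infty$ (with the convention that $\ell^\infty$ denotes $c_0$), and let $$X=\Big(\bigoplus_{j=1}^\infty\ell^{p_j}\Big)_E.$$ Then there is a strictly decreasing chain $(\mathcal M_n)_{n\in\mathbb N_0}$ of closed subalgebras of $\mathcal L(X)$ such that $\mathcal M_0=\mathcal S(X)$, and $\mathcal M_n\subset\mathcal M_{n-1}$ is a closed ideal (of $\mathcal M_{n-1}$) for all $n\in\mathbb N$, so that $$\mathcal M_n\in\mathcal{SI}_{n+1}(\mathcal L(X))\setminus\mathcal{SI}_n(\mathcal L(X))$$ for all $n\in\mathbb N$.
   Context: Scalars are real or complex; $\mathbb N=\{1,2,\ldots\}$, $\mathbb N_0=\mathbb N\cup\{0\}$. $\mathcal L(X)$ is the Banach algebra of bounded operators on $X$, and $\mathcal S(X)$ its closed ideal of strictly singular operators (operators whose restriction to any closed infinite-dimensional subspace is not a linear isomorphism onto its image). $n$-subideals: let $\mathcal A$ be a Banach algebra and $n\in\mathbb N$. A subalgebra $\mathcal I\subset\mathcal A$ is an $n$-subideal of $\mathcal A$ if there are subalgebras $\mathcal I=\mathcal J_n\subset\cdots\subset\mathcal J_1\subset\mathcal J_0=\mathcal A$ such that $\mathcal J_k$ is an ideal of $\mathcal J_{k-1}$ for each $k=1,\ldots,n$. It is a closed $n$-subideal if $\mathcal I$ and all $\mathcal J_k$ are closed in $\mathcal A$ (it suffices that $\mathcal I$ is closed). $\mathcal{SI}_n(\mathcal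 A)$ denotes the set of all closed $n$-subideals of $\mathcal A$. *)

theory Defs
  imports "HOL-Analysis.Analysis" "HOL-Library.Function_Algebras"
begin

section \<open>Normed spaces and normed algebras on a carrier set\<close>

text \<open>
  The summands of the space \<open>(\<Oplus>\<^sub>j \<ell>\<^bsup>p\<^sub>j\<^esup>)\<^sub>E\<close> depend on real parameters, so the space cannot be a type.
  Spaces and algebras are therefore given by a carrier inside an ambient abelian group, whose
  \<open>+\<close> and \<open>0\<close> serve as addition and zero.
\<close>

record ('k, 'v) nspace =
  carr :: "'v set"
  smult :: "'k \<Rightarrow> 'v \<Rightarrow> 'v"
  nrm :: "'v \<Rightarrow> real"

record ('k, 'a) nalgebra = "('k, 'a) nspace" +
  amult :: "'a \<Rightarrow> 'a \<Rightarrow> 'a"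

definition subspace_of ::
  "('k::field, 'v::ab_group_add, 'z) nspace_scheme \<Rightarrow> 'v set \<Rightarrow> bool" where
  "subspace_of X Y \<longleftrightarrow> Y \<subseteq> carr X \<and> module.subspace (smult X) Y"

definition finite_dim ::
  "('k::field, 'v::ab_group_add, 'z) nspace_scheme \<Rightarrow> 'v set \<Rightarrow> bool" where
  "finite_dim X Y \<longleftrightarrow> (\<exists>B. finite B \<and> Y = module.span (smult X) B)"

definition norm_closed ::
  "('k, 'v::ab_group_add, 'z) nspace_scheme \<Rightarrow> 'v set \<Rightarrow> bool" where
  "norm_closed X Y \<longleftrightarrow> Y \<subseteq> carr X \<and>
     (\<forall>f x. (\<forall>n. f n \<in> Y) \<and> x \<in> carr X \<and> (\<lambda>n::nat. nrm X (f n - x)) \<longlonglongrightarrow> 0 \<longrightarrow> x \<in> Y)"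

section \<open>Subalgebras, ideals and subideals\<close>

text \<open>Subalgebras need not contain a unit; ideals are two-sided.\<close>

definition subalgebra :: "('k::field, 'a::ab_group_add) nalgebra \<Rightarrow> 'a set \<Rightarrow> bool" where
  "subalgebra A I \<longleftrightarrow> subspace_of A I \<and> (\<forall>x\<in>I. \<forall>y\<in>I. amult A x y \<in> I)"

definition ideal_of ::
  "('k::field, 'a::ab_group_add) nalgebra \<Rightarrow> 'a set \<Rightarrow> 'a set \<Rightarrow> bool" where
  "ideal_of A I J \<longleftrightarrow> I \<subseteq> J \<and> subspace_of A I \<and>
     (\<forall>a\<in>J. \<forall>x\<in>I. amult A a x \<in> I \<and> amult A x a \<in> I)"

definition closed_subideals ::
  "nat \<Rightarrow> ('k::field, 'a::ab_group_add) nalgebra \<Rightarrow> 'a set set" where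
  "closed_subideals n A = {I. \<exists>J :: nat \<Rightarrow> 'a set.
     J 0 = carr A \<and> J n = I \<and>
     (\<forall>k\<le>n. subalgebra A (J k) \<and> norm_closed A (J k)) \<and>
     (\<forall>k<n. ideal_of A (J (Suc k)) (J k))}"

section \<open>Bounded operators and strictly singular operators\<close>

text \<open>
  An operator is a function on the ambient group that vanishes outside the carrier, so that
  operators are equal iff they agree on the carrier, and pointwise addition is operator addition.
\<close>

definition bounded_operators ::
  "('k::field, 'v::ab_group_add) nspace \<Rightarrow> ('k, 'v \<Rightarrow> 'v) nalgebra" where
  "bounded_operators X = \<lparr>
     carr = {T. (\<forall>x\<in>carr X. T x \<in> carr X) \<and> (\<forall>x. x \<notin> carr X \<longrightarrow> T x = 0) \<and>
       (\<forall>x\<in>carr X. \<forall>y\<in>carr X. T (x + y) = T x + T y) \<and>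
       (\<forall>c. \<forall>x\<in>carr X. T (smult X c x) = smult X c (T x)) \<and>
       (\<exists>C. \<forall>x\<in>carr X. nrm X (T x) \<le> C * nrm X x)},
     smult = (\<lambda>c T x. smult X c (T x)),
     nrm = (\<lambda>T. SUP x\<in>{x \<in> carr X. nrm X x \<le> 1}. nrm X (T x)),
     amult = (\<lambda>S T. S \<circ> T)\<rparr>"

text \<open>For a bounded operator \<open>T\<close>, the restriction to \<open>Y\<close> is a linear isomorphism onto its
  image iff it is injective and the inverse on the image is bounded.\<close>

definition isomorphism_on ::
  "('k, 'v) nspace \<Rightarrow> ('v \<Rightarrow> 'v) \<Rightarrow> 'v set \<Rightarrow> bool" where
  "isomorphism_on X T Y \<longleftrightarrow> inj_on T Y \<and>
     (\<exists>C. \<forall>z\<in>T ` Y. nrm X (inv_into Y T z) \<le> C * nrm X z)"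

definition strictly_singular ::
  "('k::field, 'v::ab_group_add) nspace \<Rightarrow> ('v \<Rightarrow> 'v) set" where
  "strictly_singular X = {T \<in> carr (bounded_operators X).
     \<forall>Y. subspace_of X Y \<and> norm_closed X Y \<and> \<not> finite_dim X Y \<longrightarrow> \<not> isomorphism_on X T Y}"

section \<open>Direct sums of sequence spaces\<close>

text \<open>\<open>ell \<infinity>\<close> denotes \<open>c\<^sub>0\<close>; other parameters are meant to lie in \<open>[1, \<infinity>)\<close>.
  Up to isometric isomorphism, the only types of sort \<open>{real_normed_field, euclidean_space}\<close> are
  the real and the complex numbers, so this sort expresses that scalars are real or complex.\<close>

definition ell :: "ereal \<Rightarrow> (nat \<Rightarrow> 'k::real_normed_field) set" where
  "ell r = (if r = \<infinity> then {x. x \<longlonglongrightarrow> 0}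
            else {x. summable (\<lambda>i. norm (x i) powr real_of_ereal r)})"

definition ell_norm :: "ereal \<Rightarrow> (nat \<Rightarrow> 'k::real_normed_field) \<Rightarrow> real" where
  "ell_norm r x = (if r = \<infinity> then (SUP i. norm (x i))
     else (\<Sum>i. norm (x i) powr real_of_ereal r) powr (1 / real_of_ereal r))"

definition ell_sum ::
  "(nat \<Rightarrow> real) \<Rightarrow> ereal \<Rightarrow> ('k::real_normed_field, nat \<Rightarrow> nat \<Rightarrow> 'k) nspace" where
  "ell_sum p r = \<lparr>
     carr = {x. (\<forall>j. x j \<in> ell (p j)) \<and> (\<lambda>j. ell_norm (p j) (x j)) \<in> ell r},
     smult = (\<lambda>c x j i. c * x j i),
     nrm = (\<lambda>x. ell_norm r (\<lambda>j. ell_norm (p j) (x j)))\<rparr>"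

text \<open>The locale assumption behind \<open>module.subspace\<close> and \<open>module.span\<close> holds for the
  scalar multiplications used here.\<close>

lemma vector_space_ell_sum: "vector_space (smult (ell_sum p r))"
  by unfold_locales (auto simp: ell_sum_def fun_eq_iff algebra_simps)

lemma vector_space_bounded_operators:
  "vector_space (smult X) \<Longrightarrow> vector_space (smult (bounded_operators X))"
  by (auto simp: bounded_operators_def vector_space_def fun_eq_iff)

end

theory Submission
  imports Defs
begin

text \<open>
  Write \<open>J\<^sub>j : \<ell>\<^bsup>p\<^sub>j\<^esup> \<rightarrow> \<ell>\<^bsup>p\<^sub>j\<^sub>+\<^sub>1\<^esup>\<close> for the formal inclusion. It is strictly singular but not compact, whereas
  a strictly singular operator on \<open>X\<close> acts compactly, roughly speaking, from a block \<open>j \<ge> 1\<close> to the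
  blocks \<open>l \<le> j\<close>. Modulo compact parts the algebra \<open>S(X)\<close> is therefore strictly triangular with
  respect to the blocks, and subideals can be built as in algebras of strictly triangular matrices.

  Split the index set of each block into odd and even indices. The algebra \<open>M\<^sub>n\<close> (\<open>chain n\<close>)
  consists of the strictly singular \<open>T\<close> which, for \<open>i \<ge> 1\<close> and \<open>1 \<le> k \<le> n\<close>, map the odd part of
  block \<open>i\<close> into the odd part of block \<open>i + k\<close>, up to a compact operator. Compactness is tested on
  bounded coordinatewise null sequences; blocks \<open>i \<ge> 1\<close> have \<open>p\<^sub>i > 1\<close>, so that such sequences are
  weakly null there. These conditions are closed and linear, and everything follows from two facts.

  First, \<open>M\<^sub>n M\<^sub>n \<subseteq> M\<^sub>n\<^sub>+\<^sub>1\<close> (\<open>chain_product\<close>): a path from block \<open>i\<close> to block \<open>i + n + 1\<close> through an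
  intermediate block makes two steps of length at most \<open>n\<close>, each of which respects oddness, and paths
  that leave the range between the two blocks contribute compactly. Hence \<open>M\<^sub>n\<^sub>+\<^sub>1\<close> is an ideal of
  \<open>M\<^sub>n\<close>.

  Second, every \<open>J\<^sub>j\<close> lies in every \<open>M\<^sub>n\<close>. If \<open>M\<^sub>n\<close> were an \<open>n\<close>-subideal, with a chain
  \<open>L(X) = I\<^sub>0 \<supseteq> \<dots> \<supseteq> I\<^sub>n = M\<^sub>n\<close>, then for the index shift \<open>a\<close> one would get \<open>a J\<^sub>1 \<in> I\<^sub>1\<close>,
  \<open>J\<^sub>2 a J\<^sub>1 \<in> I\<^sub>2\<close>, and so on up to \<open>J\<^sub>n \<dots> J\<^sub>2 a J\<^sub>1 \<in> I\<^sub>n = M\<^sub>n\<close>. But this word maps odd unit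
  vectors of block \<open>1\<close> to even unit vectors of block \<open>n + 1\<close> (\<open>chain_not_subideal\<close>).

  The analytic input is that \<open>X\<close> is a solid space of double sequences in which finitely supported
  sequences are dense, so that gliding hump arguments work (\<open>gliding_hump\<close>), together with two
  estimates for disjointly supported vectors: an upper \<open>p\<^sub>b\<close>-estimate on the blocks \<open>\<ge> b\<close> and lower
  \<open>q\<close>-estimates on a single block \<open>j\<close> for \<open>q \<ge> p\<^sub>j\<close>. An operator from a part with
  upper \<open>q\<close>-estimates to a part with lower \<open>q\<close>-estimates that does not act compactly fixes a copy of
  \<open>\<ell>\<^sup>q\<close>, so a strictly singular one acts compactly (\<open>SS_null_sequence\<close>). An operator from a part with
  lower \<open>p\<close>-estimates to a part with upper \<open>q\<close>-estimates, \<open>p < q\<close>, is strictly singular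
  (\<open>SS_between_estimates\<close>); this applies to \<open>J\<^sub>j\<close>.
\<close>

section \<open>Sequence spaces\<close>

lemma convex_on_powr_nonneg:
  assumes "1 \<le> s"
  shows "convex_on {0..} (\<lambda>x::real. x powr s)"
proof (rule convex_onI)
  fix t x y :: real
  assume t: "0 < t" "t < 1" and xy: "x \<in> {0..}" "y \<in> {0..}"
  have le: "c powr s \<le> c" if "0 \<le> c" "c \<le> 1" for c :: real
    using that assms powr_mono'[of 1 s c] by (cases "c = 0") auto
  consider "x = 0" | "y = 0" | "x > 0" "y > 0"
    using xy by force
  then show "((1 - t) *\<^sub>R x + t *\<^sub>R y) powr s \<le> (1 - t) * x powr s + t * y powr s"
  proof cases
    case 1
    then show ?thesis
      using t xy le[of t] by (simp add: powr_mult mult_right_mono)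
  next
    case 2
    then show ?thesis
      using t xy le[of "1 - t"] by (simp add: powr_mult mult_right_mono)
  next
    case 3
    then show ?thesis
      using convex_onD[OF powr_convex[OF assms], of t x y] t by simp
  qed
qed simp

text \<open>
Minkowski's inequality for finitely many summands at once. Dividing by the norms \<open>\<alpha> k\<close> turns the sum
into a convex combination with weights \<open>\<alpha> k / S\<close>, to which the convexity of \<open>x powr s\<close> applies
pointwise.
\<close>

lemma minkowski_series:
  fixes u :: "'a \<Rightarrow> nat \<Rightarrow> real"
  assumes s: "1 \<le> s" and I: "finite I"
    and u: "\<And>k j. k \<in> I \<Longrightarrow> 0 \<le> u k j"
    and sum: "\<And>k. k \<in> I \<Longrightarrow> summable (\<lambda>j. u k j powr s)"
  shows "summable (\<lambda>j. (\<Sum>k\<in>I. u k j) powr s)"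
    and "(\<Sum>j. (\<Sum>k\<in>I. u k j) powr s) powr (1 / s) \<le> (\<Sum>k\<in>I. (\<Sum>j. u k j powr s) powr (1 / s))"
proof -
  define \<alpha> where "\<alpha> k = (\<Sum>j. u k j powr s) powr (1 / s)" for k
  define S where "S = sum \<alpha> I"
  have \<alpha>0: "0 \<le> \<alpha> k" for k
    by (simp add: \<alpha>_def)
  have \<alpha>s: "\<alpha> k powr s = (\<Sum>j. u k j powr s)" if "k \<in> I" for k
    using s suminf_nonneg[OF sum[OF that]] by (simp add: \<alpha>_def powr_powr)
  have u0: "u k j = 0" if "k \<in> I" "\<alpha> k = 0" for k j
  proof -
    have "(\<Sum>j. u k j powr s) = 0"
      using \<alpha>s[OF that(1)] that(2) by simp
    then show ?thesis
      using suminf_eq_zero_iff[OF sum[OF that(1)]] by simp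
  qed
  have "summable (\<lambda>j. (\<Sum>k\<in>I. u k j) powr s) \<and>
    (\<Sum>j. (\<Sum>k\<in>I. u k j) powr s) powr (1 / s) \<le> S"
  proof (cases "S = 0")
    case True
    then have "\<alpha> k = 0" if "k \<in> I" for k
      using that I \<alpha>0 by (simp add: S_def sum_nonneg_eq_0_iff)
    then have "(\<Sum>k\<in>I. u k j) = 0" for j
      using u0 by simp
    then show ?thesis
      using True by simp
  next
    case False
    have S: "S > 0"
      using False \<alpha>0 sum_nonneg[of I \<alpha>] by (simp add: S_def order_less_le)
    have "I \<noteq> {}"
      using False by (auto simp: S_def)
    define g where "g j = S powr s * (\<Sum>k\<in>I. (\<alpha> k / S) * (u k j / \<alpha> k) powr s)" for j
    have le: "(\<Sum>k\<in>I. u k j) powr s \<le> g j" for j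
    proof -
      have "(\<Sum>k\<in>I. u k j) = S * (\<Sum>k\<in>I. (\<alpha> k / S) *\<^sub>R (u k j / \<alpha> k))"
        using S u0 by (simp add: sum_distrib_left) (rule sum.cong, auto)
      moreover have "(\<Sum>k\<in>I. (\<alpha> k / S) *\<^sub>R (u k j / \<alpha> k)) powr s
          \<le> (\<Sum>k\<in>I. (\<alpha> k / S) * (u k j / \<alpha> k) powr s)"
      proof (rule convex_on_sum[OF I \<open>I \<noteq> {}\<close> convex_on_powr_nonneg[OF s]])
        show "(\<Sum>k\<in>I. \<alpha> k / S) = 1"
          using S by (simp add: S_def flip: sum_divide_distrib)
      qed (use S \<alpha>0 u in auto)
      moreover have "0 \<le> (\<Sum>k\<in>I. (\<alpha> k / S) *\<^sub>R (u k j / \<alpha> k))"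
        using S \<alpha>0 u by (intro sum_nonneg) auto
      ultimately show ?thesis
        using S by (simp add: g_def powr_mult mult_left_mono)
    qed
    have "g sums (S powr s * (\<Sum>k\<in>I. \<alpha> k / S))"
      unfolding g_def
    proof (intro sums_mult sums_sum)
      fix k assume k: "k \<in> I"
      show "(\<lambda>j. (\<alpha> k / S) * (u k j / \<alpha> k) powr s) sums (\<alpha> k / S)"
      proof (cases "\<alpha> k = 0")
        case False
        have "(\<lambda>j. (\<alpha> k / S) * (u k j powr s / \<alpha> k powr s)) sums
            ((\<alpha> k / S) * ((\<Sum>j. u k j powr s) / \<alpha> k powr s))"
          by (intro sums_mult sums_divide summable_sums sum k)
        then show ?thesis
          unfolding \<alpha>s[OF k, symmetric] using False \<alpha>0[of k] u[OF k] by (simp add: powr_divide)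
      qed simp
    qed
    then have g: "g sums (S powr s)"
      using S by (simp add: S_def flip: sum_divide_distrib)
    have summ: "summable (\<lambda>j. (\<Sum>k\<in>I. u k j) powr s)"
      by (rule summable_comparison_test'[OF sums_summable[OF g], of 0]) (use le in auto)
    have "(\<Sum>j. (\<Sum>k\<in>I. u k j) powr s) \<le> S powr s"
      using suminf_le[OF le summ sums_summable[OF g]] sums_unique[OF g] by simp
    then have "(\<Sum>j. (\<Sum>k\<in>I. u k j) powr s) powr (1 / s) \<le> (S powr s) powr (1 / s)"
      using s by (intro powr_mono2 suminf_nonneg summ) auto
    then show ?thesis
      using summ S s by (simp add: powr_powr)
  qed
  then show "summable (\<lambda>j. (\<Sum>k\<in>I. u k j) powr s)"
    and "(\<Sum>j. (\<Sum>k\<in>I. u k j) powr s) powr (1 / s) \<le> (\<Sum>k\<in>I. (\<Sum>j. u k j powr s) powr (1 / s))"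
    by (simp_all add: S_def \<alpha>_def)
qed

lemma ell_norm_of_norm: "ell_norm r (\<lambda>i. norm (x i)) = ell_norm r x"
  by (simp add: ell_norm_def)

lemma norm_in_ell_iff: "(\<lambda>i. norm (x i)) \<in> ell r \<longleftrightarrow> x \<in> ell r"
  by (simp add: ell_def tendsto_norm_zero_iff)

lemma bdd_above_null_sequence:
  fixes x :: "nat \<Rightarrow> 'k::real_normed_field"
  assumes "x \<longlonglongrightarrow> 0"
  shows "bdd_above (range (\<lambda>i. norm (x i)))"
proof -
  have "Bseq x"
    using assms by (intro convergent_imp_Bseq convergentI)
  then obtain K where "\<And>i. norm (x i) \<le> K"
    by (auto simp: Bseq_def)
  then show ?thesis
    by (auto intro!: bdd_aboveI)
qed

lemma norm_le_ell_norm: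
  assumes "1 \<le> r" "x \<in> ell r"
  shows "norm (x i) \<le> ell_norm r x"
proof (cases "r = \<infinity>")
  case True
  then show ?thesis
    using assms bdd_above_null_sequence[of x] by (auto simp: ell_def ell_norm_def intro!: cSUP_upper)
next
  case False
  then obtain \<rho> where \<rho>: "r = ereal \<rho>" "1 \<le> \<rho>"
    using assms by (cases r) auto
  have "norm (x i) powr \<rho> \<le> (\<Sum>i. norm (x i) powr \<rho>)"
    using assms \<rho> sum_le_suminf[of "\<lambda>i. norm (x i) powr \<rho>" "{i}"] by (auto simp: ell_def)
  then have "(norm (x i) powr \<rho>) powr (1/\<rho>) \<le> (\<Sum>i. norm (x i) powr \<rho>) powr (1/\<rho>)"
    using \<rho> by (intro powr_mono2) auto
  then show ?thesis
    using \<rho> by (simp add: powr_powr ell_norm_def)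
qed

lemma ell_norm_nonneg: "1 \<le> r \<Longrightarrow> x \<in> ell r \<Longrightarrow> 0 \<le> ell_norm r x"
  using norm_le_ell_norm[of r x 0] norm_ge_zero[of "x 0"] by linarith

lemma ell_solid:
  assumes r: "1 \<le> r" and y: "y \<in> ell r" and le: "\<And>i. norm (x i) \<le> norm (y i)"
  shows "x \<in> ell r" and "ell_norm r x \<le> ell_norm r y"
proof -
  have "x \<in> ell r \<and> ell_norm r x \<le> ell_norm r y"
  proof (cases "r = \<infinity>")
    case True
    have "x \<longlonglongrightarrow> 0"
      by (rule Lim_null_comparison[of _ "\<lambda>i. norm (y i)"])
        (use True y le in \<open>auto simp: ell_def tendsto_norm_zero_iff\<close>)
    moreover have "ell_norm r x \<le> ell_norm r y"
      using True y bdd_above_null_sequence[of y] le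
      by (auto simp: ell_def ell_norm_def intro!: cSUP_mono)
    ultimately show ?thesis
      using True by (simp add: ell_def)
  next
    case False
    then obtain \<rho> where \<rho>: "r = ereal \<rho>" "1 \<le> \<rho>"
      using r by (cases r) auto
    have pw: "norm (x i) powr \<rho> \<le> norm (y i) powr \<rho>" for i
      using le \<rho> by (intro powr_mono2) auto
    have sy: "summable (\<lambda>i. norm (y i) powr \<rho>)"
      using y \<rho> by (simp add: ell_def)
    have sx: "summable (\<lambda>i. norm (x i) powr \<rho>)"
      by (rule summable_comparison_test'[OF sy, of 0]) (use pw in auto)
    then show ?thesis
      using \<rho> suminf_le[OF pw sx sy] suminf_nonneg[OF sx]
      by (auto simp: ell_def ell_norm_def intro!: powr_mono2)
  qed
  then show "x \<in> ell r" "ell_norm r x \<le> ell_norm r y"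
    by auto
qed

text \<open>
The \<open>q\<close>-convexity of \<open>\<ell>\<^sup>r\<close> for \<open>q \<le> r\<close>, which is the triangle inequality in \<open>\<ell>\<^bsup>r/q\<^esup>\<close> for the
sequences \<open>t k j powr q\<close>. The case \<open>q = 1\<close> is the triangle inequality of \<open>\<ell>\<^sup>r\<close> itself; for disjointly
supported sequences the left-hand side is the norm of the sum, and one obtains an upper estimate.
\<close>

lemma ell_convexity:
  fixes t :: "'a \<Rightarrow> nat \<Rightarrow> real"
  assumes q: "1 \<le> q" "ereal q \<le> r" and I: "finite I"
    and t: "\<And>k. k \<in> I \<Longrightarrow> t k \<in> ell r" "\<And>k j. k \<in> I \<Longrightarrow> 0 \<le> t k j"
  defines "w \<equiv> \<lambda>j. (\<Sum>k\<in>I. t k j powr q) powr (1 / q)"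
  shows "w \<in> ell r" and "ell_norm r w \<le> (\<Sum>k\<in>I. ell_norm r (t k) powr q) powr (1 / q)"
proof -
  have "w \<in> ell r \<and> ell_norm r w \<le> (\<Sum>k\<in>I. ell_norm r (t k) powr q) powr (1 / q)"
  proof (cases "r = \<infinity>")
    case True
    have "(\<lambda>j. (\<Sum>k\<in>I. t k j powr q) powr (1 / q)) \<longlonglongrightarrow> 0"
    proof (rule tendsto_zero_powrI[OF _ tendsto_const])
      show "(\<lambda>j. \<Sum>k\<in>I. t k j powr q) \<longlonglongrightarrow> 0"
      proof (rule tendsto_null_sum)
        fix k assume "k \<in> I"
        then show "(\<lambda>j. t k j powr q) \<longlonglongrightarrow> 0"
          using t True q by (intro tendsto_zero_powrI[OF _ tendsto_const]) (auto simp: ell_def)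
      qed
    qed (use q in \<open>auto intro!: sum_nonneg always_eventually\<close>)
    moreover have "norm (w j) \<le> (\<Sum>k\<in>I. ell_norm r (t k) powr q) powr (1 / q)" for j
    proof -
      have "t k j \<le> ell_norm r (t k)" if "k \<in> I" for k
        using norm_le_ell_norm[OF _ t(1)[OF that], of j] True by simp
      then show ?thesis
        unfolding w_def using q t by (auto intro!: powr_mono2 sum_mono sum_nonneg)
    qed
    ultimately show ?thesis
      using True unfolding w_def by (auto simp: ell_def ell_norm_def intro!: cSUP_least)
  next
    case False
    then obtain \<rho> where \<rho>: "r = ereal \<rho>" "q \<le> \<rho>"
      using q by (cases r) auto
    have s: "1 \<le> \<rho> / q"
      using \<rho> q by (simp add: field_simps)
    have pw: "(t k j powr q) powr (\<rho> / q) = t k j powr \<rho>" for k j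
      using q by (simp add: powr_powr)
    have "summable (\<lambda>j. (t k j powr q) powr (\<rho> / q))" if "k \<in> I" for k
      using t[OF that] \<rho> unfolding pw by (simp add: ell_def)
    note M = minkowski_series[OF s I _ this, unfolded pw]
    have w: "norm (w j) powr \<rho> = (\<Sum>k\<in>I. t k j powr q) powr (\<rho> / q)" for j
      by (simp add: w_def powr_powr)
    have sw: "summable (\<lambda>j. norm (w j) powr \<rho>)"
      unfolding w by (rule M(1)) auto
    have "(\<Sum>j. norm (w j) powr \<rho>) powr (q / \<rho>) \<le> (\<Sum>k\<in>I. (\<Sum>j. t k j powr \<rho>) powr (q / \<rho>))"
      unfolding w using M(2) by simp
    also have "\<dots> = (\<Sum>k\<in>I. ell_norm r (t k) powr q)"
      using t \<rho> q by (intro sum.cong) (auto simp: ell_norm_def powr_powr)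
    finally have "((\<Sum>j. norm (w j) powr \<rho>) powr (q / \<rho>)) powr (1 / q)
        \<le> (\<Sum>k\<in>I. ell_norm r (t k) powr q) powr (1 / q)"
      using q by (intro powr_mono2) auto
    then show ?thesis
      using sw \<rho> q by (auto simp: ell_def ell_norm_def powr_powr)
  qed
  then show "w \<in> ell r" "ell_norm r w \<le> (\<Sum>k\<in>I. ell_norm r (t k) powr q) powr (1 / q)"
    by auto
qed

lemma ell_triangle:
  fixes x y :: "nat \<Rightarrow> 'k::real_normed_field"
  assumes r: "1 \<le> r" and x: "x \<in> ell r" and y: "y \<in> ell r"
  shows "(\<lambda>i. x i + y i) \<in> ell r" and "ell_norm r (\<lambda>i. x i + y i) \<le> ell_norm r x + ell_norm r y"
proof -
  define t where "t b i = norm (if b then x i else y i)" for b i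
  have tb: "t True = (\<lambda>i. norm (x i))" "t False = (\<lambda>i. norm (y i))"
    by (auto simp: t_def)
  have t: "t b \<in> ell r" for b
    using x y by (cases b) (auto simp: tb norm_in_ell_iff)
  have t0: "0 \<le> t b i" for b i
    by (simp add: t_def)
  note C = ell_convexity[of 1 r UNIV t, OF _ _ _ t t0]
  have *: "((\<Sum>k\<in>UNIV. t k j powr 1) powr (1 / 1)) = norm (x j) + norm (y j)" for j
    by (simp add: UNIV_bool t_def)
  have **: "(\<Sum>k\<in>UNIV. ell_norm r (t k) powr 1) powr (1 / 1) = ell_norm r x + ell_norm r y"
    using ell_norm_nonneg[OF r x] ell_norm_nonneg[OF r y]
    by (simp add: UNIV_bool tb ell_norm_of_norm)
  have C1: "(\<lambda>j. norm (x j) + norm (y j)) \<in> ell r"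
    and C2: "ell_norm r (\<lambda>j. norm (x j) + norm (y j)) \<le> ell_norm r x + ell_norm r y"
    using C r unfolding * ** by (auto simp: one_ereal_def)
  have le: "norm (x i + y i) \<le> norm (norm (x i) + norm (y i))" for i
    using norm_triangle_ineq[of "x i" "y i"] by simp
  show "(\<lambda>i. x i + y i) \<in> ell r"
    by (rule ell_solid(1)[OF r C1 le])
  show "ell_norm r (\<lambda>i. x i + y i) \<le> ell_norm r x + ell_norm r y"
    using ell_solid(2)[OF r C1 le] C2 by linarith
qed

lemma ell_scale:
  fixes x :: "nat \<Rightarrow> 'k::real_normed_field"
  assumes r: "1 \<le> r" and x: "x \<in> ell r"
  shows "(\<lambda>i. c * x i) \<in> ell r" and "ell_norm r (\<lambda>i. c * x i) \<le> norm c * ell_norm r x"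
proof -
  have "(\<lambda>i. c * x i) \<in> ell r \<and> ell_norm r (\<lambda>i. c * x i) \<le> norm c * ell_norm r x"
  proof (cases "r = \<infinity>")
    case True
    have "norm (c * x i) \<le> norm c * ell_norm r x" for i
      using norm_le_ell_norm[OF r x, of i] by (simp add: norm_mult mult_left_mono)
    then show ?thesis
      using True x by (auto simp: ell_def ell_norm_def intro!: tendsto_mult_right_zero cSUP_least)
  next
    case False
    then obtain \<rho> where \<rho>: "r = ereal \<rho>" "1 \<le> \<rho>"
      using r by (cases r) auto
    have sx: "summable (\<lambda>i. norm (x i) powr \<rho>)"
      using x \<rho> by (simp add: ell_def)
    have "(\<Sum>i. norm (c * x i) powr \<rho>) = norm c powr \<rho> * (\<Sum>i. norm (x i) powr \<rho>)"
      using suminf_mult[OF sx] by (simp add: norm_mult powr_mult)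
    moreover have "summable (\<lambda>i. norm (c * x i) powr \<rho>)"
      using summable_mult[OF sx, of "norm c powr \<rho>"] by (simp add: norm_mult powr_mult)
    ultimately show ?thesis
      using \<rho> suminf_nonneg[OF sx] by (auto simp: ell_def ell_norm_def powr_mult powr_powr)
  qed
  then show "(\<lambda>i. c * x i) \<in> ell r" "ell_norm r (\<lambda>i. c * x i) \<le> norm c * ell_norm r x"
    by auto
qed

lemma ell_tail:
  fixes x :: "nat \<Rightarrow> 'k::real_normed_field"
  assumes r: "1 \<le> r" and x: "x \<in> ell r"
  shows "(\<lambda>n. ell_norm r (\<lambda>i. if n \<le> i then x i else 0)) \<longlonglongrightarrow> 0"
proof (cases "r = \<infinity>")
  case True
  then have x0: "x \<longlonglongrightarrow> 0"
    using x by (simp add: ell_def)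
  show ?thesis
  proof (rule LIMSEQ_I)
    fix e :: real assume e: "0 < e"
    then obtain n0 where n0: "\<And>i. n0 \<le> i \<Longrightarrow> norm (x i) < e / 2"
      using LIMSEQ_D[OF x0, of "e / 2"] by auto
    have "norm (ell_norm r (\<lambda>i. if n \<le> i then x i else 0) - 0) < e" if "n0 \<le> n" for n
    proof -
      have mem: "(\<lambda>i. if n \<le> i then x i else 0) \<in> ell r"
        by (rule ell_solid(1)[OF r x]) auto
      have "ell_norm r (\<lambda>i. if n \<le> i then x i else 0) \<le> e / 2"
        unfolding ell_norm_def if_P[OF True]
      proof (rule cSUP_least)
        fix i
        show "norm (if n \<le> i then x i else 0) \<le> e / 2"
          using n0[of i] that e by auto
      qed simp
      then show ?thesis
        using e ell_norm_nonneg[OF r mem] by simp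
    qed
    then show "\<exists>no. \<forall>n\<ge>no. norm (ell_norm r (\<lambda>i. if n \<le> i then x i else 0) - 0) < e"
      by blast
  qed
next
  case False
  then obtain \<rho> where \<rho>: "r = ereal \<rho>" "1 \<le> \<rho>"
    using r by (cases r) auto
  define f where "f i = norm (x i) powr \<rho>" for i
  have sf: "summable f"
    using x \<rho> unfolding f_def by (simp add: ell_def)
  have eq: "(\<Sum>i. norm (if n \<le> i then x i else 0) powr \<rho>) = suminf f - sum f {..<n}" for n
  proof -
    have *: "(\<lambda>i. norm (if n \<le> i then x i else 0) powr \<rho>) = (\<lambda>i. f i - (if i \<in> {..<n} then f i else 0))"
      by (auto simp: f_def)
    show ?thesis
      unfolding *
      by (rule sums_unique[symmetric]) (intro sums_diff summable_sums[OF sf] sums_If_finite_set, simp)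
  qed
  have "(\<lambda>n. suminf f - sum f {..<n}) \<longlonglongrightarrow> suminf f - suminf f"
    by (intro tendsto_diff tendsto_const summable_LIMSEQ sf)
  then have "(\<lambda>n. (suminf f - sum f {..<n}) powr (1 / \<rho>)) \<longlonglongrightarrow> 0"
    using \<rho> by (intro tendsto_zero_powrI[OF _ tendsto_const])
      (use sum_le_suminf[OF sf] in \<open>auto intro!: always_eventually simp: f_def\<close>)
  then show ?thesis
    using \<rho> eq by (simp add: ell_norm_def)
qed

lemma ell_single:
  fixes c :: "'k::real_normed_field"
  assumes r: "1 \<le> r"
  shows "(\<lambda>i. if i = j then c else 0) \<in> ell r" and "ell_norm r (\<lambda>i. if i = j then c else 0) = norm c"
proof -
  have "(\<lambda>i. if i = j then c else 0) \<in> ell r \<and> ell_norm r (\<lambda>i. if i = j then c else 0) = norm c"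
  proof (cases "r = \<infinity>")
    case True
    have "(\<lambda>i. if i = j then c else 0) \<longlonglongrightarrow> 0"
      by (rule tendsto_eventually, rule eventually_mono[OF eventually_gt_at_top[of j]]) auto
    then have mem: "(\<lambda>i. if i = j then c else 0) \<in> ell r"
      using True by (simp add: ell_def)
    have "ell_norm r (\<lambda>i. if i = j then c else 0) \<le> norm c"
      using True by (auto simp: ell_norm_def intro!: cSUP_least)
    then show ?thesis
      using mem norm_le_ell_norm[OF r mem, of j] by simp
  next
    case False
    then obtain \<rho> where \<rho>: "r = ereal \<rho>" "1 \<le> \<rho>"
      using r by (cases r) auto
    have *: "(\<lambda>i. norm (if i = j then c else 0) powr \<rho>) = (\<lambda>i. if i = j then norm c powr \<rho> else 0)"
      by auto
    have "(\<lambda>i. norm (if i = j then c else 0) powr \<rho>) sums (norm c powr \<rho>)"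
      unfolding * by (rule sums_single)
    then show ?thesis
      using \<rho> by (auto simp: ell_def ell_norm_def sums_iff powr_powr)
  qed
  then show "(\<lambda>i. if i = j then c else 0) \<in> ell r" "ell_norm r (\<lambda>i. if i = j then c else 0) = norm c"
    by auto
qed

lemma ell_shift:
  fixes x :: "nat \<Rightarrow> 'k::real_normed_field"
  assumes r: "1 \<le> r" and x: "x \<in> ell r"
  defines "y \<equiv> \<lambda>i. if i = 0 then 0 else x (i - 1)"
  shows "y \<in> ell r" and "ell_norm r y = ell_norm r x"
proof -
  have Suc: "y (Suc i) = x i" and zero: "y 0 = 0" for i
    by (auto simp: y_def)
  have "y \<in> ell r \<and> ell_norm r y = ell_norm r x"
  proof (cases "r = \<infinity>")
    case True
    have y: "y \<longlonglongrightarrow> 0"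
      by (subst filterlim_sequentially_Suc[symmetric]) (use x True in \<open>simp add: Suc ell_def\<close>)
    then have mem: "y \<in> ell r"
      using True by (simp add: ell_def)
    have "norm (y i) \<le> ell_norm r x" for i
      using norm_le_ell_norm[OF r x] ell_norm_nonneg[OF r x] by (auto simp: y_def)
    moreover have "norm (x i) \<le> ell_norm r y" for i
      using norm_le_ell_norm[OF r mem, of "Suc i"] by (simp add: Suc)
    ultimately have "ell_norm r y \<le> ell_norm r x" "ell_norm r x \<le> ell_norm r y"
      using True by (auto simp: ell_norm_def intro!: cSUP_least)
    then show ?thesis
      using mem by auto
  next
    case False
    then obtain \<rho> where \<rho>: "r = ereal \<rho>" "1 \<le> \<rho>"
      using r by (cases r) auto
    have sx: "summable (\<lambda>i. norm (x i) powr \<rho>)"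
      using x \<rho> by (simp add: ell_def)
    have "(\<lambda>i. norm (y (Suc i)) powr \<rho>) sums (\<Sum>i. norm (x i) powr \<rho>)"
      unfolding Suc by (rule summable_sums[OF sx])
    then have "(\<lambda>i. norm (y i) powr \<rho>) sums (\<Sum>i. norm (x i) powr \<rho>)"
      by (subst (asm) sums_Suc_iff) (simp add: zero)
    then show ?thesis
      using \<rho> by (auto simp: ell_def ell_norm_def sums_iff)
  qed
  then show "y \<in> ell r" "ell_norm r y = ell_norm r x"
    by auto
qed

text \<open>
Superadditivity of \<open>x powr \<theta>\<close>: each factor \<open>S k powr (\<theta> - 1)\<close> is bounded by the same power of the
total sum.
\<close>

lemma sum_powr_le_powr_sum:
  fixes S :: "'a \<Rightarrow> real"
  assumes "1 \<le> \<theta>" "finite I" "\<And>k. k \<in> I \<Longrightarrow> 0 \<le> S k"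
  shows "(\<Sum>k\<in>I. S k powr \<theta>) \<le> (\<Sum>k\<in>I. S k) powr \<theta>"
proof (cases "sum S I = 0")
  case True
  then have "S k = 0" if "k \<in> I" for k
    using that assms by (simp add: sum_nonneg_eq_0_iff)
  then show ?thesis
    by simp
next
  case False
  have pos: "0 < sum S I"
    using False assms by (simp add: order_less_le sum_nonneg)
  have split: "x powr \<theta> = x * x powr (\<theta> - 1)" if "0 \<le> x" for x :: real
    using that powr_add[of x 1 "\<theta> - 1"] by (cases "x = 0") auto
  have "S k powr \<theta> \<le> S k * sum S I powr (\<theta> - 1)" if "k \<in> I" for k
    using that assms split[of "S k"] member_le_sum[of k I S]
    by (auto intro!: mult_left_mono powr_mono2)
  then have "(\<Sum>k\<in>I. S k powr \<theta>) \<le> (\<Sum>k\<in>I. S k * sum S I powr (\<theta> - 1))"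
    by (intro sum_mono) auto
  then show ?thesis
    using split[of "sum S I"] pos by (simp flip: sum_distrib_right)
qed

text \<open>
On disjointly supported sequences the \<open>p\<close>-th power of the norm is additive, and passing from \<open>p\<close> to a
larger exponent only decreases the norm of the sequence of norms.
\<close>

lemma ell_lower_estimate:
  fixes c :: "'a \<Rightarrow> nat \<Rightarrow> 'k::real_normed_field"
  assumes p: "1 \<le> p" "p \<le> q" and I: "finite I"
    and c: "\<And>k. k \<in> I \<Longrightarrow> c k \<in> ell (ereal p)"
    and disj: "\<And>i k l. k \<in> I \<Longrightarrow> l \<in> I \<Longrightarrow> c k i \<noteq> 0 \<Longrightarrow> c l i \<noteq> 0 \<Longrightarrow> k = l"
  shows "(\<Sum>k\<in>I. ell_norm (ereal p) (c k) powr q) powr (1 / q) \<le> ell_norm (ereal p) (\<lambda>i. \<Sum>k\<in>I. c k i)"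
proof -
  define S where "S k = (\<Sum>i. norm (c k i) powr p)" for k
  have sc: "summable (\<lambda>i. norm (c k i) powr p)" if "k \<in> I" for k
    using c[OF that] by (simp add: ell_def)
  have S0: "0 \<le> S k" if "k \<in> I" for k
    unfolding S_def by (rule suminf_nonneg[OF sc[OF that]]) auto
  have pw: "norm (\<Sum>k\<in>I. c k i) powr p = (\<Sum>k\<in>I. norm (c k i) powr p)" for i
  proof (cases "\<exists>k\<in>I. c k i \<noteq> 0")
    case True
    then obtain k where k: "k \<in> I" "c k i \<noteq> 0"
      by auto
    have z: "c l i = 0" if "l \<in> I - {k}" for l
      using disj[of k l i] k that by auto
    show ?thesis
      using sum.remove[OF I k(1), of "\<lambda>k. c k i"] sum.remove[OF I k(1), of "\<lambda>k. norm (c k i) powr p"] z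
      by simp
  qed simp
  have tot: "(\<Sum>i. norm (\<Sum>k\<in>I. c k i) powr p) = sum S I"
    unfolding pw S_def using suminf_sum[of I "\<lambda>k i. norm (c k i) powr p"] sc by auto
  have "(\<Sum>k\<in>I. ell_norm (ereal p) (c k) powr q) = (\<Sum>k\<in>I. S k powr (q / p))"
    by (simp add: ell_norm_def S_def powr_powr)
  also have "\<dots> \<le> (sum S I) powr (q / p)"
    using p I S0 by (intro sum_powr_le_powr_sum) auto
  finally have "(\<Sum>k\<in>I. ell_norm (ereal p) (c k) powr q) powr (1 / q)
      \<le> (sum S I powr (q / p)) powr (1 / q)"
    using p by (intro powr_mono2 sum_nonneg) auto
  then show ?thesis
    using p by (simp add: ell_norm_def tot powr_powr)
qed

lemma ell_mono_exponent:
  fixes x :: "nat \<Rightarrow> 'k::real_normed_field"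
  assumes p: "1 \<le> p" "p \<le> q" and x: "x \<in> ell (ereal p)"
  shows "x \<in> ell (ereal q)" and "ell_norm (ereal q) x \<le> ell_norm (ereal p) x"
proof -
  define c where "c = ell_norm (ereal p) x"
  have c0: "0 \<le> c" and le: "norm (x i) \<le> c" for i
    using p ell_norm_nonneg[OF _ x] norm_le_ell_norm[OF _ x, of i] by (auto simp: c_def one_ereal_def)
  have sx: "summable (\<lambda>i. norm (x i) powr p)"
    using x by (simp add: ell_def)
  have cp: "c powr p = (\<Sum>i. norm (x i) powr p)"
    using p suminf_nonneg[OF sx] by (simp add: c_def ell_norm_def powr_powr)
  have pw: "norm (x i) powr q \<le> c powr (q - p) * norm (x i) powr p" for i
  proof -
    have "norm (x i) powr q = norm (x i) powr (q - p) * norm (x i) powr p"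
      using powr_add[of "norm (x i)" "q - p" p] by simp
    then show ?thesis
      using le[of i] p by (auto intro!: mult_right_mono powr_mono2)
  qed
  have s2: "summable (\<lambda>i. c powr (q - p) * norm (x i) powr p)"
    by (rule summable_mult[OF sx])
  have sq: "summable (\<lambda>i. norm (x i) powr q)"
    by (rule summable_comparison_test'[OF s2, of 0]) (use pw in auto)
  then show "x \<in> ell (ereal q)"
    by (simp add: ell_def)
  have "(\<Sum>i. norm (x i) powr q) \<le> c powr (q - p) * c powr p"
    using suminf_le[OF pw sq s2] suminf_mult[OF sx, of "c powr (q - p)"] cp by simp
  then have "(\<Sum>i. norm (x i) powr q) \<le> c powr q"
    by (simp flip: powr_add)
  then have "(\<Sum>i. norm (x i) powr q) powr (1 / q) \<le> (c powr q) powr (1 / q)"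
    using p sq by (intro powr_mono2 suminf_nonneg) auto
  then show "ell_norm (ereal q) x \<le> ell_norm (ereal p) x"
    using p c0 by (simp add: ell_norm_def powr_powr c_def)
qed
lemma ell_zero: "1 \<le> r \<Longrightarrow> (\<lambda>i. 0 :: 'k::real_normed_field) \<in> ell r"
  and ell_norm_zero: "1 \<le> r \<Longrightarrow> ell_norm r (\<lambda>i. 0 :: 'k) = 0"
  using ell_single[of r 0 "0::'k"] by simp_all

text \<open>
Dominated convergence: beyond a large index the dominating sequence is small in norm, and the finitely
many remaining coordinates tend to zero.
\<close>

lemma ell_dominated_null:
  fixes w :: "nat \<Rightarrow> nat \<Rightarrow> real" and U :: "nat \<Rightarrow> real"
  assumes r: "1 \<le> r" and U: "U \<in> ell r" and le: "\<And>n j. \<bar>w n j\<bar> \<le> U j"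
    and null: "\<And>j. (\<lambda>n. w n j) \<longlonglongrightarrow> 0"
  shows "(\<lambda>n. ell_norm r (w n)) \<longlonglongrightarrow> 0"
proof -
  have w: "w n \<in> ell r" for n
    by (rule ell_solid(1)[OF r U]) (use order_trans[OF le abs_ge_self] in simp)
  have head: "ell_norm r (\<lambda>j. if j < M then w n j else 0) \<le> (\<Sum>j<M. \<bar>w n j\<bar>)" for n M
  proof (induction M)
    case (Suc M)
    have "(\<lambda>j. if j < Suc M then w n j else 0)
        = (\<lambda>j. (if j < M then w n j else 0) + (if j = M then w n M else 0))"
      by (auto simp: less_Suc_eq)
    moreover have "(\<lambda>j. if j < M then w n j else 0) \<in> ell r"
      by (rule ell_solid(1)[OF r w[of n]]) auto
    ultimately have "ell_norm r (\<lambda>j. if j < Suc M then w n j else 0)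
        \<le> ell_norm r (\<lambda>j. if j < M then w n j else 0) + \<bar>w n M\<bar>"
      using ell_triangle(2)[OF r _ ell_single(1)[OF r], of "\<lambda>j. if j < M then w n j else 0" M "w n M"]
        ell_single(2)[OF r, of M "w n M"] by simp
    then show ?case
      using Suc.IH by simp
  qed (simp add: ell_norm_zero[OF r])
  have split: "ell_norm r (w n) \<le> (\<Sum>j<M. \<bar>w n j\<bar>) + ell_norm r (\<lambda>j. if M \<le> j then U j else 0)" for n M
  proof -
    define h where "h = (\<lambda>j. if j < M then w n j else 0)"
    define t where "t = (\<lambda>j. if M \<le> j then w n j else 0)"
    have "h \<in> ell r" "t \<in> ell r"
      unfolding h_def t_def by (auto intro!: ell_solid(1)[OF r w[of n]])
    then have "ell_norm r (\<lambda>j. h j + t j) \<le> ell_norm r h + ell_norm r t"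
      by (rule ell_triangle(2)[OF r])
    moreover have "(\<lambda>j. h j + t j) = w n"
      by (auto simp: h_def t_def)
    moreover have "(\<lambda>j. if M \<le> j then U j else 0) \<in> ell r"
      by (rule ell_solid(1)[OF r U]) auto
    then have "ell_norm r t \<le> ell_norm r (\<lambda>j. if M \<le> j then U j else 0)"
      by (rule ell_solid(2)[OF r]) (use order_trans[OF le abs_ge_self] in \<open>simp add: t_def\<close>)
    ultimately show ?thesis
      using head[of M n] by (simp add: h_def)
  qed
  show ?thesis
  proof (rule LIMSEQ_I)
    fix e :: real assume e: "0 < e"
    have "\<forall>\<^sub>F M in sequentially. ell_norm r (\<lambda>j. if M \<le> j then U j else 0) < e / 2"
      using order_tendstoD(2)[OF ell_tail[OF r U], of "e / 2"] e by simp
    then obtain M where M: "ell_norm r (\<lambda>j. if M \<le> j then U j else 0) < e / 2"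
      using eventually_happens by fastforce
    have "(\<lambda>n. \<Sum>j<M. \<bar>w n j\<bar>) \<longlonglongrightarrow> 0"
      using null by (intro tendsto_null_sum) (simp add: tendsto_rabs_zero_iff)
    then have "\<forall>\<^sub>F n in sequentially. (\<Sum>j<M. \<bar>w n j\<bar>) < e / 2"
      using order_tendstoD(2) e by (metis half_gt_zero)
    then obtain n0 where n0: "\<And>n. n0 \<le> n \<Longrightarrow> (\<Sum>j<M. \<bar>w n j\<bar>) < e / 2"
      by (auto simp: eventually_at_top_linorder)
    show "\<exists>n0. \<forall>n\<ge>n0. norm (ell_norm r (w n) - 0) < e"
    proof (intro exI allI impI)
      fix n assume "n0 \<le> n"
      then show "norm (ell_norm r (w n) - 0) < e"
        using split[of n M] M n0[of n] ell_norm_nonneg[OF r w[of n]] by simp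
    qed
  qed
qed

section \<open>Solid sequence spaces and their bounded operators\<close>

definition restrict_coords :: "(nat \<times> nat) set \<Rightarrow> (nat \<Rightarrow> nat \<Rightarrow> 'k::zero) \<Rightarrow> nat \<Rightarrow> nat \<Rightarrow> 'k" where
  "restrict_coords A x = (\<lambda>j i. if (j, i) \<in> A then x j i else 0)"

definition square :: "nat \<Rightarrow> (nat \<times> nat) set" where
  "square n = {..<n} \<times> {..<n}"

definition unit_vec :: "nat \<Rightarrow> nat \<Rightarrow> nat \<Rightarrow> nat \<Rightarrow> 'k::zero_neq_one" where
  "unit_vec j i = (\<lambda>l m. if l = j \<and> m = i then 1 else 0)"

lemma finite_square: "finite (square n)"
  by (simp add: square_def)

lemma square_mono: "m \<le> n \<Longrightarrow> square m \<subseteq> square n"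
  by (auto simp: square_def)

lemma sum_apply2: "(\<Sum>k\<in>I. f k) j i = (\<Sum>k\<in>I. f k j i :: 'k::comm_monoid_add)"
  by (induction I rule: infinite_finite_induct) (auto simp: zero_fun_def plus_fun_def)

lemma sum_apply1: "(\<Sum>k\<in>I. f k) j = (\<lambda>i. \<Sum>k\<in>I. f k j i :: 'k::comm_monoid_add)"
  by (intro ext sum_apply2)

lemma sum_half_powers_le: "(\<Sum>k<K. c / 2 ^ Suc k) \<le> (c::real)" if "0 \<le> c"
proof -
  have "(\<Sum>k<K. c / 2 ^ Suc k) = c - c / 2 ^ K"
    by (induction K) (auto simp: field_simps)
  then show ?thesis
    using that by simp
qed

text \<open>
The properties of the direct sum that the theory of strictly singular operators below needs: the norm
depends monotonically on the moduli of the coordinates, and every element is the limit of its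
restrictions to the finite squares. The coordinate functionals replace the theorem of Hahn and Banach.
\<close>

locale solid_sequence_space =
  fixes X :: "('k::real_normed_field, nat \<Rightarrow> nat \<Rightarrow> 'k) nspace"
  assumes smult_X: "smult X = (\<lambda>c x j i. c * x j i)"
    and zero_carr: "0 \<in> carr X"
    and add_carr: "x \<in> carr X \<Longrightarrow> y \<in> carr X \<Longrightarrow> x + y \<in> carr X"
    and scale_carr: "x \<in> carr X \<Longrightarrow> smult X c x \<in> carr X"
    and triangle: "x \<in> carr X \<Longrightarrow> y \<in> carr X \<Longrightarrow> nrm X (x + y) \<le> nrm X x + nrm X y"
    and scale_le: "x \<in> carr X \<Longrightarrow> nrm X (smult X c x) \<le> norm c * nrm X x"
    and solid_carr: "y \<in> carr X \<Longrightarrow> (\<And>j i. norm (x j i) \<le> norm (y j i)) \<Longrightarrow> x \<in> carr X"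
    and solid_le: "y \<in> carr X \<Longrightarrow> (\<And>j i. norm (x j i) \<le> norm (y j i)) \<Longrightarrow> nrm X x \<le> nrm X y"
    and coord_le: "x \<in> carr X \<Longrightarrow> norm (x j i) \<le> nrm X x"
    and unit_carr: "unit_vec j i \<in> carr X"
    and unit_norm: "nrm X (unit_vec j i) = 1"
    and tail: "x \<in> carr X \<Longrightarrow> (\<lambda>n. nrm X (x - restrict_coords (square n) x)) \<longlonglongrightarrow> 0"
begin

abbreviation "V \<equiv> carr X"
abbreviation "N \<equiv> nrm X"
abbreviation "L \<equiv> bounded_operators X"
abbreviation "res \<equiv> restrict_coords"
abbreviation scl (infixr "\<cdot>" 75) where "c \<cdot> x \<equiv> smult X c x"

sublocale vs: vector_space "smult X"
  by unfold_locales (auto simp: smult_X fun_eq_iff algebra_simps)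

subsection \<open>Norm and restriction\<close>

lemma scl_apply: "(c \<cdot> x) j i = c * x j i"
  by (simp add: smult_X)

lemma N_nonneg: "x \<in> V \<Longrightarrow> 0 \<le> N x"
  using coord_le[of x 0 0] norm_ge_zero[of "x 0 0"] by linarith

lemma N_zero: "N 0 = 0"
  using scale_le[OF zero_carr, of 0] N_nonneg[OF zero_carr] by simp

lemma N_eq_0D: "x \<in> V \<Longrightarrow> N x = 0 \<Longrightarrow> x = 0"
  using coord_le[of x] by (auto simp: fun_eq_iff)

lemma N_scale: "x \<in> V \<Longrightarrow> N (c \<cdot> x) = norm c * N x"
proof (cases "c = 0")
  case False
  assume x: "x \<in> V"
  have "N (inverse c \<cdot> (c \<cdot> x)) \<le> norm (inverse c) * N (c \<cdot> x)"
    by (rule scale_le[OF scale_carr[OF x]])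
  then have "N x \<le> N (c \<cdot> x) / norm c"
    using False by (simp add: norm_inverse divide_inverse mult.commute)
  then have "norm c * N x \<le> N (c \<cdot> x)"
    using False by (simp add: field_simps)
  then show ?thesis
    using scale_le[OF x, of c] by simp
qed (simp add: N_zero)

lemma minus_carr: "x \<in> V \<Longrightarrow> - x \<in> V"
  by (rule solid_carr) auto

lemma diff_carr: "x \<in> V \<Longrightarrow> y \<in> V \<Longrightarrow> x - y \<in> V"
  using add_carr[of x "- y"] minus_carr by simp

lemma N_minus: "x \<in> V \<Longrightarrow> N (- x) = N x"
  using solid_le[of x "- x"] solid_le[of "- x" x] minus_carr[of x] by simp

lemma N_diff_commute: "x \<in> V \<Longrightarrow> y \<in> V \<Longrightarrow> N (x - y) = N (y - x)"
  using N_minus[OF diff_carr, of x y] by simp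

lemma N_diff: "x \<in> V \<Longrightarrow> y \<in> V \<Longrightarrow> N (x - y) \<le> N x + N y"
  using triangle[of x "- y"] minus_carr N_minus by simp

lemma N_triangle_sub: "x \<in> V \<Longrightarrow> y \<in> V \<Longrightarrow> N x \<le> N (x - y) + N y"
  using triangle[OF diff_carr, of x y y] by simp

lemma sum_carr: "(\<And>k. k \<in> I \<Longrightarrow> f k \<in> V) \<Longrightarrow> sum f I \<in> V"
  by (induction I rule: infinite_finite_induct) (auto simp: zero_carr add_carr)

lemma N_sum: "(\<And>k. k \<in> I \<Longrightarrow> f k \<in> V) \<Longrightarrow> N (sum f I) \<le> (\<Sum>k\<in>I. N (f k))"
proof (induction I rule: infinite_finite_induct)
  case (insert k I)
  have "N (f k + sum f I) \<le> N (f k) + N (sum f I)"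
    using insert.prems by (intro triangle sum_carr) auto
  moreover have "N (sum f I) \<le> (\<Sum>k\<in>I. N (f k))"
    using insert.IH insert.prems by auto
  ultimately show ?case
    unfolding sum.insert[OF insert.hyps] by linarith
qed (auto simp: N_zero)

lemma subspace_V: "vs.subspace V"
  by (simp add: vs.subspace_def zero_carr add_carr scale_carr)

lemma res_carr: "x \<in> V \<Longrightarrow> res A x \<in> V"
  by (rule solid_carr[of x]) (auto simp: restrict_coords_def)

lemma N_res: "x \<in> V \<Longrightarrow> N (res A x) \<le> N x"
  by (rule solid_le) (auto simp: restrict_coords_def)

lemma N_res_mono: "x \<in> V \<Longrightarrow> A \<subseteq> B \<Longrightarrow> N (res A x) \<le> N (res B x)"
  by (rule solid_le[OF res_carr]) (auto simp: restrict_coords_def)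

lemma N_res_le_compl: "x \<in> V \<Longrightarrow> A \<inter> B = {} \<Longrightarrow> N (res A x) \<le> N (x - res B x)"
  by (rule solid_le[OF diff_carr[OF _ res_carr]]) (auto simp: restrict_coords_def)

lemma res_add: "res A (x + y) = res A x + (res A y :: nat \<Rightarrow> nat \<Rightarrow> 'k)"
  by (auto simp: restrict_coords_def fun_eq_iff)

lemma res_diff: "res A (x - y) = res A x - (res A y :: nat \<Rightarrow> nat \<Rightarrow> 'k)"
  by (auto simp: restrict_coords_def fun_eq_iff)

lemma res_scale: "res A (c \<cdot> x) = c \<cdot> res A x"
  by (auto simp: restrict_coords_def fun_eq_iff smult_X)

lemma res_sum: "res A (sum f I) = (\<Sum>k\<in>I. res A (f k) :: nat \<Rightarrow> nat \<Rightarrow> 'k)"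
  by (auto simp: restrict_coords_def fun_eq_iff sum_apply2)

text \<open>
On finitely many coordinates, coordinatewise convergence is convergence in norm.
\<close>

lemma res_null:
  assumes F: "finite F" and x: "\<And>m. x m \<in> V" and null: "\<And>j i. (\<lambda>m. x m j i) \<longlonglongrightarrow> 0"
  shows "(\<lambda>m. N (res F (x m))) \<longlonglongrightarrow> 0"
proof (rule Lim_null_comparison)
  have "N (res F y) \<le> (\<Sum>(j, i)\<in>F. norm (y j i))" if y: "y \<in> V" for y
  proof -
    have "res F y = (\<Sum>(j, i)\<in>F. y j i \<cdot> unit_vec j i)"
    proof (intro ext)
      fix j i
      have "(\<Sum>(j', i')\<in>F. y j' i' \<cdot> unit_vec j' i') j i
          = (\<Sum>k\<in>F. if k = (j, i) then y j i else 0)"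
        unfolding sum_apply2 by (rule sum.cong) (auto simp: smult_X unit_vec_def split: if_splits)
      then show "res F y j i = (\<Sum>(j', i')\<in>F. y j' i' \<cdot> unit_vec j' i') j i"
        using F by (simp add: restrict_coords_def)
    qed
    then have "N (res F y) \<le> (\<Sum>k\<in>F. N (case k of (j, i) \<Rightarrow> y j i \<cdot> unit_vec j i))"
      using N_sum[of F "\<lambda>(j, i). y j i \<cdot> unit_vec j i"] by (auto simp: scale_carr unit_carr)
    also have "\<dots> = (\<Sum>(j, i)\<in>F. norm (y j i))"
      by (rule sum.cong) (auto simp: N_scale unit_carr unit_norm)
    finally show ?thesis .
  qed
  then show "\<forall>\<^sub>F m in sequentially. norm (N (res F (x m))) \<le> (\<Sum>(j, i)\<in>F. norm (x m j i))"
    using x N_nonneg res_carr by auto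
  show "(\<lambda>m. \<Sum>(j, i)\<in>F. norm (x m j i)) \<longlonglongrightarrow> 0"
    using null by (intro tendsto_null_sum) (auto simp: tendsto_norm_zero_iff)
qed

subsection \<open>Bounded operators\<close>

lemma opI:
  assumes "\<And>x. x \<in> V \<Longrightarrow> T x \<in> V" "\<And>x. x \<notin> V \<Longrightarrow> T x = 0"
    "\<And>x y. x \<in> V \<Longrightarrow> y \<in> V \<Longrightarrow> T (x + y) = T x + T y"
    "\<And>c x. x \<in> V \<Longrightarrow> T (c \<cdot> x) = c \<cdot> T x"
    "\<And>x. x \<in> V \<Longrightarrow> N (T x) \<le> C * N x"
  shows "T \<in> carr L"
  using assms unfolding bounded_operators_def by simp blast

lemma
  assumes "T \<in> carr L"
  shows op_carr: "x \<in> V \<Longrightarrow> T x \<in> V"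
    and op_outside: "x \<notin> V \<Longrightarrow> T x = 0"
    and op_add: "x \<in> V \<Longrightarrow> y \<in> V \<Longrightarrow> T (x + y) = T x + T y"
    and op_scale: "x \<in> V \<Longrightarrow> T (c \<cdot> x) = c \<cdot> T x"
  using assms by (auto simp: bounded_operators_def)

lemma op_zero: "T \<in> carr L \<Longrightarrow> T 0 = 0"
  using op_scale[of T 0 0] zero_carr by simp

lemma op_diff: "T \<in> carr L \<Longrightarrow> x \<in> V \<Longrightarrow> y \<in> V \<Longrightarrow> T (x - y) = T x - T y"
  using op_add[of T "x - y" y] diff_carr[of x y] by (simp add: algebra_simps)

lemma op_sum: "T \<in> carr L \<Longrightarrow> (\<And>k. k \<in> I \<Longrightarrow> f k \<in> V) \<Longrightarrow> T (sum f I) = (\<Sum>k\<in>I. T (f k))"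
proof (induction I rule: infinite_finite_induct)
  case (insert k I)
  then show ?case
    unfolding sum.insert[OF insert.hyps]
    using op_add[of T "f k" "sum f I"] sum_carr[of I f] by (metis insertCI)
qed (metis sum.infinite sum.empty op_zero)+

lemma op_bound: "T \<in> carr L \<Longrightarrow> \<exists>C>0. \<forall>x\<in>V. N (T x) \<le> C * N x"
proof -
  assume "T \<in> carr L"
  then obtain C where C: "\<forall>x\<in>V. N (T x) \<le> C * N x"
    by (auto simp: bounded_operators_def)
  have "N (T x) \<le> max C 1 * N x" if "x \<in> V" for x
    using C that N_nonneg[OF that] mult_right_mono[of C "max C 1" "N x"] by fastforce
  then show ?thesis
    by (intro exI[of _ "max C 1"]) auto
qed

lemma op_norm_bound:
  assumes T: "T \<in> carr L" and x: "x \<in> V"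
  shows "N (T x) \<le> nrm L T * N x"
proof (cases "N x = 0")
  case True
  then have "x = 0"
    using N_eq_0D x by blast
  then show ?thesis
    by (simp add: op_zero[OF T] N_zero)
next
  case False
  then have pos: "0 < N x"
    using N_nonneg[OF x] by simp
  obtain C where C: "0 < C" "\<forall>x\<in>V. N (T x) \<le> C * N x"
    using op_bound[OF T] by blast
  define c :: 'k where "c = of_real (1 / N x)"
  have c: "norm c = 1 / N x"
    using pos by (simp only: c_def norm_of_real) simp
  have y: "c \<cdot> x \<in> V" "N (c \<cdot> x) = 1"
    using x pos by (auto simp: scale_carr N_scale c)
  have "bdd_above ((\<lambda>x. N (T x)) ` {x \<in> V. N x \<le> 1})"
  proof (intro bdd_aboveI2[of _ _ C])
    fix x assume "x \<in> {x \<in> V. N x \<le> 1}"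
    then have "N (T x) \<le> C * N x" "C * N x \<le> C * 1"
      using C by (auto intro!: mult_left_mono)
    then show "N (T x) \<le> C"
      by linarith
  qed
  then have "N (T (c \<cdot> x)) \<le> nrm L T"
    unfolding bounded_operators_def using y by (auto intro!: cSUP_upper2[where x = "c \<cdot> x"])
  then show ?thesis
    using op_carr[OF T x] pos by (simp add: op_scale[OF T x] N_scale c field_simps)
qed

lemma smult_L: "smult L = (\<lambda>c T x. c \<cdot> T x)" and amult_L: "amult L = (\<circ>)"
  by (auto simp: bounded_operators_def fun_eq_iff)

sublocale ops: vector_space "smult L"
  by (rule vector_space_bounded_operators) (rule vs.vector_space_axioms)

lemma zero_op: "0 \<in> carr L"
  by (rule opI[of _ 0]) (auto simp: zero_carr N_zero)

lemma scale_op: "T \<in> carr L \<Longrightarrow> smult L c T \<in> carr L"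
proof -
  assume T: "T \<in> carr L"
  obtain C where C: "0 < C" "\<forall>x\<in>V. N (T x) \<le> C * N x"
    using op_bound[OF T] by blast
  show ?thesis
  proof (rule opI[of _ "norm c * C"])
    fix x assume x: "x \<in> V"
    show "N (smult L c T x) \<le> norm c * C * N x"
      using C x by (auto simp: smult_L N_scale op_carr[OF T] mult.assoc intro!: mult_left_mono)
  qed (auto simp: smult_L scale_carr op_carr[OF T] op_outside[OF T] op_add[OF T] op_scale[OF T]
      vs.scale_right_distrib mult.commute)
qed

lemma add_op: "S \<in> carr L \<Longrightarrow> T \<in> carr L \<Longrightarrow> S + T \<in> carr L"
proof -
  assume S: "S \<in> carr L" and T: "T \<in> carr L"
  obtain C D where C: "\<forall>x\<in>V. N (S x) \<le> C * N x" and D: "\<forall>x\<in>V. N (T x) \<le> D * N x"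
    using op_bound[OF T] op_bound[OF S] by blast
  show ?thesis
  proof (rule opI[of _ "C + D"])
    fix x assume x: "x \<in> V"
    then have "N (S x + T x) \<le> C * N x + D * N x"
      using C D triangle[OF op_carr[OF S x] op_carr[OF T x]] by fastforce
    then show "N ((S + T) x) \<le> (C + D) * N x"
      by (simp add: algebra_simps)
    show "(S + T) (c \<cdot> x) = c \<cdot> (S + T) x" for c
      using x by (simp add: op_scale[OF S] op_scale[OF T] vs.scale_right_distrib)
  next
    fix x y assume "x \<in> V" "y \<in> V"
    then show "(S + T) (x + y) = (S + T) x + (S + T) y"
      unfolding plus_fun_apply[of S T] by (simp only: op_add[OF S] op_add[OF T] ac_simps)
  next
    fix x assume "x \<notin> V"
    then show "(S + T) x = 0"
      unfolding plus_fun_apply[of S T] by (metis op_outside[OF S] op_outside[OF T] add_0)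
  qed (auto simp: add_carr op_carr[OF S] op_carr[OF T])
qed

lemma diff_op: "S \<in> carr L \<Longrightarrow> T \<in> carr L \<Longrightarrow> S - T \<in> carr L"
  using add_op[of S "smult L (- 1) T"] scale_op[of T "- 1"]
  by (simp add: ops.scale_minus_left)

lemma comp_op: "S \<in> carr L \<Longrightarrow> T \<in> carr L \<Longrightarrow> S \<circ> T \<in> carr L"
proof -
  assume S: "S \<in> carr L" and T: "T \<in> carr L"
  obtain C D where C: "0 < C" "\<forall>x\<in>V. N (S x) \<le> C * N x" and D: "\<forall>x\<in>V. N (T x) \<le> D * N x"
    using op_bound[OF T] op_bound[OF S] by blast
  show ?thesis
  proof (rule opI[of _ "C * D"])
    fix x assume x: "x \<in> V"
    then have "N (S (T x)) \<le> C * N (T x)"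
      using C op_carr[OF T x] by auto
    also have "\<dots> \<le> C * (D * N x)"
      using C D x by (intro mult_left_mono) auto
    finally show "N ((S \<circ> T) x) \<le> C * D * N x"
      by (simp add: mult.assoc)
  next
    fix x y assume "x \<in> V" "y \<in> V"
    then show "(S \<circ> T) (x + y) = (S \<circ> T) x + (S \<circ> T) y"
      by (simp only: o_apply op_add[OF S] op_add[OF T] op_carr[OF T])
  next
    fix x assume "x \<notin> V"
    then show "(S \<circ> T) x = 0"
      by (metis o_apply op_outside[OF T] op_zero[OF S])
  qed (auto simp: op_carr[OF S] op_carr[OF T] op_scale[OF S] op_scale[OF T])
qed

lemma op_zero_null:
  assumes T: "T \<in> carr L" and x: "\<And>m. x m \<in> V" and null: "(\<lambda>m. N (x m)) \<longlonglongrightarrow> 0"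
  shows "(\<lambda>m. N (T (x m))) \<longlonglongrightarrow> 0"
proof (rule Lim_null_comparison)
  show "\<forall>\<^sub>F m in sequentially. norm (N (T (x m))) \<le> nrm L T * N (x m)"
    using op_norm_bound[OF T x] N_nonneg[OF op_carr[OF T x]] by simp
  show "(\<lambda>m. nrm L T * N (x m)) \<longlonglongrightarrow> 0"
    using null by (rule tendsto_mult_right_zero)
qed

subsection \<open>Infinite-dimensional subspaces\<close>

lemma finite_dim_subspace:
  assumes "finite_dim X W" "vs.subspace Z" "Z \<subseteq> W"
  shows "finite_dim X Z"
proof -
  obtain B where B: "finite B" "W = vs.span B"
    using assms(1) by (auto simp: finite_dim_def)
  obtain B' where B': "B' \<subseteq> Z" "vs.independent B'" "Z \<subseteq> vs.span B'"
    by (rule vs.maximal_independent_subset)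
  have "finite B'"
    using vs.independent_span_bound[OF B(1) B'(2)] B' B assms(3) by blast
  moreover have "vs.span B' = Z"
    using B' vs.span_minimal[OF B'(1) assms(2)] by blast
  ultimately show ?thesis
    by (auto simp: finite_dim_def)
qed

text \<open>
Requiring one more coordinate to vanish lowers the dimension by at most one.
\<close>

lemma infinite_dim_vanishing:
  assumes Y: "vs.subspace Y" "\<not> finite_dim X Y" and F: "finite F"
  shows "vs.subspace {x \<in> Y. \<forall>(j, i)\<in>F. x j i = 0} \<and> \<not> finite_dim X {x \<in> Y. \<forall>(j, i)\<in>F. x j i = 0}"
  using F
proof (induction F)
  case (insert k F)
  obtain j i where k: "k = (j, i)"
    by (cases k)
  define Y' where "Y' = {x \<in> Y. \<forall>(j, i)\<in>F. x j i = 0}"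
  define Y'' where "Y'' = {x \<in> Y. \<forall>(j, i)\<in>insert k F. x j i = 0}"
  have Y': "vs.subspace Y'" "\<not> finite_dim X Y'"
    using insert.IH by (auto simp: Y'_def)
  have eq: "Y'' = {x \<in> Y'. x j i = 0}"
    by (auto simp: Y'_def Y''_def k)
  have sub: "vs.subspace Y''"
    using vs.subspace_0[OF Y'(1)] vs.subspace_add[OF Y'(1)] vs.subspace_scale[OF Y'(1)]
    unfolding eq by (intro vs.subspaceI) (auto simp: scl_apply)
  moreover have "\<not> finite_dim X Y''"
  proof
    assume "finite_dim X Y''"
    then obtain B where B: "finite B" "Y'' = vs.span B"
      by (auto simp: finite_dim_def)
    show False
    proof (cases "\<exists>y\<in>Y'. y j i \<noteq> 0")
      case True
      then obtain y where y: "y \<in> Y'" "y j i \<noteq> 0"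
        by auto
      have "B \<subseteq> Y'"
        using B vs.span_superset[of B] eq by auto
      then have "vs.span (insert y B) \<subseteq> Y'"
        using y Y'(1) by (intro vs.span_minimal) auto
      moreover have "x \<in> vs.span (insert y B)" if x: "x \<in> Y'" for x
      proof -
        have "x - (x j i / y j i) \<cdot> y \<in> Y''"
          using y x vs.subspace_diff[OF Y'(1)] vs.subspace_scale[OF Y'(1)]
          by (auto simp: eq scl_apply)
        then show ?thesis
          unfolding vs.span_breakdown_eq B(2) by blast
      qed
      ultimately have "Y' = vs.span (insert y B)"
        by blast
      then show False
        using Y'(2) B(1) by (auto simp: finite_dim_def)
    next
      case False
      then have "Y'' = Y'"
        using eq by auto
      then show False
        using \<open>finite_dim X Y''\<close> Y'(2) by simp
    qed
  qed
  ultimately show ?case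
    by (simp add: Y''_def)
qed (use Y in auto)

lemma exists_nonzero:
  assumes "vs.subspace Y" "\<not> finite_dim X Y"
  shows "\<exists>x\<in>Y. x \<noteq> 0"
proof (rule ccontr)
  assume "\<not> (\<exists>x\<in>Y. x \<noteq> 0)"
  then have "Y = vs.span {}"
    using assms(1) vs.subspace_0 by fastforce
  then show False
    using assms(2) by (auto simp: finite_dim_def)
qed

lemma normalize:
  assumes "vs.subspace Y" "Y \<subseteq> V" "x \<in> Y" "x \<noteq> 0"
  shows "\<exists>y\<in>Y. N y = 1 \<and> (\<exists>c. norm c = 1 / N x \<and> y = c \<cdot> x)"
proof -
  have pos: "0 < N x"
    using assms N_nonneg[of x] N_eq_0D[of x] by fastforce
  then have "norm (of_real (1 / N x) :: 'k) = 1 / N x"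
    by (simp only: norm_of_real) simp
  then show ?thesis
    using assms pos by (intro bexI[of _ "of_real (1 / N x) \<cdot> x"] conjI exI[of _ "of_real (1 / N x)"])
      (auto simp: N_scale subsetD vs.subspace_scale)
qed

lemma span_range_explicit:
  assumes "z \<in> vs.span (range y)"
  shows "\<exists>K a. z = (\<Sum>k<(K::nat). a k \<cdot> y k)"
  using assms
proof (induction rule: vs.span_induct_alt)
  case base
  show ?case
    by (rule exI[of _ 0]) simp
next
  case (step c x z)
  obtain k0 where k0: "x = y k0"
    using step by auto
  obtain K a where z: "z = (\<Sum>k<K. a k \<cdot> y k)"
    using step by auto
  define K' where "K' = max K (Suc k0)"
  define a' where "a' k = (if k = k0 then c else 0) + (if k < K then a k else 0)" for k
  have "(\<Sum>k<K'. a' k \<cdot> y k)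
      = (\<Sum>k<K'. (if k = k0 then c else 0) \<cdot> y k) + (\<Sum>k<K'. (if k < K then a k else 0) \<cdot> y k)"
    by (simp add: a'_def vs.scale_left_distrib sum.distrib)
  also have "(\<Sum>k<K'. (if k = k0 then c else 0) \<cdot> y k) = (\<Sum>k\<in>{k0}. c \<cdot> y k)"
    by (rule sum.mono_neutral_cong_right) (auto simp: K'_def)
  also have "(\<Sum>k<K'. (if k < K then a k else 0) \<cdot> y k) = (\<Sum>k<K. a k \<cdot> y k)"
    by (rule sum.mono_neutral_cong_right) (auto simp: K'_def)
  finally have "c \<cdot> x + z = (\<Sum>k<K'. a' k \<cdot> y k)"
    unfolding k0 z by (simp only: sum.insert sum.empty finite.emptyI empty_iff not_False_eq_True add_0_right)
  then show ?case
    by blast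
qed

text \<open>
The coefficients of a vanishing linear combination vanish, so that the sequence is injective and
linearly independent.
\<close>

lemma infinite_dim_span:
  assumes y: "\<And>k. y k \<in> V" and c: "0 < c"
    and low: "\<And>a K k. k < K \<Longrightarrow> c * norm (a k) \<le> N (\<Sum>k<(K::nat). a k \<cdot> y k)"
  shows "\<not> finite_dim X (vs.span (range y))"
proof
  have coeff0: "a k = 0" if fin: "finite S" and "(\<Sum>k\<in>S. a k \<cdot> y k) = 0" "k \<in> S" for a k S
  proof -
    obtain K where K: "S \<subseteq> {..<K}"
      using finite_nat_iff_bounded[THEN iffD1, OF fin] by blast
    have "(\<Sum>k<K. (if k \<in> S then a k else 0) \<cdot> y k) = (\<Sum>k\<in>S. a k \<cdot> y k)"
      using K by (intro sum.mono_neutral_cong_right) auto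
    then show ?thesis
      using low[of k K "\<lambda>k. if k \<in> S then a k else 0"] that K c N_zero
      by (auto simp: mult_le_0_iff)
  qed
  have inj: "inj y"
  proof (rule injI, rule ccontr)
    fix k l assume "y k = y l" "k \<noteq> l"
    then have "(\<Sum>m\<in>{k, l}. (if m = k then 1 else - 1) \<cdot> y m) = 0"
      by simp
    then show False
      using coeff0[of "{k, l}" "\<lambda>m. if m = k then 1 else - 1" k] by auto
  qed
  have "vs.independent (range y)"
    unfolding vs.independent_explicit_module
  proof (intro allI impI)
    fix t u v
    assume t: "finite t" "t \<subseteq> range y" "(\<Sum>v\<in>t. u v \<cdot> v) = 0" "v \<in> t"
    obtain S where S: "finite S" "t = y ` S"
      using finite_subset_image[OF t(1,2)] by blast
    have "(\<Sum>k\<in>S. u (y k) \<cdot> y k) = 0"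
      using t(3) inj by (simp add: S(2) sum.reindex inj_on_subset[OF inj])
    then show "u v = 0"
      using coeff0[OF S(1), of "\<lambda>k. u (y k)"] t(4) S(2) by auto
  qed
  moreover assume "finite_dim X (vs.span (range y))"
  ultimately have "finite (range y)"
    using vs.independent_span_bound vs.span_superset unfolding finite_dim_def by metis
  then show False
    using inj finite_imageD by blast
qed

end

context solid_sequence_space
begin

subsection \<open>Strictly singular operators\<close>

abbreviation "SS \<equiv> strictly_singular X"

definition bounded_below :: "((nat \<Rightarrow> nat \<Rightarrow> 'k) \<Rightarrow> nat \<Rightarrow> nat \<Rightarrow> 'k) \<Rightarrow> (nat \<Rightarrow> nat \<Rightarrow> 'k) set \<Rightarrow> bool" where
  "bounded_below T Y \<longleftrightarrow> (\<exists>c>0. \<forall>x\<in>Y. c * N x \<le> N (T x))"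

definition norm_closure :: "(nat \<Rightarrow> nat \<Rightarrow> 'k) set \<Rightarrow> (nat \<Rightarrow> nat \<Rightarrow> 'k) set" where
  "norm_closure Y = {x \<in> V. \<forall>e>0. \<exists>y\<in>Y. N (y - x) < e}"

lemma norm_closureE:
  assumes "x \<in> norm_closure Y" "0 < e"
  obtains y where "y \<in> Y" "N (y - x) < e"
  using assms by (auto simp: norm_closure_def)

lemma subset_closure: "Y \<subseteq> V \<Longrightarrow> Y \<subseteq> norm_closure Y"
  unfolding norm_closure_def using N_zero by force

lemma subspace_closure:
  assumes Y: "Y \<subseteq> V" "vs.subspace Y"
  shows "subspace_of X (norm_closure Y)"
  unfolding subspace_of_def
proof (intro conjI vs.subspaceI)
  show "norm_closure Y \<subseteq> V"
    by (auto simp: norm_closure_def)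
  show "0 \<in> norm_closure Y"
    using subset_closure[OF Y(1)] vs.subspace_0[OF Y(2)] by auto
next
  fix x y assume xy: "x \<in> norm_closure Y" "y \<in> norm_closure Y"
  then have V: "x \<in> V" "y \<in> V"
    by (auto simp: norm_closure_def)
  have "\<exists>z\<in>Y. N (z - (x + y)) < e" if "e > 0" for e
  proof -
    have e2: "0 < e / 2"
      using that by simp
    obtain x' where x': "x' \<in> Y" "N (x' - x) < e / 2"
      by (rule norm_closureE[OF xy(1) e2])
    obtain y' where y': "y' \<in> Y" "N (y' - y) < e / 2"
      by (rule norm_closureE[OF xy(2) e2])
    have "N ((x' - x) + (y' - y)) \<le> N (x' - x) + N (y' - y)"
      using x' y' V Y by (intro triangle diff_carr) auto
    then have "N ((x' + y') - (x + y)) < e"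
      using x' y' by (simp add: algebra_simps)
    then show ?thesis
      using vs.subspace_add[OF Y(2) x'(1) y'(1)] by blast
  qed
  then show "x + y \<in> norm_closure Y"
    using V by (simp add: norm_closure_def add_carr)
next
  fix c x assume x: "x \<in> norm_closure Y"
  then have V: "x \<in> V"
    by (auto simp: norm_closure_def)
  have "\<exists>z\<in>Y. N (z - c \<cdot> x) < e" if "e > 0" for e
  proof -
    have "0 < e / (norm c + 1)"
      using that by (auto intro!: divide_pos_pos add_nonneg_pos)
    then obtain x' where x': "x' \<in> Y" "N (x' - x) < e / (norm c + 1)"
      using x by (auto simp: norm_closure_def)
    have x'V: "x' - x \<in> V"
      using x' Y V by (auto intro!: diff_carr)
    have "N (c \<cdot> x' - c \<cdot> x) = norm c * N (x' - x)"
      using N_scale[OF x'V] by (simp add: vs.scale_right_diff_distrib)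
    also have "\<dots> \<le> (norm c + 1) * N (x' - x)"
      using N_nonneg[OF x'V] by (intro mult_right_mono) auto
    also have "\<dots> < e"
      using x'(2) by (simp add: pos_less_divide_eq add_nonneg_pos mult.commute)
    finally show ?thesis
      using vs.subspace_scale[OF Y(2) x'(1)] by blast
  qed
  then show "c \<cdot> x \<in> norm_closure Y"
    using V by (simp add: norm_closure_def scale_carr)
qed

lemma norm_closed_closure:
  assumes Y: "Y \<subseteq> V"
  shows "norm_closed X (norm_closure Y)"
  unfolding norm_closed_def
proof (intro conjI allI impI)
  fix f x assume *: "(\<forall>n. f n \<in> norm_closure Y) \<and> x \<in> V \<and> (\<lambda>n::nat. N (f n - x)) \<longlonglongrightarrow> 0"
  have "\<exists>y\<in>Y. N (y - x) < e" if e: "e > 0" for e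
  proof -
    have "\<forall>\<^sub>F n in sequentially. N (f n - x) < e / 2"
      using * order_tendstoD(2)[of "\<lambda>n. N (f n - x)" 0 sequentially "e / 2"] e by auto
    then obtain n where n: "N (f n - x) < e / 2"
      using eventually_happens by fastforce
    have "f n \<in> norm_closure Y"
      using * by blast
    moreover have "0 < e / 2"
      using e by simp
    ultimately obtain y where y: "y \<in> Y" "N (y - f n) < e / 2"
      by (rule norm_closureE)
    have f: "f n \<in> V"
      using \<open>f n \<in> norm_closure Y\<close> by (simp add: norm_closure_def)
    have "N ((y - f n) + (f n - x)) \<le> N (y - f n) + N (f n - x)"
      using y f Y * by (intro triangle diff_carr) auto
    then show ?thesis
      using y n by (intro bexI[of _ y]) auto
  qed
  then show "x \<in> norm_closure Y"
    using * by (auto simp: norm_closure_def)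
qed (auto simp: norm_closure_def)

lemma bounded_below_closure:
  assumes T: "T \<in> carr L" and Y: "Y \<subseteq> V" and b: "bounded_below T Y"
  shows "bounded_below T (norm_closure Y)"
proof -
  obtain c where c: "0 < c" "\<forall>x\<in>Y. c * N x \<le> N (T x)"
    using b by (auto simp: bounded_below_def)
  obtain C where C: "0 < C" "\<forall>x\<in>V. N (T x) \<le> C * N x"
    using op_bound[OF T] by blast
  have "c * N x \<le> N (T x)" if x: "x \<in> norm_closure Y" for x
  proof (rule field_le_epsilon)
    fix e :: real assume "0 < e"
    then have "0 < e / (C + c)"
      using C c by simp
    then obtain y where y: "y \<in> Y" "N (y - x) < e / (C + c)" and xV: "x \<in> V"
      using x by (auto simp: norm_closure_def)
    then have yV: "y \<in> V"
      using Y by auto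
    define d where "d = N (y - x)"
    have "N x \<le> d + N y"
      unfolding d_def using N_triangle_sub[OF xV yV] N_diff_commute[OF xV yV] by linarith
    then have "c * N x \<le> c * (d + N y)"
      using c by (intro mult_left_mono) auto
    moreover have "c * N y \<le> N (T y)"
      using c(2) y(1) by blast
    moreover have "N (T y) \<le> N (T y - T x) + N (T x)"
      by (intro N_triangle_sub op_carr[OF T] xV yV)
    moreover have "N (T y - T x) \<le> C * d"
      unfolding d_def using C diff_carr[OF yV xV] op_diff[OF T yV xV] by metis
    moreover have "(C + c) * d \<le> e"
      using y(2) C c by (simp add: d_def pos_less_divide_eq mult.commute less_imp_le)
    ultimately show "c * N x \<le> N (T x) + e"
      by (simp add: algebra_simps)
  qed
  then show ?thesis
    using c(1) by (auto simp: bounded_below_def)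
qed

lemma isomorphism_on_iff:
  assumes T: "T \<in> carr L" and Y: "Y \<subseteq> V" "vs.subspace Y"
  shows "isomorphism_on X T Y \<longleftrightarrow> bounded_below T Y"
proof
  assume "isomorphism_on X T Y"
  then obtain C where inj: "inj_on T Y" and C: "\<forall>z\<in>T ` Y. N (inv_into Y T z) \<le> C * N z"
    by (auto simp: isomorphism_on_def)
  have "1 / max C 1 * N x \<le> N (T x)" if x: "x \<in> Y" for x
  proof -
    have "N x \<le> C * N (T x)"
      using C x inj by (metis imageI inv_into_f_f)
    also have "\<dots> \<le> max C 1 * N (T x)"
      using x Y by (intro mult_right_mono N_nonneg op_carr[OF T]) auto
    finally show ?thesis
      by (simp add: field_simps)
  qed
  then show "bounded_below T Y"
    unfolding bounded_below_def by (intro exI[of _ "1 / max C 1"]) auto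
next
  assume "bounded_below T Y"
  then obtain c where c: "0 < c" "\<forall>x\<in>Y. c * N x \<le> N (T x)"
    by (auto simp: bounded_below_def)
  have inj: "inj_on T Y"
  proof (rule inj_onI)
    fix x y assume xy: "x \<in> Y" "y \<in> Y" "T x = T y"
    then have V: "x \<in> V" "y \<in> V"
      using Y by auto
    have "c * N (x - y) \<le> N (T (x - y))"
      using c vs.subspace_diff[OF Y(2) xy(1,2)] by blast
    moreover have "N (T (x - y)) = 0"
      unfolding op_diff[OF T V] using xy N_zero by simp
    ultimately have "N (x - y) = 0"
      using c(1) N_nonneg[OF diff_carr[OF V]] by (metis mult_le_0_iff not_le order_antisym)
    then show "x = y"
      using N_eq_0D[OF diff_carr[OF V]] by simp
  qed
  moreover have "N (inv_into Y T z) \<le> 1 / c * N z" if z: "z \<in> T ` Y" for z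
  proof -
    obtain x where x: "x \<in> Y" "z = T x"
      using z by auto
    then show ?thesis
      using c inj by (auto simp: field_simps)
  qed
  ultimately show "isomorphism_on X T Y"
    unfolding isomorphism_on_def by blast
qed

text \<open>
Lower bounds extend to norm closures, so arbitrary infinite-dimensional subspaces can take the place of
closed ones.
\<close>

lemma strictly_singular_iff:
  "T \<in> SS \<longleftrightarrow> T \<in> carr L \<and>
    (\<forall>Y. Y \<subseteq> V \<and> vs.subspace Y \<and> \<not> finite_dim X Y \<longrightarrow> \<not> bounded_below T Y)"
proof (intro iffI conjI allI impI)
  fix Y assume T: "T \<in> SS" and Y: "Y \<subseteq> V \<and> vs.subspace Y \<and> \<not> finite_dim X Y"
  have TL: "T \<in> carr L"
    using T by (simp add: strictly_singular_def)
  have cl: "subspace_of X (norm_closure Y)" "norm_closed X (norm_closure Y)"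
    using Y by (auto intro: subspace_closure norm_closed_closure)
  have "\<not> finite_dim X (norm_closure Y)"
    using finite_dim_subspace[of "norm_closure Y" Y] subset_closure Y by blast
  then have "\<not> isomorphism_on X T (norm_closure Y)"
    using T cl by (auto simp: strictly_singular_def)
  then have "\<not> bounded_below T (norm_closure Y)"
    using isomorphism_on_iff[OF TL] cl(1) by (auto simp: subspace_of_def)
  then show "\<not> bounded_below T Y"
    using bounded_below_closure[OF TL] Y by blast
next
  assume *: "T \<in> carr L \<and> (\<forall>Y. Y \<subseteq> V \<and> vs.subspace Y \<and> \<not> finite_dim X Y \<longrightarrow> \<not> bounded_below T Y)"
  then show "T \<in> SS"
    using isomorphism_on_iff[of T] by (auto simp: strictly_singular_def subspace_of_def)
qed (auto simp: strictly_singular_def)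

lemma SS_op: "T \<in> SS \<Longrightarrow> T \<in> carr L"
  by (simp add: strictly_singular_def)

lemma SS_not_bounded_below:
  "T \<in> SS \<Longrightarrow> Y \<subseteq> V \<Longrightarrow> vs.subspace Y \<Longrightarrow> \<not> finite_dim X Y \<Longrightarrow> \<not> bounded_below T Y"
  by (simp add: strictly_singular_iff)

text \<open>
Choose the members \<open>x (\<sigma> k)\<close> and squares inductively: each new member is almost zero on the square
that carries the previous one up to a small error, and a new larger square carries almost all of it.
The sets \<open>A k\<close> are the differences of consecutive squares.
\<close>

lemma gliding_hump:
  fixes x :: "nat \<Rightarrow> nat \<Rightarrow> nat \<Rightarrow> 'k"
  assumes x: "\<And>m. x m \<in> V" and null: "\<And>j i. (\<lambda>m. x m j i) \<longlonglongrightarrow> 0" and \<epsilon>: "\<And>k. 0 < \<epsilon> k"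
  obtains \<sigma> A where "strict_mono \<sigma>" "disjoint_family A"
    "\<And>k. N (x (\<sigma> k) - res (A k) (x (\<sigma> k))) \<le> \<epsilon> (k::nat)"
proof -
  define P where "P k s = (case s of (m, n, n') \<Rightarrow> n \<le> n' \<and> N (res (square n) (x m)) \<le> \<epsilon> k / 2 \<and>
    N (x m - res (square n') (x m)) \<le> \<epsilon> k / 2)" for k and s :: "nat \<times> nat \<times> nat"
  define Q where "Q s s' = (fst s < fst s' \<and> fst (snd s') = snd (snd s))" for s s' :: "nat \<times> nat \<times> nat"
  have step: "\<exists>m>m0. \<exists>n'. P k (m, n, n')" for k m0 n
  proof -
    have "\<forall>\<^sub>F m in sequentially. N (res (square n) (x m)) < \<epsilon> k / 2 \<and> m0 < m"
      using order_tendstoD(2)[OF res_null[OF finite_square x null], of "\<epsilon> k / 2"] \<epsilon>[of k]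
      by (auto intro: eventually_conj eventually_gt_at_top)
    then obtain m where m: "N (res (square n) (x m)) < \<epsilon> k / 2" "m0 < m"
      using eventually_happens by fastforce
    have "\<forall>\<^sub>F n' in sequentially. N (x m - res (square n') (x m)) < \<epsilon> k / 2 \<and> n \<le> n'"
      using order_tendstoD(2)[OF tail[OF x], of "\<epsilon> k / 2"] \<epsilon>[of k]
      by (auto intro: eventually_conj eventually_ge_at_top)
    then obtain n' where "N (x m - res (square n') (x m)) < \<epsilon> k / 2" "n \<le> n'"
      using eventually_happens by fastforce
    then show ?thesis
      using m by (intro exI[of _ m]) (auto simp: P_def intro!: exI[of _ n'])
  qed
  have "\<exists>f. \<forall>k. P k (f k) \<and> Q (f k) (f (Suc k))"
  proof (rule dependent_nat_choice)
    show "\<exists>s. P 0 s"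
      using step[of _ 0] by blast
    show "\<exists>s'. P (Suc k) s' \<and> Q s s'" for s k
      using step[of "fst s" "Suc k" "snd (snd s)"]
      by (auto simp: Q_def)
  qed
  then obtain f where f: "\<And>k. P k (f k)" "\<And>k. Q (f k) (f (Suc k))"
    by blast
  define \<sigma> where "\<sigma> k = fst (f k)" for k
  define lo where "lo k = fst (snd (f k))" for k
  define hi where "hi k = snd (snd (f k))" for k
  have lohi: "lo k \<le> hi k" and lo: "N (res (square (lo k)) (x (\<sigma> k))) \<le> \<epsilon> k / 2"
    and hi: "N (x (\<sigma> k) - res (square (hi k)) (x (\<sigma> k))) \<le> \<epsilon> k / 2" for k
    using f(1)[of k] by (auto simp: P_def lo_def hi_def \<sigma>_def split: prod.splits)
  have \<sigma>: "\<sigma> k < \<sigma> (Suc k)" and next_lo: "lo (Suc k) = hi k" for k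
    using f(2)[of k] by (auto simp: Q_def \<sigma>_def lo_def hi_def)
  have hilo: "hi k \<le> lo l" if "k < l" for k l
    using that
  proof (induction l)
    case (Suc l)
    show ?case
    proof (cases "k = l")
      case False
      then have "hi k \<le> lo l"
        using Suc by simp
      then show ?thesis
        using lohi[of l] next_lo[of l] by simp
    qed (simp add: next_lo)
  qed simp
  define A where "A k = square (hi k) - square (lo k)" for k
  have "A k \<inter> A l = {}" if "k < l" for k l
    using square_mono[OF hilo[OF that]] by (auto simp: A_def)
  then have "disjoint_family A"
    unfolding disjoint_family_on_def by (metis Int_commute linorder_neqE_nat)
  moreover have "N (x (\<sigma> k) - res (A k) (x (\<sigma> k))) \<le> \<epsilon> k" for k
  proof -
    have split: "x (\<sigma> k) - res (A k) (x (\<sigma> k))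
        = res (square (lo k)) (x (\<sigma> k)) + (x (\<sigma> k) - res (square (hi k)) (x (\<sigma> k)))"
      using square_mono[OF lohi[of k]] by (auto simp: restrict_coords_def A_def fun_eq_iff)
    show ?thesis
      unfolding split
      using triangle[OF res_carr[OF x] diff_carr[OF x res_carr[OF x]], of "square (lo k)" "\<sigma> k" "\<sigma> k" "square (hi k)" "\<sigma> k"]
        lo[of k] hi[of k] by linarith
  qed
  ultimately show thesis
    using that[of \<sigma> A] \<sigma> by (auto simp: strict_mono_Suc_iff)
qed

text \<open>
Restricting the sum to the set \<open>A m\<close> that belongs to the largest coefficient leaves \<open>a m \<cdot> x m\<close>, up to
errors that are small multiples of that coefficient.
\<close>

lemma almost_disjoint_lower_bound:
  assumes A: "disjoint_family A" and x: "\<And>k. x k \<in> V" "\<And>k. N (x k) = 1"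
    and \<epsilon>: "\<And>k. N (x k - res (A k) (x k)) \<le> \<epsilon> k" "sum \<epsilon> {..<K} \<le> 1 / 2" and k: "k < (K::nat)"
  shows "norm (a k) \<le> 2 * N (\<Sum>k<K. a k \<cdot> x k)"
proof -
  define \<mu> where "\<mu> = Max ((\<lambda>k. norm (a k)) ` {..<K})"
  have \<mu>: "norm (a l) \<le> \<mu>" if "l < K" for l
    using that by (auto simp: \<mu>_def)
  have "\<mu> \<in> (\<lambda>k. norm (a k)) ` {..<K}"
    unfolding \<mu>_def using k by (intro Max_in) auto
  then obtain m where m: "m < K" "norm (a m) = \<mu>"
    by auto
  define z where "z = (\<Sum>k<K. a k \<cdot> x k)"
  have z: "z \<in> V"
    unfolding z_def by (intro sum_carr scale_carr x)
  \<comment> \<open>The contribution to \<open>A m\<close> of the other vectors, each of which lives essentially outside \<open>A m\<close>.\<close>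
  define R where "R = (\<Sum>l\<in>{..<K} - {m}. a l \<cdot> res (A m) (x l))"
  have R: "R \<in> V"
    unfolding R_def by (intro sum_carr scale_carr res_carr x)
  have "res (A m) z = (\<Sum>l<K. a l \<cdot> res (A m) (x l))"
    unfolding z_def res_sum res_scale ..
  also have "\<dots> = a m \<cdot> res (A m) (x m) + R"
    unfolding R_def by (rule sum.remove) (use m in auto)
  finally have split: "a m \<cdot> res (A m) (x m) = res (A m) z - R"
    by simp
  have "N R \<le> (\<Sum>l\<in>{..<K} - {m}. N (a l \<cdot> res (A m) (x l)))"
    unfolding R_def by (rule N_sum) (intro scale_carr res_carr x)
  also have "\<dots> \<le> (\<Sum>l\<in>{..<K} - {m}. \<mu> * \<epsilon> l)"
  proof (rule sum_mono)
    fix l assume l: "l \<in> {..<K} - {m}"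
    have "A m \<inter> A l = {}"
      using A l by (auto simp: disjoint_family_on_def)
    then have "N (res (A m) (x l)) \<le> \<epsilon> l"
      using N_res_le_compl[OF x(1)] \<epsilon>(1) order_trans by blast
    then show "N (a l \<cdot> res (A m) (x l)) \<le> \<mu> * \<epsilon> l"
      using \<mu>[of l] l N_nonneg[OF res_carr[OF x(1)]] m(2) by (auto simp: N_scale[OF res_carr[OF x(1)]] intro!: mult_mono)
  qed
  finally have R_le: "N R \<le> \<mu> * (\<Sum>l\<in>{..<K} - {m}. \<epsilon> l)"
    by (simp add: sum_distrib_left)
  have "1 - \<epsilon> m \<le> N (res (A m) (x m))"
    using N_triangle_sub[OF x(1) res_carr[OF x(1)], of m "A m" m] x(2)[of m] \<epsilon>(1)[of m] by linarith
  then have "\<mu> * (1 - \<epsilon> m) \<le> N (a m \<cdot> res (A m) (x m))"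
    using m by (auto simp: N_scale[OF res_carr[OF x(1)]] intro!: mult_left_mono)
  also have "\<dots> \<le> N z + N R"
    unfolding split using N_diff[OF res_carr[OF z] R, of "A m"] N_res[OF z, of "A m"] by linarith
  also have "\<dots> \<le> N z + \<mu> * (\<Sum>l\<in>{..<K} - {m}. \<epsilon> l)"
    using R_le by simp
  finally have "\<mu> \<le> N z + \<mu> * (\<epsilon> m + (\<Sum>l\<in>{..<K} - {m}. \<epsilon> l))"
    by (simp add: algebra_simps)
  also have "\<epsilon> m + (\<Sum>l\<in>{..<K} - {m}. \<epsilon> l) = sum \<epsilon> {..<K}"
    using m sum.remove[of "{..<K}" m \<epsilon>] by simp
  also have "\<mu> * sum \<epsilon> {..<K} \<le> \<mu> * (1 / 2)"
    using \<epsilon>(2) m(2) by (intro mult_left_mono) auto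
  finally have "\<mu> \<le> 2 * N z"
    by simp
  then show ?thesis
    using \<mu>[OF k] by (simp add: z_def)
qed

text \<open>
The restriction of \<open>T\<close> to the vectors in \<open>Y\<close> that vanish on a square is still not bounded below, as
these vectors form an infinite-dimensional subspace.
\<close>

lemma SS_small_vector:
  assumes T: "T \<in> SS" and Y: "Y \<subseteq> V" "vs.subspace Y" "\<not> finite_dim X Y" and c: "0 < c"
  shows "\<exists>x\<in>Y. N x = 1 \<and> (\<forall>(j, i)\<in>square n. x j i = 0) \<and> N (T x) \<le> c"
proof -
  define Y' where "Y' = {x \<in> Y. \<forall>(j, i)\<in>square n. x j i = 0}"
  have Y': "vs.subspace Y'" "\<not> finite_dim X Y'" "Y' \<subseteq> V" "Y' \<subseteq> Y"
    using infinite_dim_vanishing[OF Y(2,3) finite_square[of n]] Y(1) by (auto simp: Y'_def)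
  then have "\<not> bounded_below T Y'"
    using SS_not_bounded_below[OF T] by blast
  then obtain x where x: "x \<in> Y'" "N (T x) < c * N x"
    using c unfolding bounded_below_def by (meson not_le)
  have xV: "x \<in> V"
    using x Y' by auto
  have "x \<noteq> 0"
    using x N_zero op_zero[OF SS_op[OF T]] by auto
  then obtain y d where y: "y \<in> Y'" "N y = 1" and d: "norm d = 1 / N x" "y = d \<cdot> x"
    using normalize[OF Y'(1,3) x(1)] by blast
  have pos: "0 < N x"
    using \<open>x \<noteq> 0\<close> N_nonneg[OF xV] N_eq_0D[OF xV] by fastforce
  have "N (T y) = N (T x) / N x"
    using op_scale[OF SS_op[OF T] xV] N_scale[OF op_carr[OF SS_op[OF T] xV]] d by simp
  also have "\<dots> \<le> c"
    using x(2) pos by (simp add: field_simps)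
  finally show ?thesis
    using y Y' by (auto simp: Y'_def)
qed

lemma vanishing_null:
  assumes "\<And>n. \<forall>(j, i)\<in>square n. x n j i = (0::'k)"
  shows "(\<lambda>n. x n j i) \<longlonglongrightarrow> 0"
proof (rule tendsto_eventually, rule eventually_mono[OF eventually_gt_at_top[of "max j i"]])
  show "x n j i = 0" if "max j i < n" for n
    using assms[of n] that by (force simp: square_def)
qed

text \<open>
Suppose that \<open>S + T\<close> is bounded below by \<open>c\<close> on \<open>Y\<close>. Inside \<open>Y\<close> there is a sequence of almost
disjoint unit vectors on which \<open>T\<close> is so small that \<open>T\<close> has norm at most \<open>c/2\<close> on the whole
span. On this span \<open>S\<close> is bounded below, although \<open>S\<close> is strictly singular.
\<close>

lemma SS_add:
  assumes S: "S \<in> SS" and T: "T \<in> SS"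
  shows "S + T \<in> SS"
  unfolding strictly_singular_iff
proof (intro conjI allI impI notI)
  show "S + T \<in> carr L"
    by (intro add_op SS_op S T)
  fix Y assume Y: "Y \<subseteq> V \<and> vs.subspace Y \<and> \<not> finite_dim X Y" and "bounded_below (S + T) Y"
  then obtain c where c: "0 < c" "\<And>x. x \<in> Y \<Longrightarrow> c * N x \<le> N ((S + T) x)"
    by (auto simp: bounded_below_def)
  \<comment> \<open>Coefficients in the span will be at most \<open>2 * N z\<close>, and these bounds sum up to at most \<open>c / 4\<close>.\<close>
  have "\<exists>x\<in>Y. N x = 1 \<and> (\<forall>(j, i)\<in>square n. x j i = 0) \<and> N (T x) \<le> c / 4 / 2 ^ Suc n" for n
    using SS_small_vector[OF T] Y c by auto
  then obtain x where x: "\<And>n. x n \<in> Y" "\<And>n. N (x n) = 1" "\<And>n. \<forall>(j, i)\<in>square n. x n j i = 0"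
      "\<And>n. N (T (x n)) \<le> c / 4 / 2 ^ Suc n"
    by metis
  have xV: "x n \<in> V" for n
    using x(1) Y by auto
  obtain \<sigma> A where \<sigma>: "strict_mono \<sigma>" and A: "disjoint_family A"
    and near: "\<And>k. N (x (\<sigma> k) - res (A k) (x (\<sigma> k))) \<le> (1 / 2) / 2 ^ Suc k"
    by (rule gliding_hump[OF xV vanishing_null[OF x(3)], of "\<lambda>k. (1 / 2) / 2 ^ Suc k"]) auto
  define y where "y k = x (\<sigma> k)" for k
  have y: "y k \<in> V" "y k \<in> Y" for k
    using x xV by (auto simp: y_def)
  have low: "norm (a k) \<le> 2 * N (\<Sum>k<K. a k \<cdot> y k)" if "k < K" for a K k
    by (rule almost_disjoint_lower_bound[OF A y(1) _ _ _ that, where \<epsilon> = "\<lambda>k. (1 / 2) / 2 ^ Suc k"])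
      (use near x sum_half_powers_le[of "1 / 2" K] in \<open>auto simp: y_def\<close>)
  have Ty: "N (T (y k)) \<le> c / 4 / 2 ^ Suc k" for k
  proof -
    have "(2::real) ^ Suc k \<le> 2 ^ Suc (\<sigma> k)"
      using seq_suble[OF \<sigma>, of k] by (intro power_increasing) auto
    then have "c / 4 / 2 ^ Suc (\<sigma> k) \<le> c / 4 / 2 ^ Suc k"
      using c by (intro divide_left_mono) auto
    then show ?thesis
      using x(4)[of "\<sigma> k"] by (simp add: y_def)
  qed
  define Z where "Z = vs.span (range y)"
  have Z: "vs.subspace Z" "Z \<subseteq> Y" "Z \<subseteq> V"
    using Y y vs.span_minimal[of "range y" Y] by (auto simp: Z_def)
  have "\<not> finite_dim X Z"
    unfolding Z_def
  proof (rule infinite_dim_span[OF y(1), of "1 / 2"])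
    show "1 / 2 * norm (a k) \<le> N (\<Sum>k<K. a k \<cdot> y k)" if "k < K" for a K k
      using low[OF that, of a] by simp
  qed simp
  moreover have "bounded_below S Z"
    unfolding bounded_below_def
  proof (intro exI[of _ "c / 2"] conjI ballI)
    fix z assume z: "z \<in> Z"
    then obtain K a where za: "z = (\<Sum>k<K. a k \<cdot> y k)"
      using span_range_explicit[of z y] unfolding Z_def by blast
    have zV: "z \<in> V"
      using z Z by auto
    have "N (T z) = N (\<Sum>k<K. a k \<cdot> T (y k))"
      unfolding za using op_sum[OF SS_op[OF T], of "{..<K}" "\<lambda>k. a k \<cdot> y k"] y
      by (simp add: scale_carr op_scale[OF SS_op[OF T]])
    also have "\<dots> \<le> (\<Sum>k<K. N (a k \<cdot> T (y k)))"
      by (intro N_sum scale_carr op_carr[OF SS_op[OF T]] y)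
    also have "\<dots> \<le> (\<Sum>k<K. (2 * N z) * (c / 4 / 2 ^ Suc k))"
    proof (rule sum_mono)
      fix k assume "k \<in> {..<K}"
      then have "norm (a k) \<le> 2 * N z"
        using low za by auto
      then show "N (a k \<cdot> T (y k)) \<le> (2 * N z) * (c / 4 / 2 ^ Suc k)"
        unfolding N_scale[OF op_carr[OF SS_op[OF T] y(1)]]
        by (intro mult_mono Ty N_nonneg[OF op_carr[OF SS_op[OF T] y(1)]]) (use N_nonneg[OF zV] in auto)
    qed
    also have "\<dots> = (2 * N z) * (\<Sum>k<K. c / 4 / 2 ^ Suc k)"
      by (simp add: sum_distrib_left)
    also have "\<dots> \<le> (2 * N z) * (c / 4)"
      using c N_nonneg[OF zV] sum_half_powers_le[of "c / 4" K] by (intro mult_left_mono) auto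
    finally have "N (T z) \<le> c / 2 * N z"
      by simp
    moreover have "N ((S + T) z) \<le> N (S z) + N (T z)"
      using triangle[OF op_carr[OF SS_op[OF S] zV] op_carr[OF SS_op[OF T] zV]] by simp
    moreover have "c * N z \<le> N ((S + T) z)"
      using c z Z by auto
    ultimately show "c / 2 * N z \<le> N (S z)"
      by simp
  qed (use c in auto)
  ultimately show False
    using SS_not_bounded_below[OF S] Z by blast
qed

lemma SS_zero: "0 \<in> SS"
  unfolding strictly_singular_iff
proof (intro conjI allI impI notI)
  fix Y assume Y: "Y \<subseteq> V \<and> vs.subspace Y \<and> \<not> finite_dim X Y" and "bounded_below 0 Y"
  then obtain c where c: "0 < c" "\<forall>x\<in>Y. c * N x \<le> N (0 x)"
    unfolding bounded_below_def by blast
  obtain x where x: "x \<in> Y" "x \<noteq> 0"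
    using exists_nonzero[of Y] Y by blast
  then have "0 < N x"
    using Y N_nonneg[of x] N_eq_0D[of x] by (metis order_less_le subsetD)
  moreover have "c * N x \<le> 0"
    using c(2) x(1) N_zero by (metis zero_fun_apply)
  ultimately show False
    using c(1) by (simp add: mult_le_0_iff)
qed (rule zero_op)

lemma SS_comp_left:
  assumes S: "S \<in> carr L" and T: "T \<in> SS"
  shows "S \<circ> T \<in> SS"
  unfolding strictly_singular_iff
proof (intro conjI allI impI notI)
  show "S \<circ> T \<in> carr L"
    by (intro comp_op S SS_op T)
  fix Y assume Y: "Y \<subseteq> V \<and> vs.subspace Y \<and> \<not> finite_dim X Y" and "bounded_below (S \<circ> T) Y"
  then obtain c where c: "0 < c" "\<And>x. x \<in> Y \<Longrightarrow> c * N x \<le> N (S (T x))"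
    by (auto simp: bounded_below_def)
  obtain C where C: "0 < C" "\<forall>x\<in>V. N (S x) \<le> C * N x"
    using op_bound[OF S] by blast
  have "c / C * N x \<le> N (T x)" if "x \<in> Y" for x
  proof -
    have "T x \<in> V"
      using op_carr[OF SS_op[OF T]] Y that by auto
    then have "c * N x \<le> C * N (T x)"
      using c(2)[OF that] C(2) by force
    then show ?thesis
      using C(1) by (simp add: field_simps)
  qed
  then have "bounded_below T Y"
    unfolding bounded_below_def using c C by (intro exI[of _ "c / C"]) auto
  then show False
    using SS_not_bounded_below[OF T] Y by blast
qed

text \<open>
If \<open>S \<circ> T\<close> is bounded below on \<open>Y\<close>, then so is \<open>T\<close>. Hence \<open>T ` Y\<close> is infinite-dimensional, and \<open>S\<close>
is bounded below on it.
\<close>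

lemma SS_comp_right:
  assumes S: "S \<in> SS" and T: "T \<in> carr L"
  shows "S \<circ> T \<in> SS"
  unfolding strictly_singular_iff
proof (intro conjI allI impI notI)
  show "S \<circ> T \<in> carr L"
    by (intro comp_op T SS_op S)
  fix Y assume Y: "Y \<subseteq> V \<and> vs.subspace Y \<and> \<not> finite_dim X Y" and "bounded_below (S \<circ> T) Y"
  then obtain c where c: "0 < c" "\<And>x. x \<in> Y \<Longrightarrow> c * N x \<le> N (S (T x))"
    by (auto simp: bounded_below_def)
  obtain C where C: "0 < C" "\<forall>x\<in>V. N (T x) \<le> C * N x"
    using op_bound[OF T] by blast
  obtain D where D: "0 < D" "\<forall>x\<in>V. N (S x) \<le> D * N x"
    using op_bound[OF SS_op[OF S]] by blast
  have YV: "Y \<subseteq> V" and sub: "vs.subspace Y"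
    using Y by auto
  have low: "c / D * N x \<le> N (T x)" if "x \<in> Y" for x
  proof -
    have "T x \<in> V"
      using op_carr[OF T] YV that by auto
    then have "c * N x \<le> D * N (T x)"
      using c(2)[OF that] D(2) by force
    then show ?thesis
      using D(1) by (simp add: field_simps)
  qed
  define Z where "Z = T ` Y"
  have Z: "Z \<subseteq> V"
    using op_carr[OF T] YV by (auto simp: Z_def)
  have subZ: "vs.subspace Z"
  proof (rule vs.subspaceI)
    show "0 \<in> Z"
      unfolding Z_def using vs.subspace_0[OF sub] op_zero[OF T] by (metis imageI)
  next
    fix x y assume "x \<in> Z" "y \<in> Z"
    then obtain u v where "u \<in> Y" "v \<in> Y" "x = T u" "y = T v"
      by (auto simp: Z_def)
    then show "x + y \<in> Z"
      unfolding Z_def using vs.subspace_add[OF sub, of u v] op_add[OF T, of u v] YV by (metis imageI subsetD)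
  next
    fix d x assume "x \<in> Z"
    then obtain u where "u \<in> Y" "x = T u"
      by (auto simp: Z_def)
    then show "d \<cdot> x \<in> Z"
      unfolding Z_def using vs.subspace_scale[OF sub, of u d] op_scale[OF T, of u d] YV by (metis imageI subsetD)
  qed
  have "\<not> finite_dim X Z"
  proof
    assume "finite_dim X Z"
    then obtain B where B: "finite B" "Z = vs.span B"
      by (auto simp: finite_dim_def)
    have "B \<subseteq> T ` Y"
      using vs.span_superset[of B] B(2) by (simp add: Z_def)
    then obtain B' where B': "B' \<subseteq> Y" "finite B'" "B = T ` B'"
      using finite_subset_image[OF B(1)] by blast
    have sp: "vs.span B' \<subseteq> Y"
      by (rule vs.span_minimal[OF B'(1) sub])
    have img: "\<exists>u\<in>vs.span B'. T u = z" if "z \<in> vs.span B" for z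
      using that
    proof (induction rule: vs.span_induct_alt)
      case base
      show ?case
        using vs.span_zero op_zero[OF T] by blast
    next
      case (step d b z)
      obtain u w where u: "u \<in> B'" "b = T u" and w: "w \<in> vs.span B'" "T w = z"
        using step B' by auto
      have "d \<cdot> u + w \<in> vs.span B'"
        using u w(1) vs.span_base[OF u(1)] by (intro vs.span_add vs.span_scale)
      moreover have "u \<in> V" "w \<in> V"
        using u w B' sp YV by auto
      then have "T (d \<cdot> u + w) = d \<cdot> b + z"
        using op_add[OF T, of "d \<cdot> u" w] op_scale[OF T, of u d] u w scale_carr by metis
      ultimately show ?case
        by blast
    qed
    have "Y \<subseteq> vs.span B'"
    proof
      fix x assume x: "x \<in> Y"
      then obtain u where u: "u \<in> vs.span B'" "T u = T x"
        using img[of "T x"] B(2) by (auto simp: Z_def)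
      have uY: "u \<in> Y"
        using u sp by auto
      have "x - u \<in> Y"
        using x uY by (rule vs.subspace_diff[OF sub])
      then have "c / D * N (x - u) \<le> N (T (x - u))"
        by (rule low)
      moreover have "T (x - u) = 0"
        using op_diff[OF T, of x u] x uY YV u(2) by auto
      moreover have V: "x - u \<in> V"
        using \<open>x - u \<in> Y\<close> YV by auto
      ultimately have "c / D * N (x - u) \<le> 0"
        by (simp only: N_zero)
      then have "N (x - u) = 0"
        using c(1) D(1) N_nonneg[OF V] by (simp add: mult_le_0_iff divide_le_0_iff)
      then show "x \<in> vs.span B'"
        using N_eq_0D[OF V] u by simp
    qed
    then have "Y = vs.span B'"
      using sp by auto
    then show False
      using Y B' by (auto simp: finite_dim_def)
  qed
  moreover have "bounded_below S Z"
    unfolding bounded_below_def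
  proof (intro exI[of _ "c / C"] conjI ballI)
    fix z assume "z \<in> Z"
    then obtain x where x: "x \<in> Y" "z = T x"
      by (auto simp: Z_def)
    then have "N z \<le> C * N x"
      using C YV by auto
    then have "c * N z \<le> C * (c * N x)"
      using c(1) mult_left_mono[of "N z" "C * N x" c] by (simp add: mult.left_commute)
    also have "\<dots> \<le> C * N (S z)"
      using c(2)[OF x(1)] x C(1) by (intro mult_left_mono) auto
    finally show "c / C * N z \<le> N (S z)"
      using C(1) by (simp add: field_simps)
  qed (use c C in auto)
  ultimately show False
    using SS_not_bounded_below[OF S] Z subZ by blast
qed

lemma SS_scale: "T \<in> SS \<Longrightarrow> smult L c T \<in> SS"
proof -
  assume T: "T \<in> SS"
  define M where "M x = (if x \<in> V then c \<cdot> x else 0)" for x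
  have "M \<in> carr L"
    by (rule opI[of _ "norm c"])
      (auto simp: M_def scale_carr add_carr vs.scale_right_distrib mult.commute N_scale)
  then have "M \<circ> T \<in> SS"
    using T by (rule SS_comp_left)
  moreover have "M \<circ> T = smult L c T"
  proof
    fix x
    have "T x \<in> V"
      using op_carr[OF SS_op[OF T]] op_outside[OF SS_op[OF T]] zero_carr by (cases "x \<in> V") auto
    then show "(M \<circ> T) x = smult L c T x"
      by (simp add: M_def smult_L)
  qed
  ultimately show ?thesis
    by simp
qed

text \<open>
A lower bound \<open>c\<close> for the limit on a subspace yields the lower bound \<open>c/2\<close> for every approximant at
distance less than \<open>c/2\<close>.
\<close>

lemma SS_closed: "norm_closed L SS"
  unfolding norm_closed_def
proof (intro conjI allI impI)
  fix f T assume *: "(\<forall>n. f n \<in> SS) \<and> T \<in> carr L \<and> (\<lambda>n::nat. nrm L (f n - T)) \<longlonglongrightarrow> 0"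
  then have T: "T \<in> carr L" and f: "f n \<in> SS" for n
    by auto
  show "T \<in> SS"
    unfolding strictly_singular_iff
  proof (intro conjI allI impI notI)
    fix Y assume Y: "Y \<subseteq> V \<and> vs.subspace Y \<and> \<not> finite_dim X Y" and "bounded_below T Y"
    then obtain c where c: "0 < c" "\<And>x. x \<in> Y \<Longrightarrow> c * N x \<le> N (T x)"
      by (auto simp: bounded_below_def)
    have "\<forall>\<^sub>F n in sequentially. nrm L (f n - T) < c / 2"
      using * order_tendstoD(2)[of "\<lambda>n. nrm L (f n - T)" 0 sequentially "c / 2"] c by auto
    then obtain n where n: "nrm L (f n - T) < c / 2"
      using eventually_happens by fastforce
    have "c / 2 * N x \<le> N (f n x)" if x: "x \<in> Y" for x
    proof -
      have V: "x \<in> V" "f n x \<in> V" "T x \<in> V"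
        using x Y op_carr[OF T] op_carr[OF SS_op[OF f]] by auto
      have "N ((f n - T) x) \<le> nrm L (f n - T) * N x"
        by (intro op_norm_bound diff_op SS_op f T V)
      also have "\<dots> \<le> c / 2 * N x"
        using n N_nonneg[OF V(1)] by (intro mult_right_mono) auto
      finally have "N (T x - f n x) \<le> c / 2 * N x"
        using N_diff_commute[OF V(2,3)] by simp
      then show ?thesis
        using N_triangle_sub[OF V(3,2)] c(2)[OF x] by simp
    qed
    then have "bounded_below (f n) Y"
      unfolding bounded_below_def using c(1) by (intro exI[of _ "c / 2"]) auto
    then show False
      using SS_not_bounded_below[OF f] Y by blast
  qed (rule T)
qed (auto simp: SS_op)

end

section \<open>Upper and lower estimates\<close>

definition lq_norm :: "real \<Rightarrow> nat \<Rightarrow> (nat \<Rightarrow> real) \<Rightarrow> real" where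
  "lq_norm q K t = (\<Sum>k<K. t k powr q) powr (1 / q)"

lemma lq_norm_mono:
  assumes "0 < q" "\<And>k. k < K \<Longrightarrow> 0 \<le> s k \<and> s k \<le> t k"
  shows "lq_norm q K s \<le> lq_norm q K t"
  unfolding lq_norm_def using assms by (intro powr_mono2 sum_mono sum_nonneg) auto

lemma lq_norm_scale:
  assumes "0 < q" "0 \<le> c" "\<And>k. k < K \<Longrightarrow> 0 \<le> t k"
  shows "lq_norm q K (\<lambda>k. c * t k) = c * lq_norm q K t"
proof -
  have "(\<Sum>k<K. (c * t k) powr q) = c powr q * (\<Sum>k<K. t k powr q)"
    using assms by (simp add: powr_mult sum_distrib_left)
  then show ?thesis
    using assms by (simp add: lq_norm_def powr_mult powr_powr sum_nonneg)
qed

lemma le_lq_norm: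
  assumes "0 < q" "\<And>k. k < K \<Longrightarrow> 0 \<le> t k" "k < K"
  shows "t k \<le> lq_norm q K t"
proof -
  have "t k powr q \<le> (\<Sum>k<K. t k powr q)"
    using assms by (intro member_le_sum) auto
  then have "(t k powr q) powr (1 / q) \<le> lq_norm q K t"
    unfolding lq_norm_def using assms by (intro powr_mono2) auto
  then show ?thesis
    using assms by (simp add: powr_powr)
qed

lemma lq_norm_nonneg: "0 \<le> lq_norm q K t"
  by (simp add: lq_norm_def)

lemma lq_norm_one: "0 < q \<Longrightarrow> lq_norm q K (\<lambda>k. 1) = real K powr (1 / q)"
  by (simp add: lq_norm_def)

text \<open>
The growth comparison that contradicts an estimate by \<open>K powr \<alpha>\<close> from above and \<open>K powr \<beta>\<close> from
below, valid for sums of any length \<open>K\<close>.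
\<close>

lemma powr_growth:
  fixes \<alpha> \<beta> :: real
  assumes "\<alpha> < \<beta>" "0 < \<delta>"
  shows "\<exists>K::nat. D * real K powr \<alpha> < \<delta> * real K powr \<beta>"
proof -
  define R where "R = max (D / \<delta>) 1"
  obtain K where "R powr (1 / (\<beta> - \<alpha>)) < real K"
    using reals_Archimedean2 by blast
  moreover have "0 < R powr (1 / (\<beta> - \<alpha>))"
    by (auto simp: R_def)
  ultimately have "0 < real K"
    by linarith
  then have "0 < K" and "(R powr (1 / (\<beta> - \<alpha>))) powr (\<beta> - \<alpha>) < real K powr (\<beta> - \<alpha>)"
    using assms \<open>R powr (1 / (\<beta> - \<alpha>)) < real K\<close> by (auto intro!: powr_less_mono2)
  then have K: "D / \<delta> < real K powr (\<beta> - \<alpha>)" "0 < K"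
    using assms by (auto simp: powr_powr R_def)
  have "D * real K powr \<alpha> < \<delta> * real K powr (\<beta> - \<alpha>) * real K powr \<alpha>"
    using K assms by (intro mult_strict_right_mono) (auto simp: field_simps)
  then show ?thesis
    by (auto simp: mult.assoc simp flip: powr_add)
qed

lemma not_null_subsequence:
  fixes u :: "nat \<Rightarrow> 'a::real_normed_vector"
  assumes "\<not> u \<longlonglongrightarrow> 0"
  obtains \<delta> s where "0 < \<delta>" "strict_mono (s :: nat \<Rightarrow> nat)" "\<And>k. \<delta> \<le> norm (u (s k))"
proof -
  obtain \<delta> where \<delta>: "0 < \<delta>" "\<And>n0. \<exists>n\<ge>n0. \<delta> \<le> norm (u n)"
    using assms unfolding LIMSEQ_iff by (auto simp: not_less)
  then have "infinite {n. \<delta> \<le> norm (u n)}"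
    unfolding infinite_nat_iff_unbounded_le by blast
  then obtain s :: "nat \<Rightarrow> nat" where "strict_mono s" "\<forall>k. s k \<in> {n. \<delta> \<le> norm (u n)}"
    using infinite_enumerate by blast
  then show thesis
    using that[of \<delta> s] \<delta>(1) by auto
qed

context solid_sequence_space
begin

text \<open>
The coordinatewise substitute for weakly null sequences: in \<open>\<ell>\<^sup>p\<close> with \<open>1 < p < \<infinity>\<close> the two notions
agree.
\<close>

definition null_sequence :: "(nat \<times> nat) set \<Rightarrow> (nat \<Rightarrow> nat \<Rightarrow> nat \<Rightarrow> 'k) \<Rightarrow> bool" where
  "null_sequence B x \<longleftrightarrow> (\<forall>m. x m \<in> V \<and> (\<forall>j i. (j, i) \<notin> B \<longrightarrow> x m j i = 0)) \<and>
    (\<exists>C. \<forall>m. N (x m) \<le> C) \<and> (\<forall>j i. (\<lambda>m. x m j i) \<longlonglongrightarrow> 0)"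

text \<open>
The upper and lower \<open>q\<close>-estimates of Banach lattice theory, with constant \<open>1\<close>.
\<close>

definition upper_estimate :: "real \<Rightarrow> (nat \<times> nat) set \<Rightarrow> bool" where
  "upper_estimate q B \<longleftrightarrow> (\<forall>A x K. disjoint_family A \<and>
      (\<forall>k. x k \<in> V \<and> (\<forall>j i. (j, i) \<notin> A k \<inter> B \<longrightarrow> x k j i = 0)) \<longrightarrow>
    N (\<Sum>k<K. x k) \<le> lq_norm q K (\<lambda>k. N (x k)))"

definition lower_estimate :: "real \<Rightarrow> (nat \<times> nat) set \<Rightarrow> bool" where
  "lower_estimate q B \<longleftrightarrow> (\<forall>A x K. disjoint_family A \<and>
      (\<forall>k. x k \<in> V \<and> (\<forall>j i. (j, i) \<notin> A k \<inter> B \<longrightarrow> x k j i = 0)) \<longrightarrow>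
    lq_norm q K (\<lambda>k. N (x k)) \<le> N (\<Sum>k<K. x k))"

lemma upper_estimateD:
  assumes "upper_estimate q B" "disjoint_family A" "\<And>k. x k \<in> V"
    "\<And>k j i. (j, i) \<notin> A k \<inter> B \<Longrightarrow> x k j i = 0"
  shows "N (sum x {..<K}) \<le> lq_norm q K (\<lambda>k. N (x k))"
  using assms unfolding upper_estimate_def by blast

lemma lower_estimateD:
  assumes "lower_estimate q B" "disjoint_family A" "\<And>k. x k \<in> V"
    "\<And>k j i. (j, i) \<notin> A k \<inter> B \<Longrightarrow> x k j i = 0"
  shows "lq_norm q K (\<lambda>k. N (x k)) \<le> N (sum x {..<K})"
  using assms unfolding lower_estimate_def by blast

text \<open>
The error is measured by the \<open>\<ell>\<^sup>q\<close>-norm of the coefficients, which dominates each of them, so that it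
can be absorbed when estimates pass from disjoint to almost disjoint vectors.
\<close>

lemma combination_error:
  assumes q: "0 < q" and y: "\<And>k. y k \<in> V" and \<eta>: "0 \<le> \<eta>"
    and near: "\<And>k. N (y k - res (A k) (y k)) \<le> \<eta> / 2 ^ Suc k"
  shows "N ((\<Sum>k<K. a k \<cdot> y k) - (\<Sum>k<K. a k \<cdot> res (A k) (y k))) \<le> \<eta> * lq_norm q K (\<lambda>k. norm (a k))"
proof -
  have d: "y k - res (A k) (y k) \<in> V" for k
    by (intro diff_carr res_carr y)
  have "(\<Sum>k<K. a k \<cdot> y k) - (\<Sum>k<K. a k \<cdot> res (A k) (y k)) = (\<Sum>k<K. a k \<cdot> (y k - res (A k) (y k)))"
    by (simp only: vs.scale_right_diff_distrib sum_subtractf)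
  moreover have "N (\<Sum>k<K. a k \<cdot> (y k - res (A k) (y k))) \<le> (\<Sum>k<K. N (a k \<cdot> (y k - res (A k) (y k))))"
    by (intro N_sum scale_carr d)
  moreover have "(\<Sum>k<K. N (a k \<cdot> (y k - res (A k) (y k))))
      \<le> (\<Sum>k<K. lq_norm q K (\<lambda>k. norm (a k)) * (\<eta> / 2 ^ Suc k))"
  proof (rule sum_mono)
    fix k assume "k \<in> {..<K}"
    then have "norm (a k) \<le> lq_norm q K (\<lambda>k. norm (a k))"
      using q by (intro le_lq_norm) auto
    then show "N (a k \<cdot> (y k - res (A k) (y k))) \<le> lq_norm q K (\<lambda>k. norm (a k)) * (\<eta> / 2 ^ Suc k)"
      unfolding N_scale[OF d] using near N_nonneg[OF d] lq_norm_nonneg by (intro mult_mono) auto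
  qed
  moreover have "(\<Sum>k<K. lq_norm q K (\<lambda>k. norm (a k)) * (\<eta> / 2 ^ Suc k))
      \<le> lq_norm q K (\<lambda>k. norm (a k)) * \<eta>"
    unfolding sum_distrib_left[symmetric]
    by (intro mult_left_mono sum_half_powers_le \<eta> lq_norm_nonneg)
  ultimately show ?thesis
    by (metis (no_types, lifting) mult.commute order_trans)
qed

lemma upper_estimate_near:
  assumes B: "upper_estimate q B" and q: "0 < q" and A: "disjoint_family A"
    and y: "\<And>k. y k \<in> V" "\<And>k j i. (j, i) \<notin> B \<Longrightarrow> y k j i = 0" "\<And>k. N (y k) \<le> C"
    and \<eta>: "0 \<le> \<eta>" "\<And>k. N (y k - res (A k) (y k)) \<le> \<eta> / 2 ^ Suc k"
  shows "N (\<Sum>k<K. a k \<cdot> y k) \<le> (C + \<eta>) * lq_norm q K (\<lambda>k. norm (a k))"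
proof -
  define b where "b k = a k \<cdot> res (A k) (y k)" for k
  have b: "b k \<in> V" for k
    unfolding b_def by (intro scale_carr res_carr y)
  have "N (sum b {..<K}) \<le> lq_norm q K (\<lambda>k. N (b k))"
    by (rule upper_estimateD[OF B A b]) (use y(2) in \<open>auto simp: b_def scl_apply restrict_coords_def\<close>)
  also have "\<dots> \<le> lq_norm q K (\<lambda>k. C * norm (a k))"
  proof (rule lq_norm_mono[OF q])
    fix k
    have "N (b k) = norm (a k) * N (res (A k) (y k))"
      unfolding b_def by (intro N_scale res_carr y)
    moreover have "N (res (A k) (y k)) \<le> C"
      using N_res[OF y(1)] y(3) order_trans by blast
    ultimately show "0 \<le> N (b k) \<and> N (b k) \<le> C * norm (a k)"
      using N_nonneg[OF b, of k] by (simp add: mult.commute[of C] mult_left_mono)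
  qed
  also have "\<dots> = C * lq_norm q K (\<lambda>k. norm (a k))"
    using q N_nonneg[OF y(1)] y(3) by (intro lq_norm_scale) (auto intro: order_trans)
  finally have "N (sum b {..<K}) \<le> C * lq_norm q K (\<lambda>k. norm (a k))" .
  moreover have "N ((\<Sum>k<K. a k \<cdot> y k) - sum b {..<K}) \<le> \<eta> * lq_norm q K (\<lambda>k. norm (a k))"
    unfolding b_def by (rule combination_error[OF q y(1) \<eta>])
  moreover have "N (\<Sum>k<K. a k \<cdot> y k) \<le> N ((\<Sum>k<K. a k \<cdot> y k) - sum b {..<K}) + N (sum b {..<K})"
    by (intro N_triangle_sub sum_carr scale_carr y b)
  ultimately show ?thesis
    unfolding distrib_right by linarith
qed

lemma lower_estimate_near:
  assumes B: "lower_estimate q B" and q: "0 < q" and A: "disjoint_family A"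
    and y: "\<And>k. y k \<in> V" "\<And>k j i. (j, i) \<notin> B \<Longrightarrow> y k j i = 0" "\<And>k. \<delta> \<le> N (y k)"
    and \<eta>: "0 \<le> \<eta>" "\<And>k. N (y k - res (A k) (y k)) \<le> \<eta> / 2 ^ Suc k" and \<delta>: "\<eta> \<le> \<delta>"
  shows "(\<delta> - 2 * \<eta>) * lq_norm q K (\<lambda>k. norm (a k)) \<le> N (\<Sum>k<K. a k \<cdot> y k)"
proof -
  define b where "b k = a k \<cdot> res (A k) (y k)" for k
  have b: "b k \<in> V" for k
    unfolding b_def by (intro scale_carr res_carr y)
  have "(\<delta> - \<eta>) * lq_norm q K (\<lambda>k. norm (a k)) = lq_norm q K (\<lambda>k. (\<delta> - \<eta>) * norm (a k))"
    using q \<delta> by (intro lq_norm_scale[symmetric]) auto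
  also have "\<dots> \<le> lq_norm q K (\<lambda>k. N (b k))"
  proof (rule lq_norm_mono[OF q])
    fix k
    have "N (b k) = norm (a k) * N (res (A k) (y k))"
      unfolding b_def by (intro N_scale res_carr y)
    moreover have "\<eta> / 2 ^ Suc k \<le> \<eta> / 1"
      using \<eta>(1) two_realpow_ge_one[of "Suc k"] by (intro divide_left_mono) auto
    then have "\<delta> - \<eta> \<le> N (res (A k) (y k))"
      using N_triangle_sub[OF y(1) res_carr[OF y(1)], of k "A k" k] y(3)[of k] \<eta>(2)[of k] by linarith
    ultimately show "0 \<le> (\<delta> - \<eta>) * norm (a k) \<and> (\<delta> - \<eta>) * norm (a k) \<le> N (b k)"
      using \<delta> by (simp add: mult.commute[of "\<delta> - \<eta>"] mult_left_mono)
  qed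
  also have "\<dots> \<le> N (sum b {..<K})"
    by (rule lower_estimateD[OF B A b]) (use y(2) in \<open>auto simp: b_def scl_apply restrict_coords_def\<close>)
  finally have "(\<delta> - \<eta>) * lq_norm q K (\<lambda>k. norm (a k)) \<le> N (sum b {..<K})" .
  moreover have "N ((\<Sum>k<K. a k \<cdot> y k) - sum b {..<K}) \<le> \<eta> * lq_norm q K (\<lambda>k. norm (a k))"
    unfolding b_def by (rule combination_error[OF q y(1) \<eta>])
  moreover have "N (sum b {..<K}) \<le> N (sum b {..<K} - (\<Sum>k<K. a k \<cdot> y k)) + N (\<Sum>k<K. a k \<cdot> y k)"
    by (intro N_triangle_sub sum_carr scale_carr y b)
  moreover have "N (sum b {..<K} - (\<Sum>k<K. a k \<cdot> y k)) = N ((\<Sum>k<K. a k \<cdot> y k) - sum b {..<K})"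
    by (intro N_diff_commute sum_carr scale_carr y b)
  ultimately show ?thesis
    by (simp add: algebra_simps del: minus_apply)
qed

text \<open>
If a coordinate of \<open>T (y m)\<close> did not tend to zero, it would have modulus at least \<open>\<delta>\<close> along a
subsequence of almost disjoint vectors. On a sum of \<open>K\<close> of them, suitably scaled, it would equal \<open>\<delta> K\<close>,
while the norm of the sum is only of order \<open>K powr (1 / q)\<close>.
\<close>

lemma op_coordinate_null:
  assumes T: "T \<in> carr L" and B: "upper_estimate q B" and q: "1 < q" and y: "null_sequence B y"
  shows "(\<lambda>m. T (y m) j i) \<longlonglongrightarrow> 0"
proof (rule ccontr)
  obtain C where C: "\<And>m. N (y m) \<le> C"
    using y by (auto simp: null_sequence_def)
  have yV: "y m \<in> V" and supp: "(j, i) \<notin> B \<Longrightarrow> y m j i = 0" for m j i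
    using y by (auto simp: null_sequence_def)
  have C0: "0 \<le> C"
    using C[of 0] N_nonneg[OF yV[of 0]] by linarith
  obtain M where M: "0 < M" "\<forall>x\<in>V. N (T x) \<le> M * N x"
    using op_bound[OF T] by blast
  assume "\<not> (\<lambda>m. T (y m) j i) \<longlonglongrightarrow> 0"
  then obtain \<delta> s where \<delta>: "0 < \<delta>" and s: "strict_mono (s :: nat \<Rightarrow> nat)"
    and ge: "\<And>k. \<delta> \<le> norm (T (y (s k)) j i)"
    using not_null_subsequence[of "\<lambda>m. T (y m) j i"] by blast
  have null: "(\<lambda>k. y (s k) j i) \<longlonglongrightarrow> 0" for j i
    using y LIMSEQ_subseq_LIMSEQ[OF _ s, of "\<lambda>m. y m j i" 0] by (auto simp: null_sequence_def o_def)
  obtain \<sigma> A where A: "disjoint_family A"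
    and near: "\<And>k. N (y (s (\<sigma> k)) - res (A k) (y (s (\<sigma> k)))) \<le> 1 / 2 ^ Suc k"
    by (rule gliding_hump[OF yV null, of "\<lambda>k. 1 / 2 ^ Suc k"], simp, blast)
  define y' where "y' k = y (s (\<sigma> k))" for k
  \<comment> \<open>These scalars have modulus at most one and make all the values \<open>T (a k \<cdot> y' k) j i\<close> equal to \<open>\<delta>\<close>.\<close>
  define a where "a k = of_real \<delta> / T (y' k) j i" for k
  have ge': "\<delta> \<le> norm (T (y' k) j i)" and nz: "T (y' k) j i \<noteq> 0" for k
    using ge[of "\<sigma> k"] \<delta> by (auto simp: y'_def)
  have a: "norm (a k) \<le> 1" for k
    using ge'[of k] \<delta> nz[of k] by (simp add: a_def norm_divide)
  have "\<delta> * real K powr 1 \<le> M * (C + 1) * real K powr (1 / q)" for K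
  proof -
    define z where "z = (\<Sum>k<K. a k \<cdot> y' k)"
    have z: "z \<in> V"
      unfolding z_def y'_def by (intro sum_carr scale_carr yV)
    have "T z = (\<Sum>k<K. a k \<cdot> T (y' k))"
      unfolding z_def using op_sum[OF T, of "{..<K}" "\<lambda>k. a k \<cdot> y' k"]
      by (simp add: y'_def scale_carr yV op_scale[OF T])
    then have "T z j i = (\<Sum>k<K. a k * T (y' k) j i)"
      by (simp add: sum_apply2 scl_apply)
    also have "\<dots> = (\<Sum>k<K. of_real \<delta>)"
      using nz by (simp add: a_def)
    finally have "\<delta> * real K = norm (T z j i)"
      using \<delta> by (simp add: norm_mult mult.commute)
    also have "\<dots> \<le> N (T z)"
      by (intro coord_le op_carr[OF T] z)
    also have "\<dots> \<le> M * N z"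
      using M z by auto
    also have "\<dots> \<le> M * ((C + 1) * lq_norm q K (\<lambda>k. norm (a k)))"
      unfolding z_def using M(1) q near supp yV C
      by (intro mult_left_mono upper_estimate_near[OF B _ A]) (auto simp: y'_def)
    also have "\<dots> \<le> M * ((C + 1) * lq_norm q K (\<lambda>k. 1))"
      using M(1) C0 a q by (intro mult_left_mono lq_norm_mono) auto
    finally show ?thesis
      using q by (simp add: lq_norm_one mult.assoc)
  qed
  moreover have "1 / q < 1"
    using q by simp
  ultimately show False
    using powr_growth[of "1 / q" 1 \<delta> "M * (C + 1)"] \<delta> by (meson not_le)
qed

text \<open>
If the images did not tend to zero in \<open>D\<close>, a subsequence would be almost disjoint, with almost
disjoint images in \<open>D\<close> that are bounded away from zero. Then
\<open>N (T (\<Sum>a\<^sub>k y\<^sub>k)) \<ge> c \<parallel>a\<parallel>\<^sub>q \<ge> c' N (\<Sum>a\<^sub>k y\<^sub>k)\<close>, and \<open>T\<close> is bounded below on the span.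
\<close>

lemma SS_null_sequence:
  assumes T: "T \<in> SS" and B: "upper_estimate q B" and D: "lower_estimate q D" and q: "1 < q"
    and y: "null_sequence B y"
  shows "(\<lambda>m. N (res D (T (y m)))) \<longlonglongrightarrow> 0"
proof (rule ccontr)
  note TL = SS_op[OF T]
  obtain C where C: "\<And>m. N (y m) \<le> C"
    using y by (auto simp: null_sequence_def)
  have yV: "y m \<in> V" and supp: "(j, i) \<notin> B \<Longrightarrow> y m j i = 0" for m j i
    using y by (auto simp: null_sequence_def)
  have C0: "0 \<le> C"
    using C[of 0] N_nonneg[OF yV[of 0]] by linarith
  obtain M where M: "0 < M" "\<forall>x\<in>V. N (T x) \<le> M * N x"
    using op_bound[OF TL] by blast
  define z where "z m = res D (T (y m))" for m
  have zV: "z m \<in> V" for m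
    unfolding z_def by (intro res_carr op_carr[OF TL] yV)
  assume "\<not> (\<lambda>m. N (res D (T (y m)))) \<longlonglongrightarrow> 0"
  then obtain \<delta> s where \<delta>: "0 < \<delta>" and s: "strict_mono (s :: nat \<Rightarrow> nat)"
    and ge: "\<And>k. \<delta> \<le> norm (N (z (s k)))"
    using not_null_subsequence[of "\<lambda>m. N (z m)"] unfolding z_def by blast
  have null: "(\<lambda>k. y (s k) j i) \<longlonglongrightarrow> 0" for j i
    using y LIMSEQ_subseq_LIMSEQ[OF _ s, of "\<lambda>m. y m j i" 0] by (auto simp: null_sequence_def o_def)
  obtain \<sigma> A where \<sigma>: "strict_mono \<sigma>" and A: "disjoint_family A"
    and near: "\<And>k. N (y (s (\<sigma> k)) - res (A k) (y (s (\<sigma> k)))) \<le> 1 / 2 ^ Suc k"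
    by (rule gliding_hump[OF yV null, of "\<lambda>k. 1 / 2 ^ Suc k"], simp, blast)
  have znull: "(\<lambda>k. z (s (\<sigma> k)) j i) \<longlonglongrightarrow> 0" for j i
  proof -
    have "(\<lambda>m. z m j i) \<longlonglongrightarrow> 0"
      using op_coordinate_null[OF TL B q y, of j i]
      by (cases "(j, i) \<in> D") (simp_all add: z_def restrict_coords_def)
    then show ?thesis
      using LIMSEQ_subseq_LIMSEQ[OF _ strict_mono_o[OF s \<sigma>], of "\<lambda>m. z m j i" 0] by (auto simp: o_def)
  qed
  obtain \<tau> A' where \<tau>: "strict_mono \<tau>" and A': "disjoint_family A'"
    and znear: "\<And>k. N (z (s (\<sigma> (\<tau> k))) - res (A' k) (z (s (\<sigma> (\<tau> k))))) \<le> (\<delta> / 4) / 2 ^ Suc k"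
    by (rule gliding_hump[OF zV znull, of "\<lambda>k. (\<delta> / 4) / 2 ^ Suc k"], use \<delta> in simp, blast)
  define y' where "y' k = y (s (\<sigma> (\<tau> k)))" for k
  define z' where "z' k = z (s (\<sigma> (\<tau> k)))" for k
  have y'V: "y' k \<in> V" for k
    by (simp add: y'_def yV)
  have A\<tau>: "disjoint_family (\<lambda>k. A (\<tau> k))"
    using A \<tau> by (auto simp: disjoint_family_on_def strict_mono_eq)
  have near': "N (y' k - res (A (\<tau> k)) (y' k)) \<le> 1 / 2 ^ Suc k" for k
  proof -
    have "(2::real) ^ Suc k \<le> 2 ^ Suc (\<tau> k)"
      using seq_suble[OF \<tau>, of k] by (intro power_increasing) auto
    then have "1 / 2 ^ Suc (\<tau> k) \<le> (1::real) / 2 ^ Suc k"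
      by (intro divide_left_mono) auto
    then show ?thesis
      using near[of "\<tau> k"] unfolding y'_def by linarith
  qed
  have upper: "N (\<Sum>k<K. a k \<cdot> y' k) \<le> (C + 1) * lq_norm q K (\<lambda>k. norm (a k))" for a K
    using q near' y'V C supp by (intro upper_estimate_near[OF B _ A\<tau>]) (auto simp: y'_def)
  have lower: "\<delta> / 2 * lq_norm q K (\<lambda>k. norm (a k)) \<le> N (T (\<Sum>k<K. a k \<cdot> y' k))" for a K
  proof -
    define w where "w = (\<Sum>k<K. a k \<cdot> y' k)"
    have w: "w \<in> V"
      unfolding w_def by (intro sum_carr scale_carr y'V)
    have "(\<delta> - 2 * (\<delta> / 4)) * lq_norm q K (\<lambda>k. norm (a k)) \<le> N (\<Sum>k<K. a k \<cdot> z' k)"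
      using q znear \<delta> zV ge N_nonneg[OF zV]
      by (intro lower_estimate_near[OF D _ A']) (auto simp: z'_def z_def restrict_coords_def)
    also have "(\<Sum>k<K. a k \<cdot> z' k) = res D (T w)"
      using op_sum[OF TL, of "{..<K}" "\<lambda>k. a k \<cdot> y' k"]
      by (simp add: w_def scale_carr y'V op_scale[OF TL] res_sum res_scale)
        (simp add: z'_def z_def y'_def)
    also have "N (res D (T w)) \<le> N (T w)"
      by (intro N_res op_carr[OF TL] w)
    finally show ?thesis
      by (simp add: w_def)
  qed
  define Z where "Z = vs.span (range y')"
  have Z: "vs.subspace Z" "Z \<subseteq> V"
    using y'V vs.span_minimal[OF _ subspace_V, of "range y'"] by (auto simp: Z_def)
  have "\<not> finite_dim X Z"
    unfolding Z_def
  proof (rule infinite_dim_span[OF y'V, of "\<delta> / 2 / M"])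
    fix a :: "nat \<Rightarrow> 'k" and K k assume k: "k < (K::nat)"
    have "\<delta> / 2 * norm (a k) \<le> \<delta> / 2 * lq_norm q K (\<lambda>k. norm (a k))"
      using \<delta> q k by (intro mult_left_mono le_lq_norm) auto
    also have "\<dots> \<le> N (T (\<Sum>k<K. a k \<cdot> y' k))"
      by (rule lower)
    also have "\<dots> \<le> M * N (\<Sum>k<K. a k \<cdot> y' k)"
      using M(2) sum_carr[of "{..<K}" "\<lambda>k. a k \<cdot> y' k"] scale_carr y'V by blast
    finally show "\<delta> / 2 / M * norm (a k) \<le> N (\<Sum>k<K. a k \<cdot> y' k)"
      using M(1) by (simp add: field_simps)
  qed (use \<delta> M in auto)
  moreover have "bounded_below T Z"
    unfolding bounded_below_def
  proof (intro exI[of _ "\<delta> / 2 * inverse (C + 1)"] conjI ballI)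
    fix z assume "z \<in> Z"
    then obtain K a where z: "z = (\<Sum>k<K. a k \<cdot> y' k)"
      using span_range_explicit[of z y'] unfolding Z_def by blast
    have "\<delta> / 2 * inverse (C + 1) * N z \<le> \<delta> / 2 * inverse (C + 1) * ((C + 1) * lq_norm q K (\<lambda>k. norm (a k)))"
      unfolding z using \<delta> C0 by (intro mult_left_mono upper) auto
    also have "\<dots> = \<delta> / 2 * lq_norm q K (\<lambda>k. norm (a k))"
      using C0 by (simp only: mult.assoc) (simp add: add_nonneg_eq_0_iff flip: mult.assoc)
    also have "\<dots> \<le> N (T z)"
      unfolding z by (rule lower)
    finally show "\<delta> / 2 * inverse (C + 1) * N z \<le> N (T z)" .
  qed (use \<delta> C0 in auto)
  ultimately show False
    using SS_not_bounded_below[OF T] Z by blast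
qed

text \<open>
If \<open>T\<close> were bounded below on \<open>Y\<close>, sums of \<open>K\<close> almost disjoint unit vectors in \<open>Y\<close> would have norm at
least of order \<open>K powr (1 / p)\<close>, and their images at most of order \<open>K powr (1 / q)\<close>.
\<close>

lemma SS_between_estimates:
  assumes T: "T \<in> carr L" and D: "lower_estimate p D" and B: "upper_estimate q B"
    and pq: "0 < p" "p < q"
    and factor: "\<And>x. x \<in> V \<Longrightarrow> N (T x) \<le> N (res D x)"
    and supp: "\<And>x j i. (j, i) \<notin> B \<Longrightarrow> T x j i = 0"
    and null: "\<And>x j i. (\<And>m. x m \<in> V) \<Longrightarrow> (\<And>j i. (\<lambda>m. x m j i) \<longlonglongrightarrow> 0) \<Longrightarrow> (\<lambda>m::nat. T (x m) j i) \<longlonglongrightarrow> 0"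
  shows "T \<in> SS"
  unfolding strictly_singular_iff
proof (intro conjI allI impI notI)
  fix Y assume Y: "Y \<subseteq> V \<and> vs.subspace Y \<and> \<not> finite_dim X Y" and "bounded_below T Y"
  then obtain c where c: "0 < c" "\<And>x. x \<in> Y \<Longrightarrow> c * N x \<le> N (T x)"
    by (auto simp: bounded_below_def)
  have "\<exists>x\<in>Y. N x = 1 \<and> (\<forall>(j, i)\<in>square n. x j i = 0)" for n
  proof -
    define Y' where "Y' = {x \<in> Y. \<forall>(j, i)\<in>square n. x j i = 0}"
    have Y': "vs.subspace Y'" "\<not> finite_dim X Y'" "Y' \<subseteq> V"
      using infinite_dim_vanishing[OF _ _ finite_square[of n], of Y] Y by (auto simp: Y'_def)
    obtain x where "x \<in> Y'" "x \<noteq> 0"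
      using exists_nonzero[OF Y'(1,2)] by blast
    then show ?thesis
      using normalize[OF Y'(1,3)] unfolding Y'_def by blast
  qed
  then obtain x where x: "\<And>n. x n \<in> Y" "\<And>n. N (x n) = 1" "\<And>n. \<forall>(j, i)\<in>square n. x n j i = 0"
    by metis
  have xV: "x n \<in> V" for n
    using x(1) Y by auto
  have TxV: "T (x n) \<in> V" and RxV: "res D (x n) \<in> V" for n
    by (intro op_carr[OF T] res_carr xV)+
  have xnull: "(\<lambda>n. x n j i) \<longlonglongrightarrow> 0" for j i
    by (rule vanishing_null[OF x(3)])
  have Rnull: "(\<lambda>n. res D (x n) j i) \<longlonglongrightarrow> 0" for j i
    using xnull[of j i] by (cases "(j, i) \<in> D") (simp_all add: restrict_coords_def)
  have ge: "c \<le> N (res D (x n))" for n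
    using c(2)[OF x(1)] factor[OF xV] x(2) by (metis mult.right_neutral order_trans)
  obtain \<sigma> A where \<sigma>: "strict_mono \<sigma>" and A: "disjoint_family A"
    and near: "\<And>k. N (res D (x (\<sigma> k)) - res (A k) (res D (x (\<sigma> k)))) \<le> (c / 4) / 2 ^ Suc k"
    by (rule gliding_hump[OF RxV Rnull, of "\<lambda>k. (c / 4) / 2 ^ Suc k"], use c(1) in simp, blast)
  have Tnull: "(\<lambda>n. T (x (\<sigma> n)) j i) \<longlonglongrightarrow> 0" for j i
    using LIMSEQ_subseq_LIMSEQ[OF xnull \<sigma>] by (intro null xV) (auto simp: o_def)
  obtain \<tau> A' where \<tau>: "strict_mono \<tau>" and A': "disjoint_family A'"
    and Tnear: "\<And>k. N (T (x (\<sigma> (\<tau> k))) - res (A' k) (T (x (\<sigma> (\<tau> k))))) \<le> 1 / 2 ^ Suc k"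
    by (rule gliding_hump[OF TxV Tnull, of "\<lambda>k. 1 / 2 ^ Suc k"], simp, blast)
  define x' where "x' k = x (\<sigma> (\<tau> k))" for k
  have x'V: "x' k \<in> V" for k
    by (simp add: x'_def xV)
  have A\<tau>: "disjoint_family (\<lambda>k. A (\<tau> k))"
    using A \<tau> by (auto simp: disjoint_family_on_def strict_mono_eq)
  have near': "N (res D (x' k) - res (A (\<tau> k)) (res D (x' k))) \<le> (c / 4) / 2 ^ Suc k" for k
  proof -
    have "(2::real) ^ Suc k \<le> 2 ^ Suc (\<tau> k)"
      using seq_suble[OF \<tau>, of k] by (intro power_increasing) auto
    then have "(c / 4) / 2 ^ Suc (\<tau> k) \<le> (c / 4) / 2 ^ Suc k"
      using c(1) by (intro divide_left_mono) auto
    then show ?thesis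
      using near[of "\<tau> k"] unfolding x'_def by linarith
  qed
  have TN: "N (T (x' k)) \<le> 1" for k
    using factor[OF x'V] N_res[OF x'V, of D k] x(2) by (metis order_trans x'_def)
  have "c * (c / 2) * real K powr (1 / p) \<le> (1 + 1) * real K powr (1 / q)" for K
  proof -
    define z where "z = (\<Sum>k<K. 1 \<cdot> x' k)"
    have z: "z \<in> V" "z \<in> Y"
      using Y x(1) x'V by (auto simp: z_def x'_def vs.subspace_sum intro!: sum_carr)
    have "(c - 2 * (c / 4)) * lq_norm p K (\<lambda>k. norm (1 :: 'k)) \<le> N (\<Sum>k<K. 1 \<cdot> res D (x' k))"
      using near' c(1) ge RxV pq
      by (intro lower_estimate_near[OF D _ A\<tau>]) (auto simp: x'_def restrict_coords_def)
    also have "(\<Sum>k<K. 1 \<cdot> res D (x' k)) = res D z"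
      by (simp add: z_def res_sum)
    also have "N (res D z) \<le> N z"
      by (rule N_res[OF z(1)])
    finally have "c * (c / 2 * real K powr (1 / p)) \<le> c * N z"
      using pq c(1) by (intro mult_left_mono) (auto simp: lq_norm_one)
    also have "\<dots> \<le> N (T z)"
      by (rule c(2)[OF z(2)])
    also have "T z = (\<Sum>k<K. 1 \<cdot> T (x' k))"
      using op_sum[OF T, of "{..<K}" x'] x'V by (simp add: z_def)
    also have "N \<dots> \<le> (1 + 1) * lq_norm q K (\<lambda>k. norm (1 :: 'k))"
      using pq Tnear TN op_carr[OF T x'V] supp
      by (intro upper_estimate_near[OF B _ A']) (auto simp: x'_def)
    finally show ?thesis
      using pq by (simp add: lq_norm_one mult.assoc)
  qed
  moreover have "1 / q < 1 / p"
    using pq by (simp add: field_simps)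
  ultimately show False
    using powr_growth[of "1 / q" "1 / p" "c * (c / 2)" "1 + 1"] c(1) by (meson not_le mult_pos_pos half_gt_zero)
qed (rule T)

end

section \<open>The direct sum\<close>

locale ell_sum_space =
  fixes p :: "nat \<Rightarrow> real" and r :: ereal
    and X :: "('k::real_normed_field, nat \<Rightarrow> nat \<Rightarrow> 'k) nspace"
  assumes p_mono: "strict_mono p" and p_ge: "\<And>j. 1 \<le> p j" and p_le: "\<And>j. ereal (p j) \<le> r"
    and X_def: "X = ell_sum p r"
begin

definition block_norm :: "(nat \<Rightarrow> nat \<Rightarrow> 'k) \<Rightarrow> nat \<Rightarrow> real" where
  "block_norm x j = ell_norm (ereal (p j)) (x j)"

lemma p_ge': "1 \<le> ereal (p j)"
  using p_ge[of j] by (simp add: one_ereal_def)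

lemma r_ge: "1 \<le> r"
  using p_ge' p_le order_trans by blast

lemma carr_iff: "x \<in> carr X \<longleftrightarrow> (\<forall>j. x j \<in> ell (ereal (p j))) \<and> block_norm x \<in> ell r"
  by (simp add: X_def ell_sum_def block_norm_def[abs_def])

lemma nrm_eq: "nrm X x = ell_norm r (block_norm x)"
  by (simp add: X_def ell_sum_def block_norm_def[abs_def])

lemma smult_eq: "smult X = (\<lambda>c x j i. c * x j i)"
  by (simp add: X_def ell_sum_def)

lemma block_mem: "x \<in> carr X \<Longrightarrow> x j \<in> ell (ereal (p j))"
  by (simp add: carr_iff)

lemma block_norm_nonneg: "x j \<in> ell (ereal (p j)) \<Longrightarrow> 0 \<le> block_norm x j"
  unfolding block_norm_def by (intro ell_norm_nonneg p_ge')

lemma block_norm_le: "x \<in> carr X \<Longrightarrow> block_norm x j \<le> nrm X x"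
  using norm_le_ell_norm[OF r_ge, of "block_norm x" j] block_norm_nonneg[of x j]
  by (simp add: carr_iff nrm_eq)

lemma carr_dominated:
  assumes x: "\<And>j. x j \<in> ell (ereal (p j))" and U: "U \<in> ell r" and le: "\<And>j. block_norm x j \<le> U j"
  shows "x \<in> carr X" and "nrm X x \<le> ell_norm r U"
proof -
  have *: "norm (block_norm x j) \<le> norm (U j)" for j
    using le[of j] block_norm_nonneg[of x j] x[of j] by simp
  show "x \<in> carr X" "nrm X x \<le> ell_norm r U"
    using ell_solid[OF r_ge U *] x by (auto simp: carr_iff nrm_eq)
qed

lemma single_block:
  assumes x: "x j \<in> ell (ereal (p j))" and z: "\<And>l i. l \<noteq> j \<Longrightarrow> x l i = 0"
  shows "x \<in> carr X" and "nrm X x = ell_norm (ereal (p j)) (x j)"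
proof -
  have xl: "x l = (\<lambda>i. 0)" if "l \<noteq> j" for l
    using z[OF that] by auto
  have "block_norm x = (\<lambda>l. if l = j then ell_norm (ereal (p j)) (x j) else 0)"
    by (auto simp: block_norm_def xl ell_norm_zero[OF p_ge'])
  moreover have "x l \<in> ell (ereal (p l))" for l
    using x by (cases "l = j") (auto simp: xl ell_zero[OF p_ge'])
  ultimately show "x \<in> carr X" "nrm X x = ell_norm (ereal (p j)) (x j)"
    using ell_single[OF r_ge, of j "ell_norm (ereal (p j)) (x j)"] ell_norm_nonneg[OF p_ge' x]
    by (auto simp: carr_iff nrm_eq)
qed

sublocale solid_sequence_space X
proof
  show "smult X = (\<lambda>c x j i. c * x j i)"
    by (rule smult_eq)
next
  show "0 \<in> carr X"
    by (rule single_block(1)[of _ 0]) (auto simp: zero_fun_def ell_zero[OF p_ge'])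
next
  fix x y assume xy: "x \<in> carr X" "y \<in> carr X"
  have mem: "(x + y) j \<in> ell (ereal (p j))"
    and le: "block_norm (x + y) j \<le> block_norm x j + block_norm y j" for j
    using ell_triangle[OF p_ge' block_mem[OF xy(1)] block_mem[OF xy(2)], of j]
    by (auto simp: block_norm_def plus_fun_def)
  have U: "(\<lambda>j. block_norm x j + block_norm y j) \<in> ell r"
    "ell_norm r (\<lambda>j. block_norm x j + block_norm y j) \<le> nrm X x + nrm X y"
    using ell_triangle[OF r_ge, of "block_norm x" "block_norm y"] xy by (auto simp: carr_iff nrm_eq)
  show "x + y \<in> carr X"
    by (rule carr_dominated(1)[OF mem U(1) le])
  show "nrm X (x + y) \<le> nrm X x + nrm X y"
    using carr_dominated(2)[OF mem U(1) le] U(2) by linarith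
next
  fix x c assume x: "x \<in> carr X"
  have mem: "smult X c x j \<in> ell (ereal (p j))"
    and le: "block_norm (smult X c x) j \<le> norm c * block_norm x j" for j
    using ell_scale[OF p_ge' block_mem[OF x], where c = c] by (auto simp: block_norm_def smult_eq)
  have U: "(\<lambda>j. norm c * block_norm x j) \<in> ell r"
    "ell_norm r (\<lambda>j. norm c * block_norm x j) \<le> norm c * nrm X x"
    using ell_scale[OF r_ge, of "block_norm x" "norm c"] x by (auto simp: carr_iff nrm_eq)
  show "smult X c x \<in> carr X"
    by (rule carr_dominated(1)[OF mem U(1) le])
  show "nrm X (smult X c x) \<le> norm c * nrm X x"
    using carr_dominated(2)[OF mem U(1) le] U(2) by linarith
next
  fix x y :: "nat \<Rightarrow> nat \<Rightarrow> 'k"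
  assume y: "y \<in> carr X" and le: "\<And>j i. norm (x j i) \<le> norm (y j i)"
  have mem: "x j \<in> ell (ereal (p j))" and le': "block_norm x j \<le> block_norm y j" for j
    using ell_solid[OF p_ge' block_mem[OF y] le] by (auto simp: block_norm_def)
  have U: "block_norm y \<in> ell r"
    using y by (simp add: carr_iff)
  show "x \<in> carr X" "nrm X x \<le> nrm X y"
    using carr_dominated[OF mem U le'] by (auto simp: nrm_eq)
next
  fix x j i assume x: "x \<in> carr X"
  show "norm (x j i) \<le> nrm X x"
    using norm_le_ell_norm[OF p_ge' block_mem[OF x], of j i] block_norm_le[OF x, of j]
    by (simp add: block_norm_def)
next
  fix j i
  have "(unit_vec j i :: nat \<Rightarrow> nat \<Rightarrow> 'k) j = (\<lambda>m. if m = i then 1 else 0)"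
    by (auto simp: unit_vec_def)
  then show "unit_vec j i \<in> carr X" "nrm X (unit_vec j i) = 1"
    using single_block[of "unit_vec j i" j] ell_single[OF p_ge'[of j], of i "1 :: 'k"]
    by (auto simp: unit_vec_def)
next
  fix x assume x: "x \<in> carr X"
  define y where "y n = x - restrict_coords (square n) x" for n
  have y_eq: "y n j = (if j < n then (\<lambda>i. if n \<le> i then x j i else 0) else x j)" for n j
    by (auto simp: y_def restrict_coords_def square_def)
  have le: "\<bar>block_norm (y n) j\<bar> \<le> block_norm x j" for n j
  proof -
    have "norm (y n j i) \<le> norm (x j i)" for i
      by (simp add: y_eq)
    note * = ell_solid[OF p_ge' block_mem[OF x] this]
    then show ?thesis
      using block_norm_nonneg[of "y n" j] by (simp add: block_norm_def)
  qed
  have "(\<lambda>n. ell_norm r (block_norm (y n))) \<longlonglongrightarrow> 0"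
  proof (rule ell_dominated_null[OF r_ge _ le])
    show "block_norm x \<in> ell r"
      using x by (simp add: carr_iff)
    fix j
    have "\<forall>\<^sub>F n in sequentially. ell_norm (ereal (p j)) (\<lambda>i. if n \<le> i then x j i else 0) = block_norm (y n) j"
      by (rule eventually_mono[OF eventually_gt_at_top[of j]]) (simp add: block_norm_def y_eq)
    then show "(\<lambda>n. block_norm (y n) j) \<longlonglongrightarrow> 0"
      by (rule Lim_transform_eventually[OF ell_tail[OF p_ge' block_mem[OF x]]])
  qed
  then show "(\<lambda>n. nrm X (x - restrict_coords (square n) x)) \<longlonglongrightarrow> 0"
    by (simp add: nrm_eq y_def)
qed

text \<open>
Convexity is applied twice: in the blocks, whose exponents \<open>p j\<close> are at least \<open>p b\<close>, where disjointness
identifies the modulus of the sum with a \<open>q\<close>-sum of moduli; and in the outer space, where the block norms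
of different vectors overlap and the full strength of \<open>ell_convexity\<close> is needed.
\<close>

lemma upper_estimate_tail: "upper_estimate (p b) ({b..} \<times> UNIV)"
  unfolding upper_estimate_def
proof (intro allI impI)
  fix A and x :: "nat \<Rightarrow> nat \<Rightarrow> nat \<Rightarrow> 'k" and K :: nat
  assume *: "disjoint_family A \<and> (\<forall>k. x k \<in> V \<and> (\<forall>j i. (j, i) \<notin> A k \<inter> {b..} \<times> UNIV \<longrightarrow> x k j i = 0))"
  then have A: "disjoint_family A" and x: "x k \<in> V" and z: "(j, i) \<notin> A k \<inter> {b..} \<times> UNIV \<Longrightarrow> x k j i = 0" for k j i
    by auto
  define q where "q = p b"
  have q: "1 \<le> q" "0 < q"
    using p_ge[of b] by (auto simp: q_def)
  have S: "sum x {..<K} \<in> V"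
    by (intro sum_carr x)
  define U where "U j = (\<Sum>k<K. block_norm (x k) j powr q) powr (1 / q)" for j
  have bn: "block_norm (x k) \<in> ell r" "0 \<le> block_norm (x k) j" for k j
    using x[of k] block_norm_nonneg by (auto simp: carr_iff)
  have U: "U \<in> ell r" "ell_norm r U \<le> (\<Sum>k<K. nrm X (x k) powr q) powr (1 / q)"
    using ell_convexity[of q r "{..<K}" "\<lambda>k. block_norm (x k)"] q p_le[of b] bn
    by (auto simp: U_def[abs_def] q_def nrm_eq)
  have "block_norm (sum x {..<K}) j \<le> U j" for j
  proof (cases "b \<le> j")
    case False
    then have "sum x {..<K} j = (\<lambda>i. 0)"
      using z by (auto simp: sum_apply2)
    then show ?thesis
      by (simp add: block_norm_def ell_norm_zero[OF p_ge'] U_def)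
  next
    case True
    then have qj: "ereal q \<le> ereal (p j)"
      using p_mono by (auto simp: q_def strict_mono_less_eq)
    have pw: "norm (sum x {..<K} j i) = (\<Sum>k<K. norm (x k j i) powr q) powr (1 / q)" for i
    proof (cases "\<exists>k<K. x k j i \<noteq> 0")
      case True
      then obtain k where k: "k < K" "x k j i \<noteq> 0"
        by auto
      have z': "x l j i = 0" if "l \<noteq> k" for l
      proof -
        have "(j, i) \<in> A k"
          using k z by blast
        then have "(j, i) \<notin> A l"
          using A that by (auto simp: disjoint_family_on_def)
        then show ?thesis
          using z by blast
      qed
      have "(\<Sum>l<K. x l j i) = x k j i" "(\<Sum>l<K. norm (x l j i) powr q) = norm (x k j i) powr q"
        using k z' by (auto simp: sum.remove[of "{..<K}" k])
      then show ?thesis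
        using q by (simp add: sum_apply2 powr_powr)
    qed (auto simp: sum_apply2)
    have "block_norm (sum x {..<K}) j = ell_norm (ereal (p j)) (\<lambda>i. norm (sum x {..<K} j i))"
      by (simp add: block_norm_def ell_norm_of_norm)
    also have "\<dots> \<le> (\<Sum>k<K. ell_norm (ereal (p j)) (\<lambda>i. norm (x k j i)) powr q) powr (1 / q)"
      unfolding pw using q(1) qj block_mem[OF x]
      by (intro ell_convexity(2)) (auto simp: norm_in_ell_iff)
    finally show ?thesis
      by (simp add: ell_norm_of_norm U_def block_norm_def)
  qed
  then have "nrm X (sum x {..<K}) \<le> ell_norm r U"
    by (intro carr_dominated(2)[OF block_mem[OF S] U(1)])
  then show "nrm X (sum x {..<K}) \<le> lq_norm (p b) K (\<lambda>k. nrm X (x k))"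
    using U(2) by (simp add: lq_norm_def q_def)
qed

lemma lower_estimate_block:
  assumes q: "p j \<le> q"
  shows "lower_estimate q ({j} \<times> UNIV)"
  unfolding lower_estimate_def
proof (intro allI impI)
  fix A and x :: "nat \<Rightarrow> nat \<Rightarrow> nat \<Rightarrow> 'k" and K :: nat
  assume *: "disjoint_family A \<and> (\<forall>k. x k \<in> V \<and> (\<forall>l i. (l, i) \<notin> A k \<inter> {j} \<times> UNIV \<longrightarrow> x k l i = 0))"
  then have A: "disjoint_family A" and x: "x k \<in> V" and z: "(l, i) \<notin> A k \<inter> {j} \<times> UNIV \<Longrightarrow> x k l i = 0" for k l i
    by auto
  have N: "nrm X (x k) = ell_norm (ereal (p j)) (x k j)" for k
    using z by (intro single_block(2) block_mem x) auto
  have NS: "nrm X (sum x {..<K}) = ell_norm (ereal (p j)) (sum x {..<K} j)"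
    using z by (intro single_block(2) block_mem sum_carr x) (auto simp: sum_apply2)
  have "(\<Sum>k<K. ell_norm (ereal (p j)) (x k j) powr q) powr (1 / q)
      \<le> ell_norm (ereal (p j)) (\<lambda>i. \<Sum>k<K. x k j i)"
  proof (rule ell_lower_estimate[OF p_ge q])
    fix i k l assume kl: "x k j i \<noteq> 0" "x l j i \<noteq> 0"
    then have "(j, i) \<in> A k \<inter> A l"
      using z by blast
    then show "k = l"
      using A by (auto simp: disjoint_family_on_def)
  qed (auto intro: block_mem x)
  then show "lq_norm q K (\<lambda>k. nrm X (x k)) \<le> nrm X (sum x {..<K})"
    unfolding lq_norm_def N NS by (simp add: sum_apply1)
qed

text \<open>
Both operators vanish outside the carrier, as the encoding of operators demands.
\<close>

definition inclusion :: "nat \<Rightarrow> (nat \<Rightarrow> nat \<Rightarrow> 'k) \<Rightarrow> nat \<Rightarrow> nat \<Rightarrow> 'k" where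
  "inclusion j x = (\<lambda>l i. if x \<in> V \<and> l = Suc j then x j i else 0)"

definition index_shift :: "(nat \<Rightarrow> nat \<Rightarrow> 'k) \<Rightarrow> nat \<Rightarrow> nat \<Rightarrow> 'k" where
  "index_shift x = (\<lambda>l i. if x \<in> V \<and> i \<noteq> 0 then x l (i - 1) else 0)"

lemma inclusion_bound:
  assumes x: "x \<in> V"
  shows "inclusion j x \<in> V" and "N (inclusion j x) \<le> N (res ({j} \<times> UNIV) x)"
proof -
  have eq: "inclusion j x (Suc j) = x j"
    using x by (auto simp: inclusion_def)
  have pp: "p j \<le> p (Suc j)"
    using p_mono by (simp add: strict_mono_less_eq)
  note m = ell_mono_exponent[OF p_ge pp block_mem[OF x]]
  show "inclusion j x \<in> V"
    using m(1) by (intro single_block(1)[of _ "Suc j"]) (simp only: eq, simp add: inclusion_def)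
  have "N (inclusion j x) = ell_norm (ereal (p (Suc j))) (x j)"
    using m(1) single_block(2)[of "inclusion j x" "Suc j"] unfolding eq by (auto simp: inclusion_def)
  moreover have "N (res ({j} \<times> UNIV) x) = ell_norm (ereal (p j)) (x j)"
    using single_block(2)[of "res ({j} \<times> UNIV) x" j] block_mem[OF x, of j]
    by (auto simp: restrict_coords_def)
  ultimately show "N (inclusion j x) \<le> N (res ({j} \<times> UNIV) x)"
    using m(2) by simp
qed

lemma inclusion_op: "inclusion j \<in> carr L"
proof (rule opI[of _ 1])
  fix x assume x: "x \<in> V"
  show "N (inclusion j x) \<le> 1 * N x"
    using inclusion_bound(2)[OF x, of j] N_res[OF x, of "{j} \<times> UNIV"] by linarith
  show "inclusion j x \<in> V"
    by (rule inclusion_bound(1)[OF x])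
qed (auto simp: inclusion_def fun_eq_iff add_carr scale_carr scl_apply)

lemma inclusion_SS: "inclusion j \<in> SS"
proof (rule SS_between_estimates[OF inclusion_op lower_estimate_block upper_estimate_tail])
  show "p j \<le> p j" "0 < p j" "p j < p (Suc j)"
    using p_ge[of j] p_mono by (auto simp: strict_mono_less)
  show "inclusion j x l i = 0" if "(l, i) \<notin> {Suc j..} \<times> UNIV" for x l i
    using that by (auto simp: inclusion_def)
  fix x :: "nat \<Rightarrow> nat \<Rightarrow> nat \<Rightarrow> 'k" and l i
  assume "\<And>m. x m \<in> V" "\<And>j i. (\<lambda>m. x m j i) \<longlonglongrightarrow> 0"
  then show "(\<lambda>m. inclusion j (x m) l i) \<longlonglongrightarrow> 0"
    by (cases "l = Suc j") (simp_all add: inclusion_def)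
qed (rule inclusion_bound(2))

lemma index_shift_op: "index_shift \<in> carr L"
proof (rule opI[of _ 1])
  fix x assume x: "x \<in> V"
  have eq: "index_shift x j = (\<lambda>i. if i = 0 then 0 else x j (i - 1))" for j
    using x by (auto simp: index_shift_def)
  have mem: "index_shift x j \<in> ell (ereal (p j))" and nn: "block_norm (index_shift x) j = block_norm x j" for j
    using ell_shift[OF p_ge' block_mem[OF x], of j] unfolding eq block_norm_def by auto
  have "block_norm (index_shift x) = block_norm x"
    using nn by auto
  then show "index_shift x \<in> V" "N (index_shift x) \<le> 1 * N x"
    using x mem by (auto simp: carr_iff nrm_eq)
qed (auto simp: index_shift_def fun_eq_iff add_carr scale_carr scl_apply)

lemma inclusion_unit: "inclusion j (unit_vec j i) = unit_vec (Suc j) i"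
  by (auto simp: inclusion_def unit_vec_def fun_eq_iff unit_carr[unfolded unit_vec_def])

lemma index_shift_unit: "index_shift (unit_vec j i) = unit_vec j (Suc i)"
  by (auto simp: index_shift_def unit_vec_def fun_eq_iff unit_carr[unfolded unit_vec_def])

section \<open>The chain\<close>

definition odd_part :: "nat \<Rightarrow> (nat \<times> nat) set" where
  "odd_part j = {j} \<times> {i. odd i}"

definition even_part :: "nat \<Rightarrow> (nat \<times> nat) set" where
  "even_part j = {j} \<times> {i. even i}"

text \<open>
The entry of \<open>T\<close> from block \<open>i\<close> to block \<open>j\<close> maps the odd part into the odd part modulo operators that
send the test sequences to norm null sequences.
\<close>

definition parity_respecting :: "nat \<Rightarrow> nat \<Rightarrow> ((nat \<Rightarrow> nat \<Rightarrow> 'k) \<Rightarrow> nat \<Rightarrow> nat \<Rightarrow> 'k) \<Rightarrow> bool" where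
  "parity_respecting i j T \<longleftrightarrow>
    (\<forall>x. null_sequence (odd_part i) x \<longrightarrow> (\<lambda>m. N (res (even_part j) (T (x m)))) \<longlonglongrightarrow> 0)"

definition chain :: "nat \<Rightarrow> ((nat \<Rightarrow> nat \<Rightarrow> 'k) \<Rightarrow> nat \<Rightarrow> nat \<Rightarrow> 'k) set" where
  "chain n = {T \<in> SS. \<forall>i\<ge>1. \<forall>j. i < j \<and> j \<le> i + n \<longrightarrow> parity_respecting i j T}"

lemma chain_0: "chain 0 = SS"
  by (auto simp: chain_def)

lemma chain_Suc_subset: "chain (Suc n) \<subseteq> chain n"
  by (auto simp: chain_def)

lemma chainD:
  assumes "T \<in> chain n" "1 \<le> i" "i < j" "null_sequence (odd_part i) x" "j \<le> i + n"
  shows "(\<lambda>m. N (res (even_part j) (T (x m)))) \<longlonglongrightarrow> 0"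
  using assms unfolding chain_def parity_respecting_def by blast

lemma chain_op: "T \<in> chain n \<Longrightarrow> T \<in> carr L"
  by (auto simp: chain_def SS_op)

lemma null_sequence_carr: "null_sequence B x \<Longrightarrow> x m \<in> V"
  by (simp add: null_sequence_def)

lemma null_sequence_mono: "null_sequence B x \<Longrightarrow> B \<subseteq> B' \<Longrightarrow> null_sequence B' x"
  unfolding null_sequence_def by blast

lemma parity_respecting_add:
  assumes "S \<in> carr L" "T \<in> carr L" "parity_respecting i j S" "parity_respecting i j T"
  shows "parity_respecting i j (S + T)"
  unfolding parity_respecting_def
proof (intro allI impI)
  fix x assume x: "null_sequence (odd_part i) x"
  note xV = null_sequence_carr[OF x]
  have V: "S (x m) \<in> V" "T (x m) \<in> V" for m
    using assms xV op_carr by auto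
  show "(\<lambda>m. N (res (even_part j) ((S + T) (x m)))) \<longlonglongrightarrow> 0"
  proof (rule Lim_null_comparison)
    show "(\<lambda>m. N (res (even_part j) (S (x m))) + N (res (even_part j) (T (x m)))) \<longlonglongrightarrow> 0"
      using assms x by (auto simp: parity_respecting_def intro: tendsto_add_zero)
    show "\<forall>\<^sub>F m in sequentially. norm (N (res (even_part j) ((S + T) (x m))))
        \<le> N (res (even_part j) (S (x m))) + N (res (even_part j) (T (x m)))"
      using triangle[OF res_carr[OF V(1)] res_carr[OF V(2)]] N_nonneg[OF res_carr[OF add_carr[OF V]]]
      by (intro always_eventually allI) (simp add: res_add)
  qed
qed

lemma parity_respecting_scale:
  assumes "T \<in> carr L" "parity_respecting i j T"
  shows "parity_respecting i j (smult L c T)"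
  unfolding parity_respecting_def
proof (intro allI impI)
  fix x assume x: "null_sequence (odd_part i) x"
  have "N (res (even_part j) (smult L c T (x m))) = norm c * N (res (even_part j) (T (x m)))" for m
    using op_carr[OF assms(1) null_sequence_carr[OF x]] by (simp add: smult_L res_scale N_scale res_carr)
  then show "(\<lambda>m. N (res (even_part j) (smult L c T (x m)))) \<longlonglongrightarrow> 0"
    using assms(2) x by (auto simp: parity_respecting_def intro: tendsto_mult_right_zero)
qed

lemma parity_respecting_closed:
  assumes f: "\<And>n. f n \<in> carr L" "\<And>n. parity_respecting i j (f n)" and T: "T \<in> carr L"
    and lim: "(\<lambda>n::nat. nrm L (f n - T)) \<longlonglongrightarrow> 0"
  shows "parity_respecting i j T"
  unfolding parity_respecting_def
proof (intro allI impI)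
  fix x assume x: "null_sequence (odd_part i) x"
  note xV = null_sequence_carr[OF x]
  obtain C where C: "\<And>m. N (x m) \<le> C"
    using x by (auto simp: null_sequence_def)
  have C0: "0 \<le> C"
    using C[of 0] N_nonneg[OF xV[of 0]] by linarith
  show "(\<lambda>m. N (res (even_part j) (T (x m)))) \<longlonglongrightarrow> 0"
  proof (rule LIMSEQ_I)
    fix e :: real assume e: "0 < e"
    then have "0 < e / 2 / (C + 1)"
      using C0 by simp
    then have "\<forall>\<^sub>F n in sequentially. nrm L (f n - T) < e / 2 / (C + 1)"
      using order_tendstoD(2)[OF lim] by simp
    then obtain n where n: "nrm L (f n - T) < e / 2 / (C + 1)"
      using eventually_happens by fastforce
    have "(\<lambda>m. N (res (even_part j) (f n (x m)))) \<longlonglongrightarrow> 0"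
      using f(2) x by (auto simp: parity_respecting_def)
    then have "\<forall>\<^sub>F m in sequentially. N (res (even_part j) (f n (x m))) < e / 2"
      using order_tendstoD(2) e half_gt_zero by metis
    then obtain m0 where m0: "\<And>m. m0 \<le> m \<Longrightarrow> N (res (even_part j) (f n (x m))) < e / 2"
      by (auto simp: eventually_at_top_linorder)
    show "\<exists>m0. \<forall>m\<ge>m0. norm (N (res (even_part j) (T (x m))) - 0) < e"
    proof (intro exI allI impI)
      fix m assume m: "m0 \<le> m"
      have V: "T (x m) \<in> V" "f n (x m) \<in> V"
        using op_carr[OF T xV] op_carr[OF f(1) xV] by auto
      have "N ((f n - T) (x m)) \<le> nrm L (f n - T) * N (x m)"
        by (intro op_norm_bound diff_op f T xV)
      also have "\<dots> \<le> e / 2 / (C + 1) * (C + 1)"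
        using n C[of m] C0 e N_nonneg[OF xV[of m]] by (intro mult_mono) auto
      also have "\<dots> = e / 2"
        using C0 nonzero_mult_div_cancel_right[of "C + 1" "e / 2"] by (simp only: times_divide_eq_left)
      finally have "N (T (x m) - f n (x m)) \<le> e / 2"
        using N_diff_commute[OF V] by (simp only: minus_apply)
      then have "N (res (even_part j) (T (x m) - f n (x m))) \<le> e / 2"
        using N_res[OF diff_carr[OF V]] order_trans by blast
      moreover have "N (res (even_part j) (T (x m))) \<le> N (res (even_part j) (T (x m)) - res (even_part j) (f n (x m)))
          + N (res (even_part j) (f n (x m)))"
        by (intro N_triangle_sub res_carr V)
      ultimately show "norm (N (res (even_part j) (T (x m))) - 0) < e"
        using m0[OF m] N_nonneg[OF res_carr[OF V(1)]] by (simp add: res_diff)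
    qed
  qed
qed

lemma chain_subspace: "subspace_of L (chain n)"
  unfolding subspace_of_def
proof (intro conjI ops.subspaceI)
  show "chain n \<subseteq> carr L"
    using chain_op by blast
  have "parity_respecting i j 0" for i j
    using N_zero by (simp add: parity_respecting_def restrict_coords_def zero_fun_def)
  then show "0 \<in> chain n"
    by (auto simp: chain_def SS_zero)
  show "S + T \<in> chain n" if "S \<in> chain n" "T \<in> chain n" for S T
    using that by (auto simp: chain_def SS_add SS_op intro: parity_respecting_add)
  show "smult L c T \<in> chain n" if "T \<in> chain n" for c T
    using that by (auto simp: chain_def SS_scale SS_op intro: parity_respecting_scale)
qed

lemma chain_closed: "norm_closed L (chain n)"
  unfolding norm_closed_def
proof (intro conjI allI impI)
  show "chain n \<subseteq> carr L"
    using chain_op by blast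
  fix f T assume *: "(\<forall>k. f k \<in> chain n) \<and> T \<in> carr L \<and> (\<lambda>k::nat. nrm L (f k - T)) \<longlonglongrightarrow> 0"
  then have f: "f k \<in> chain n" for k
    by blast
  have "T \<in> SS"
    using SS_closed * unfolding norm_closed_def chain_def by blast
  moreover have "parity_respecting i j T" if "1 \<le> i" "i < j" "j \<le> i + n" for i j
  proof (rule parity_respecting_closed)
    show "f k \<in> carr L" for k
      by (rule chain_op[OF f])
    show "parity_respecting i j (f k)" for k
      using f[of k] that by (auto simp: chain_def)
  qed (use * in auto)
  ultimately show "T \<in> chain n"
    by (auto simp: chain_def)
qed

lemma p_gt: "1 \<le> b \<Longrightarrow> 1 < p b"
  using p_ge[of 0] p_mono by (metis le_less_trans not_one_le_zero strict_mono_less neq0_conv)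

lemma null_sequence_image:
  assumes T: "T \<in> carr L" and x: "null_sequence ({b..} \<times> UNIV) x" and b: "1 \<le> b"
  shows "null_sequence A (\<lambda>m. res A (T (x m)))"
  unfolding null_sequence_def
proof (intro conjI allI impI)
  note xV = null_sequence_carr[OF x]
  fix m j i
  show "res A (T (x m)) \<in> V"
    by (intro res_carr op_carr[OF T] xV)
  show "res A (T (x m)) j i = 0" if "(j, i) \<notin> A"
    using that by (simp add: restrict_coords_def)
next
  note xV = null_sequence_carr[OF x]
  obtain C where C: "\<And>m. N (x m) \<le> C"
    using x by (auto simp: null_sequence_def)
  obtain M where M: "0 < M" "\<forall>x\<in>V. N (T x) \<le> M * N x"
    using op_bound[OF T] by blast
  have "N (res A (T (x m))) \<le> M * C" for m
  proof -
    have "N (res A (T (x m))) \<le> N (T (x m))"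
      by (intro N_res op_carr[OF T] xV)
    also have "\<dots> \<le> M * N (x m)"
      using M xV by blast
    also have "\<dots> \<le> M * C"
      using M C by (intro mult_left_mono) auto
    finally show ?thesis .
  qed
  then show "\<exists>C. \<forall>m. N (res A (T (x m))) \<le> C"
    by blast
next
  fix j i
  show "(\<lambda>m. res A (T (x m)) j i) \<longlonglongrightarrow> 0"
    using op_coordinate_null[OF T upper_estimate_tail p_gt[OF b] x, of j i]
    by (cases "(j, i) \<in> A") (simp_all add: restrict_coords_def)
qed

text \<open>
The triangularity of strictly singular operators: the exponent \<open>p b\<close> serves both for the upper
estimate on the blocks from \<open>b\<close> on and for the lower estimate on an earlier block. The restriction
\<open>1 \<le> b\<close> ensures \<open>1 < p b\<close>, without which operators need not preserve coordinatewise null sequences.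
\<close>

lemma SS_lower_blocks:
  assumes T: "T \<in> SS" and x: "null_sequence ({b..} \<times> UNIV) x" and b: "1 \<le> b" "l \<le> b"
  shows "(\<lambda>m. N (res ({l} \<times> UNIV) (T (x m)))) \<longlonglongrightarrow> 0"
  using b p_mono
  by (intro SS_null_sequence[OF T upper_estimate_tail lower_estimate_block p_gt x]) (auto simp: strict_mono_less_eq)

text \<open>
Cut \<open>T (x m)\<close> into blocks. Blocks up to \<open>i\<close> tend to zero in norm. In a block \<open>l\<close> strictly between \<open>i\<close>
and \<open>j\<close> the even part tends to zero in norm since \<open>l - i \<le> n\<close>, and the odd part is a test sequence for
\<open>S\<close> with \<open>j - l \<le> n\<close>. The blocks from \<open>j\<close> on are mapped by \<open>S\<close> to norm null sequences in block \<open>j\<close>.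
\<close>

lemma chain_product:
  assumes S: "S \<in> chain n" and T: "T \<in> chain n"
  shows "S \<circ> T \<in> chain (Suc n)"
  unfolding chain_def
proof (intro CollectI conjI allI impI)
  have SS: "S \<in> SS" "T \<in> SS" and SL: "S \<in> carr L" and TL: "T \<in> carr L"
    using S T by (auto simp: chain_def SS_op)
  show "S \<circ> T \<in> SS"
    by (intro SS_comp_left SS SL)
  fix i j assume i: "1 \<le> i" and j: "i < j \<and> j \<le> i + Suc n"
  show "parity_respecting i j (S \<circ> T)"
    unfolding parity_respecting_def
  proof (intro allI impI)
    fix x assume x: "null_sequence (odd_part i) x"
    then have x': "null_sequence ({i..} \<times> UNIV) x"
      by (rule null_sequence_mono) (auto simp: odd_part_def)
    define y where "y m = T (x m)" for m
    have yV: "y m \<in> V" for m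
      unfolding y_def by (intro op_carr[OF TL] null_sequence_carr[OF x])
    \<comment> \<open>The pieces of \<open>T (x m)\<close> that \<open>S\<close> maps to sequences negligible on \<open>even_part j\<close>.\<close>
    define G where "G z \<longleftrightarrow> (\<lambda>m. N (res (even_part j) (S (z m)))) \<longlonglongrightarrow> 0" for z :: "nat \<Rightarrow> nat \<Rightarrow> nat \<Rightarrow> 'k"
    have G_norm_null: "G z" if "\<And>m. z m \<in> V" "(\<lambda>m. N (z m)) \<longlonglongrightarrow> 0" for z
      unfolding G_def
    proof (rule Lim_null_comparison)
      show "\<forall>\<^sub>F m in sequentially. norm (N (res (even_part j) (S (z m)))) \<le> N (S (z m))"
        using N_res[OF op_carr[OF SL that(1)]] N_nonneg[OF res_carr[OF op_carr[OF SL that(1)]]]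
        by (intro always_eventually allI) simp
    qed (rule op_zero_null[OF SL that])
    have G_add: "G (\<lambda>m. z m + w m)" if "\<And>m. z m \<in> V" "\<And>m. w m \<in> V" "G z" "G w" for z w
      unfolding G_def
    proof (rule Lim_null_comparison)
      have V: "S (z m) \<in> V" "S (w m) \<in> V" for m
        using that op_carr[OF SL] by auto
      show "(\<lambda>m. N (res (even_part j) (S (z m))) + N (res (even_part j) (S (w m)))) \<longlonglongrightarrow> 0"
        using that by (auto simp: G_def intro: tendsto_add_zero)
      show "\<forall>\<^sub>F m in sequentially. norm (N (res (even_part j) (S (z m + w m))))
          \<le> N (res (even_part j) (S (z m))) + N (res (even_part j) (S (w m)))"
        unfolding op_add[OF SL that(1,2)] res_add
        using triangle[OF res_carr[OF V(1)] res_carr[OF V(2)]]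
          N_nonneg[OF add_carr[OF res_carr[OF V(1)] res_carr[OF V(2)]]]
        by (intro always_eventually allI) simp
    qed
    have G_sum: "G (\<lambda>m. \<Sum>l<K. f l m)" if "\<And>l m. f l m \<in> V" "\<And>l. l < K \<Longrightarrow> G (f l)"
      for K :: nat and f :: "nat \<Rightarrow> nat \<Rightarrow> nat \<Rightarrow> nat \<Rightarrow> 'k"
      using that(2)
    proof (induction K)
      case 0
      show ?case
        unfolding lessThan_0 sum.empty
        by (rule G_norm_null[OF zero_carr]) (simp only: N_zero tendsto_const)
    next
      case (Suc K)
      have "G (\<lambda>m. (\<Sum>l<K. f l m) + f K m)"
        using Suc that(1) by (intro G_add sum_carr) auto
      then show ?case
        unfolding sum.lessThan_Suc .
    qed
    have G_block: "G (\<lambda>m. res ({l} \<times> UNIV) (y m))" if l: "l < j" for l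
    proof (cases "l \<le> i")
      case True
      show ?thesis
        unfolding y_def
        by (rule G_norm_null) (intro res_carr yV[unfolded y_def] SS_lower_blocks[OF SS(2) x' i True])+
    next
      case False
      then have l': "1 \<le> l" "i < l" "l \<le> i + n" "j \<le> l + n"
        using l j i by auto
      have "G (\<lambda>m. res (even_part l) (y m))"
        using T x i l' unfolding y_def
        by (intro G_norm_null res_carr yV[unfolded y_def]) (auto simp: chain_def parity_respecting_def)
      moreover have "G (\<lambda>m. res (odd_part l) (y m))"
        unfolding G_def y_def using l'
        by (intro chainD[OF S _ l null_sequence_image[OF TL x' i]]) auto
      ultimately have "G (\<lambda>m. res (even_part l) (y m) + res (odd_part l) (y m))"
        by (intro G_add res_carr yV)
      moreover have "res (even_part l) (y m) + res (odd_part l) (y m) = res ({l} \<times> UNIV) (y m)" for m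
        by (auto simp: restrict_coords_def even_part_def odd_part_def fun_eq_iff)
      ultimately show ?thesis
        by simp
    qed
    have G_tail: "G (\<lambda>m. res ({j..} \<times> UNIV) (y m))"
      unfolding G_def
    proof (rule Lim_null_comparison)
      have nj: "null_sequence ({j..} \<times> UNIV) (\<lambda>m. res ({j..} \<times> UNIV) (y m))"
        unfolding y_def by (rule null_sequence_image[OF TL x' i])
      show "(\<lambda>m. N (res ({j} \<times> UNIV) (S (res ({j..} \<times> UNIV) (y m))))) \<longlonglongrightarrow> 0"
        using i j by (intro SS_lower_blocks[OF SS(1) nj]) auto
      have V: "S (res ({j..} \<times> UNIV) (y m)) \<in> V" for m
        by (intro op_carr[OF SL] res_carr yV)
      show "\<forall>\<^sub>F m in sequentially. norm (N (res (even_part j) (S (res ({j..} \<times> UNIV) (y m)))))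
          \<le> N (res ({j} \<times> UNIV) (S (res ({j..} \<times> UNIV) (y m))))"
        using N_res_mono[OF V, of "even_part j" "{j} \<times> UNIV"] N_nonneg[OF res_carr[OF V]]
        by (intro always_eventually allI) (auto simp: even_part_def)
    qed
    have decomp: "y m = (\<Sum>l<j. res ({l} \<times> UNIV) (y m)) + res ({j..} \<times> UNIV) (y m)" for m
    proof (intro ext)
      fix l i
      have "(\<Sum>l'<j. res ({l'} \<times> UNIV) (y m) l i) = (\<Sum>l'<j. if l' = l then y m l i else 0)"
        by (rule sum.cong) (auto simp: restrict_coords_def)
      then show "y m l i = ((\<Sum>l<j. res ({l} \<times> UNIV) (y m)) + res ({j..} \<times> UNIV) (y m)) l i"
        by (simp add: sum_apply2) (simp add: restrict_coords_def)
    qed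
    have "G (\<lambda>m. (\<Sum>l<j. res ({l} \<times> UNIV) (y m)) + res ({j..} \<times> UNIV) (y m))"
      by (intro G_add G_sum G_tail G_block sum_carr res_carr yV)
    then have "G y"
      unfolding decomp[symmetric] .
    then show "(\<lambda>m. N (res (even_part j) ((S \<circ> T) (x m)))) \<longlonglongrightarrow> 0"
      by (simp add: G_def y_def)
  qed
qed

lemma inclusion_chain: "inclusion l \<in> chain n"
proof -
  have "parity_respecting i j (inclusion l)" for i j
    unfolding parity_respecting_def
  proof (intro allI impI)
    fix x assume x: "null_sequence (odd_part i) x"
    have "res (even_part j) (inclusion l (x m)) = 0" for m
    proof (intro ext)
      fix j' i'
      have "even i' \<Longrightarrow> x m l i' = 0"
        using x by (auto simp: null_sequence_def odd_part_def)
      then show "res (even_part j) (inclusion l (x m)) j' i' = 0 j' i'"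
        by (auto simp: restrict_coords_def even_part_def inclusion_def)
    qed
    then show "(\<lambda>m. N (res (even_part j) (inclusion l (x m)))) \<longlonglongrightarrow> 0"
      by (simp add: N_zero)
  qed
  then show ?thesis
    by (simp add: chain_def inclusion_SS)
qed

text \<open>
The word \<open>J\<^sub>n\<^sub>+\<^sub>1 \<dots> J\<^sub>2 a J\<^sub>1\<close> from block \<open>1\<close> to block \<open>n + 2\<close>, where \<open>a\<close> is the index shift; it
changes odd indices into even ones.
\<close>

fun shifted_word :: "nat \<Rightarrow> (nat \<Rightarrow> nat \<Rightarrow> 'k) \<Rightarrow> nat \<Rightarrow> nat \<Rightarrow> 'k" where
  "shifted_word 0 = index_shift \<circ> inclusion 1"
| "shifted_word (Suc n) = inclusion (n + 2) \<circ> shifted_word n"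

lemma shifted_word_unit: "shifted_word n (unit_vec 1 i) = unit_vec (n + 2) (Suc i)"
  by (induction n) (simp_all add: inclusion_unit index_shift_unit numeral_2_eq_2)

lemma shifted_word_not_in_chain: "shifted_word n \<notin> chain (Suc n)"
proof
  assume w: "shifted_word n \<in> chain (Suc n)"
  define x :: "nat \<Rightarrow> nat \<Rightarrow> nat \<Rightarrow> 'k" where "x m = unit_vec 1 (2 * m + 1)" for m
  have "null_sequence (odd_part 1) x"
    unfolding null_sequence_def
  proof (intro conjI allI impI)
    show "x m \<in> V" for m
      by (simp add: x_def unit_carr)
    show "x m j i = 0" if "(j, i) \<notin> odd_part 1" for m j i
      using that by (auto simp: x_def unit_vec_def odd_part_def)
    show "\<exists>C. \<forall>m. N (x m) \<le> C"
      by (intro exI[of _ 1]) (simp add: x_def unit_norm)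
    show "(\<lambda>m. x m j i) \<longlonglongrightarrow> 0" for j i
      by (rule tendsto_eventually, rule eventually_mono[OF eventually_gt_at_top[of i]])
        (auto simp: x_def unit_vec_def)
  qed
  moreover have "parity_respecting 1 (n + 2) (shifted_word n)"
    using w by (auto simp: chain_def)
  ultimately have "(\<lambda>m. N (res (even_part (n + 2)) (shifted_word n (x m)))) \<longlonglongrightarrow> 0"
    by (auto simp: parity_respecting_def)
  moreover have "res (even_part (n + 2)) (shifted_word n (x m)) = unit_vec (n + 2) (2 * m + 2)" for m
    unfolding x_def shifted_word_unit
    by (auto simp: restrict_coords_def unit_vec_def even_part_def fun_eq_iff)
  ultimately show False
    using LIMSEQ_unique[OF tendsto_const] by (fastforce simp: unit_norm)
qed

lemma chain_subalgebra: "subalgebra L (chain n)"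
  unfolding subalgebra_def
  using chain_subspace chain_product chain_Suc_subset by (fastforce simp: amult_L)

lemma chain_ideal: "ideal_of L (chain (Suc n)) (chain n)"
  unfolding ideal_of_def
  using chain_subspace chain_product chain_Suc_subset by (fastforce simp: amult_L)

lemma SS_ideal: "ideal_of L SS (carr L)"
  unfolding ideal_of_def
  using chain_subspace[of 0] SS_comp_left SS_comp_right SS_op by (auto simp: amult_L chain_0)

lemma carr_L_subalgebra: "subalgebra L (carr L)"
  unfolding subalgebra_def subspace_of_def
  by (auto simp: amult_L ops.subspace_def zero_op add_op scale_op comp_op)

lemma carr_L_closed: "norm_closed L (carr L)"
  by (auto simp: norm_closed_def)

lemma chain_subideal: "chain n \<in> closed_subideals (Suc n) L"
proof -
  define J where "J k = (if k = 0 then carr L else chain (k - 1))" for k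
  have "ideal_of L (J (Suc k)) (J k)" for k
    using SS_ideal chain_ideal by (cases k) (auto simp: J_def chain_0)
  moreover have "subalgebra L (J k) \<and> norm_closed L (J k)" for k
    by (auto simp: J_def chain_subalgebra chain_closed carr_L_subalgebra carr_L_closed)
  ultimately show ?thesis
    unfolding closed_subideals_def by (intro CollectI exI[of _ J]) (simp add: J_def)
qed

text \<open>
By induction, the \<open>k\<close>-th word lies in the member \<open>J (Suc k)\<close> of any chain of ideals that ends in
\<open>chain (Suc n)\<close>: the first word because \<open>J 0\<close> contains all bounded operators, among them the shift, and
the others because every inclusion lies in all members \<open>J k\<close> with \<open>k \<le> Suc n\<close>.
\<close>

lemma chain_not_subideal: "chain (Suc n) \<notin> closed_subideals (Suc n) L"
proof
  assume "chain (Suc n) \<in> closed_subideals (Suc n) L"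
  then obtain J where J0: "J 0 = carr L" and Jn: "J (Suc n) = chain (Suc n)"
    and ideal: "\<And>k. k < Suc n \<Longrightarrow> ideal_of L (J (Suc k)) (J k)"
    by (auto simp: closed_subideals_def)
  have sub: "chain (Suc n) \<subseteq> J k" if "k \<le> Suc n" for k
    using that
  proof (induction rule: inc_induct)
    case (step k)
    then show ?case
      using ideal[of k] by (auto simp: ideal_of_def)
  qed (simp add: Jn)
  have "shifted_word k \<in> J (Suc k)" if "k \<le> n" for k
    using that
  proof (induction k)
    case 0
    have "inclusion 1 \<in> J (Suc 0)"
      using sub[of "Suc 0"] inclusion_chain by auto
    then show ?case
      using ideal[of 0] index_shift_op unfolding shifted_word.simps J0 ideal_of_def amult_L by blast
  next
    case (Suc k)
    have "inclusion (k + 2) \<in> J (Suc (Suc k))"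
      using sub[of "Suc (Suc k)"] inclusion_chain Suc.prems by auto
    moreover have "shifted_word k \<in> J (Suc k)" "ideal_of L (J (Suc (Suc k))) (J (Suc k))"
      using Suc ideal by auto
    ultimately show ?case
      unfolding shifted_word.simps ideal_of_def amult_L by blast
  qed
  then show False
    using shifted_word_not_in_chain[of n] Jn by auto
qed

end

theorem theorem4p8:
  fixes p :: "nat \<Rightarrow> real" and r :: ereal
    and X :: "('k::{real_normed_field, euclidean_space}, nat \<Rightarrow> nat \<Rightarrow> 'k) nspace"
  assumes "strict_mono p" and "range p \<subseteq> {1..}"
    and "(SUP j. ereal (p j)) \<le> r"
    and "X = ell_sum p r"
  shows "\<exists>M :: nat \<Rightarrow> ((nat \<Rightarrow> nat \<Rightarrow> 'k) \<Rightarrow> (nat \<Rightarrow> nat \<Rightarrow> 'k)) set.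
    (\<forall>n. subalgebra (bounded_operators X) (M n) \<and> norm_closed (bounded_operators X) (M n)) \<and>
    M 0 = strictly_singular X \<and>
    (\<forall>n\<ge>1. M n \<subset> M (n - 1) \<and> ideal_of (bounded_operators X) (M n) (M (n - 1))) \<and>
    (\<forall>n\<ge>1. M n \<in> closed_subideals (n + 1) (bounded_operators X) -
                  closed_subideals n (bounded_operators X))"
proof -
  interpret ell_sum_space p r X
    using assms by unfold_locales (auto simp: SUP_le_iff)
  have "chain n \<subset> chain (n - 1) \<and> ideal_of L (chain n) (chain (n - 1)) \<and>
      chain n \<in> closed_subideals (n + 1) L - closed_subideals n L" if pos: "1 \<le> n" for n
  proof -
    obtain m where n: "n = Suc m"
      using pos by (cases n) auto
    show ?thesis
      using chain_ideal[of m] chain_subideal[of m] chain_subideal[of n] chain_not_subideal[of m]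
        chain_Suc_subset[of m] by (auto simp: n)
  qed
  then show ?thesis
    by (intro exI[of _ chain]) (simp add: chain_0 chain_subalgebra chain_closed)
qed

end
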